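(* Let $\pi:(M^{2(m+n)+1},\phi,\xi,\eta,g_M)\to(N^{m+2n+1},g_N)$ be a conformal anti-invariant $\xi^\perp$-submersion, where $(M,\phi,\xi,\eta,g_M)$ is a Sasakian manifold of dimension $2(m+n)+1$ and $(N,g_N)$ is a Riemannian manifold of dimension $m+2n+1$. Then any two of the conditions below imply the third: (i) $\pi$ is harmonic; (ii) the fibres of $\pi$ are minimal; (iii) $\pi$ is a horizontally homothetic map.
   Context: Everything is smooth. An almost contact metric manifold $(M,\phi,\xi,\eta,g_M)$ is a Riemannian manifold with a $(1,1)$-tensor field $\phi$, a vector field $\xi$ and a 1-form $\eta$ with $\phi\xi=0$, $\eta\circ\phi=0$, $\eta(\xi)=1$, $\phi^2=-I+\eta\otimes\xi$, $g_M(\phi X,\phi Y)=g_M(X,Y)-\eta(X)\eta(Y)$. It is Sasakian (in the sign convention used here) if $(\nabla_X\phi)Y=-g_M(X,Y)\xi+\eta(Y)X$ and $\nabla_X\xi=\phi X$, with $\nabla$ the Levi-Civita connection of $g_M$. A horizontally conformal submersion $\pi:(M,g_M)\to(N,g_N)$ with dilation $\lambda$ ($\lambda$ a positive function on $M$) is a submersion with $\lambda^2g_M(X,Y)=g_N(\pi_*X,\pi_*Y)$ for all $X,Y\in\Gamma((\ker\pi_* )^\perp)$; it is horizontally homothetic if the projection of $\mathrm{grad}\,\lambda$ to $(\ker\pi_* )^\perp$ vanishes. A conformal anti-invariant $\xi^\perp$-submersion is a horizontally conformal submersion from an almost contact metric manifold to a Riemannian manifold such that $\xi$ is normal to $\ker\pi_*$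 and $\phi(\ker\pi_* )\subset(\ker\pi_* )^\perp$. With $\nabla^\pi$ the pullback to $\pi^{-1}TN$ of the Levi-Civita connection of $N$, the second fundamental form of $\pi$ is $(\nabla\pi_* )(X,Y)=\nabla^\pi_X\pi_*Y-\pi_*(\nabla_XY)$, the tension field is $\tau(\pi)=\sum_i(\nabla\pi_* )(e_i,e_i)$ for a local orthonormal frame $\{e_i\}$ of $M$, and $\pi$ is harmonic if $\tau(\pi)=0$.
   Formalization: The case m = 1, n = 0 (dim M = 3, dim N = 2) is excluded: there (i) and (ii) do not imply (iii), e.g. for a Hopf map from the Sasakian 3-sphere onto the 2-sphere with a non-constantly rescaled metric, along a great-circle field orthogonal to ξ. *)

theory Defs
  imports "HOL-Analysis.Analysis"
begin

section \<open>Smooth maps between open subsets of Euclidean spaces\<close>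

text \<open>\<open>C_on k S f\<close> is meant for open \<open>S\<close>: all partial derivatives up to order \<open>k\<close> exist and are
  continuous on \<open>S\<close>.\<close>

primrec C_on :: "nat \<Rightarrow> 'a::euclidean_space set \<Rightarrow> ('a \<Rightarrow> 'b::real_normed_vector) \<Rightarrow> bool" where
  "C_on 0 S f \<longleftrightarrow> continuous_on S f"
| "C_on (Suc k) S f \<longleftrightarrow>
     f differentiable_on S \<and> (\<forall>v. C_on k S (\<lambda>x. frechet_derivative f (at x) v))"

definition smooth_on :: "'a::euclidean_space set \<Rightarrow> ('a \<Rightarrow> 'b::real_normed_vector) \<Rightarrow> bool" where
  "smooth_on S f \<longleftrightarrow> (\<forall>k. C_on k S f)"


section \<open>Smooth manifolds\<close>

text \<open>The underlying space of a manifold is a whole (Hausdorff, second countable) type \<open>'a\<close>;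
  charts take values in a Euclidean space \<open>'e\<close>, so the dimension is \<open>DIM('e)\<close>.
  A chart is a pair of its domain and the coordinate map (which is irrelevant outside the domain).
  Atlases are not required to be maximal.\<close>

type_synonym ('a, 'e) chart = "'a set \<times> ('a \<Rightarrow> 'e)"

definition chart_inv :: "('a, 'e) chart \<Rightarrow> 'e \<Rightarrow> 'a" where
  "chart_inv c = inv_into (fst c) (snd c)"

definition smooth_atlas ::
  "('a::{t2_space,second_countable_topology}, 'e::euclidean_space) chart set \<Rightarrow> bool" where
  "smooth_atlas A \<longleftrightarrow>
     (\<forall>c\<in>A. open (fst c) \<and> open (snd c ` fst c) \<and>
            homeomorphism (fst c) (snd c ` fst c) (snd c) (chart_inv c)) \<and>
     (\<Union>c\<in>A. fst c) = UNIV \<and>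
     (\<forall>c\<in>A. \<forall>d\<in>A. smooth_on (snd c ` (fst c \<inter> fst d)) (snd d \<circ> chart_inv c))"

text \<open>A preferred chart is chosen around every point. The tangent space at \<open>p\<close> is the model
  space \<open>'e\<close>: the vector \<open>v :: 'e\<close> stands for the tangent vector at \<open>p\<close> whose components in
  the preferred chart around \<open>p\<close> are \<open>v\<close>. Its components in any other chart \<open>c\<close> around \<open>p\<close> are
  \<open>components A c p v\<close>. A vector field is thus a function \<open>X :: 'a \<Rightarrow> 'e\<close>; since the preferred
  chart jumps from point to point, its smoothness must be read off from its components in fixed
  charts (\<open>smooth_section\<close> below), and not from \<open>X\<close> as a function into \<open>'e\<close>.\<close>

definition chart_at :: "('a, 'e) chart set \<Rightarrow> 'a \<Rightarrow> ('a, 'e) chart" where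
  "chart_at A p = (SOME c. c \<in> A \<and> p \<in> fst c)"

definition coord_at :: "('a, 'e) chart set \<Rightarrow> 'a \<Rightarrow> 'e" where
  "coord_at A p = snd (chart_at A p) p"

definition deriv_at ::
  "('a, 'e::euclidean_space) chart set \<Rightarrow> ('a \<Rightarrow> 'f::real_normed_vector) \<Rightarrow> 'a \<Rightarrow> 'e \<Rightarrow> 'f" where
  "deriv_at A f p v = frechet_derivative (f \<circ> chart_inv (chart_at A p)) (at (coord_at A p)) v"

definition components ::
  "('a, 'e::euclidean_space) chart set \<Rightarrow> ('a, 'e) chart \<Rightarrow> 'a \<Rightarrow> 'e \<Rightarrow> 'e" where
  "components A c p v = deriv_at A (snd c) p v"

definition differential ::
  "('a, 'e::euclidean_space) chart set \<Rightarrow> ('b, 'k::euclidean_space) chart set \<Rightarrow>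
   ('a \<Rightarrow> 'b) \<Rightarrow> 'a \<Rightarrow> 'e \<Rightarrow> 'k" where
  "differential A B f p v = deriv_at A (snd (chart_at B (f p)) \<circ> f) p v"

definition smooth_fun ::
  "('a::topological_space, 'e::euclidean_space) chart set \<Rightarrow> 'a set \<Rightarrow> ('a \<Rightarrow> real) \<Rightarrow> bool" where
  "smooth_fun A U f \<longleftrightarrow> (\<forall>c\<in>A. smooth_on (snd c ` (U \<inter> fst c)) (f \<circ> chart_inv c))"

definition smooth_map ::
  "('a::topological_space, 'e::euclidean_space) chart set \<Rightarrow>
   ('b::topological_space, 'k::euclidean_space) chart set \<Rightarrow> ('a \<Rightarrow> 'b) \<Rightarrow> bool" where
  "smooth_map A B f \<longleftrightarrow> continuous_on UNIV f \<and>
     (\<forall>c\<in>A. \<forall>d\<in>B. smooth_on (snd c ` (fst c \<inter> f -` fst d)) (snd d \<circ> f \<circ> chart_inv c))"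

text \<open>Smooth sections over \<open>U\<close> of the pullback \<open>f\<^sup>-\<^sup>1TN\<close> of the tangent bundle along \<open>f\<close>:
  \<open>W p\<close> is a tangent vector at \<open>f p\<close>. Vector fields are the case of the identity map.\<close>

definition smooth_section ::
  "('a::topological_space, 'e::euclidean_space) chart set \<Rightarrow>
   ('b::topological_space, 'k::euclidean_space) chart set \<Rightarrow>
   ('a \<Rightarrow> 'b) \<Rightarrow> 'a set \<Rightarrow> ('a \<Rightarrow> 'k) \<Rightarrow> bool" where
  "smooth_section A B f U W \<longleftrightarrow>
     (\<forall>c\<in>A. \<forall>d\<in>B. smooth_on (snd c ` (U \<inter> fst c \<inter> f -` fst d))
        ((\<lambda>p. components B d (f p) (W p)) \<circ> chart_inv c))"

abbreviation smooth_vf ::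
  "('a::topological_space, 'e::euclidean_space) chart set \<Rightarrow> 'a set \<Rightarrow> ('a \<Rightarrow> 'e) \<Rightarrow> bool" where
  "smooth_vf A U X \<equiv> smooth_section A A (\<lambda>p. p) U X"

text \<open>The Lie bracket at \<open>p\<close>, computed in the preferred chart around \<open>p\<close>.\<close>

definition lie_bracket ::
  "('a, 'e::euclidean_space) chart set \<Rightarrow> ('a \<Rightarrow> 'e) \<Rightarrow> ('a \<Rightarrow> 'e) \<Rightarrow> 'a \<Rightarrow> 'e" where
  "lie_bracket A X Y p =
     deriv_at A (\<lambda>q. components A (chart_at A p) q (Y q)) p (X p) -
     deriv_at A (\<lambda>q. components A (chart_at A p) q (X q)) p (Y p)"


section \<open>Riemannian metrics and connections\<close>

definition riemannian_metric ::
  "('a::topological_space, 'e::euclidean_space) chart set \<Rightarrow> ('a \<Rightarrow> 'e \<Rightarrow> 'e \<Rightarrow> real) \<Rightarrow> bool" where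
  "riemannian_metric A g \<longleftrightarrow>
     (\<forall>p. bilinear (g p) \<and> (\<forall>u v. g p u v = g p v u) \<and> (\<forall>v. v \<noteq> 0 \<longrightarrow> g p v v > 0)) \<and>
     (\<forall>U X Y. open U \<and> smooth_vf A U X \<and> smooth_vf A U Y \<longrightarrow>
        smooth_fun A U (\<lambda>p. g p (X p) (Y p)))"

text \<open>A connection on \<open>f\<^sup>-\<^sup>1TN\<close>: \<open>D p v W\<close> is the covariant derivative at \<open>p\<close> in direction \<open>v\<close> of
  a section \<open>W\<close> defined and smooth near \<open>p\<close>. The Leibniz rule implies that it depends only on
  the germ of \<open>W\<close> at \<open>p\<close>. Nothing is said about sections that are not smooth near \<open>p\<close>.\<close>

definition connection_along ::
  "('a::topological_space, 'e::euclidean_space) chart set \<Rightarrow>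
   ('b::topological_space, 'k::euclidean_space) chart set \<Rightarrow>
   ('a \<Rightarrow> 'b) \<Rightarrow> ('a \<Rightarrow> 'e \<Rightarrow> ('a \<Rightarrow> 'k) \<Rightarrow> 'k) \<Rightarrow> bool" where
  "connection_along A B f D \<longleftrightarrow>
     (\<forall>U W. open U \<and> smooth_section A B f U W \<longrightarrow>
        (\<forall>p\<in>U. linear (\<lambda>v. D p v W)) \<and>
        (\<forall>W'. smooth_section A B f U W' \<longrightarrow>
           (\<forall>p\<in>U. \<forall>v. D p v (\<lambda>q. W q + W' q) = D p v W + D p v W')) \<and>
        (\<forall>h. smooth_fun A U h \<longrightarrow>
           (\<forall>p\<in>U. \<forall>v. D p v (\<lambda>q. h q *\<^sub>R W q) = deriv_at A h p v *\<^sub>R W p + h p *\<^sub>R D p v W)) \<and>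
        (\<forall>X. smooth_vf A U X \<longrightarrow> smooth_section A B f U (\<lambda>p. D p (X p) W)))"

definition levi_civita ::
  "('a::topological_space, 'e::euclidean_space) chart set \<Rightarrow> ('a \<Rightarrow> 'e \<Rightarrow> 'e \<Rightarrow> real) \<Rightarrow>
   ('a \<Rightarrow> 'e \<Rightarrow> ('a \<Rightarrow> 'e) \<Rightarrow> 'e) \<Rightarrow> bool" where
  "levi_civita A g D \<longleftrightarrow> connection_along A A (\<lambda>p. p) D \<and>
     (\<forall>U X Y. open U \<and> smooth_vf A U X \<and> smooth_vf A U Y \<longrightarrow>
        (\<forall>p\<in>U. D p (X p) Y - D p (Y p) X = lie_bracket A X Y p) \<and>
        (\<forall>p\<in>U. \<forall>v. deriv_at A (\<lambda>q. g q (X q) (Y q)) p v =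
                      g p (D p v X) (Y p) + g p (X p) (D p v Y)))"

text \<open>The connection on \<open>f\<^sup>-\<^sup>1TN\<close> induced by a connection \<open>DN\<close> of the target: it is determined by
  its values on the sections \<open>W \<circ> f\<close>, which locally span all sections over the smooth functions.\<close>

definition pullback_connection ::
  "('a::topological_space, 'e::euclidean_space) chart set \<Rightarrow>
   ('b::topological_space, 'k::euclidean_space) chart set \<Rightarrow> ('a \<Rightarrow> 'b) \<Rightarrow>
   ('b \<Rightarrow> 'k \<Rightarrow> ('b \<Rightarrow> 'k) \<Rightarrow> 'k) \<Rightarrow> ('a \<Rightarrow> 'e \<Rightarrow> ('a \<Rightarrow> 'k) \<Rightarrow> 'k) \<Rightarrow> bool" where
  "pullback_connection A B f DN D \<longleftrightarrow> connection_along A B f D \<and>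
     (\<forall>V W. open V \<and> smooth_vf B V W \<longrightarrow>
        (\<forall>p\<in>f -` V. \<forall>v. D p v (W \<circ> f) = DN (f p) (differential A B f p v) W))"

definition gradient ::
  "('a, 'e::euclidean_space) chart set \<Rightarrow> ('a \<Rightarrow> 'e \<Rightarrow> 'e \<Rightarrow> real) \<Rightarrow> ('a \<Rightarrow> real) \<Rightarrow> 'a \<Rightarrow> 'e" where
  "gradient A g f p = (THE v. \<forall>w. g p v w = deriv_at A f p w)"

text \<open>\<open>E 0, \<dots>, E (k - 1)\<close> is a local orthonormal frame, defined near \<open>p\<close>, of the distribution \<open>\<Delta>\<close>.\<close>

definition local_orthonormal_frame ::
  "('a::topological_space, 'e::euclidean_space) chart set \<Rightarrow> ('a \<Rightarrow> 'e \<Rightarrow> 'e \<Rightarrow> real) \<Rightarrow>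
   ('a \<Rightarrow> 'e set) \<Rightarrow> 'a \<Rightarrow> nat \<Rightarrow> (nat \<Rightarrow> 'a \<Rightarrow> 'e) \<Rightarrow> bool" where
  "local_orthonormal_frame A g \<Delta> p k E \<longleftrightarrow>
     (\<exists>U. open U \<and> p \<in> U \<and> (\<forall>i<k. smooth_vf A U (E i)) \<and>
        (\<forall>q\<in>U. span ((\<lambda>i. E i q) ` {..<k}) = \<Delta> q \<and>
               (\<forall>i<k. \<forall>j<k. g q (E i q) (E j q) = (if i = j then 1 else 0))))"


section \<open>Sasakian manifolds\<close>

definition almost_contact_metric ::
  "('a::topological_space, 'e::euclidean_space) chart set \<Rightarrow> ('a \<Rightarrow> 'e \<Rightarrow> 'e) \<Rightarrow> ('a \<Rightarrow> 'e) \<Rightarrow>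
   ('a \<Rightarrow> 'e \<Rightarrow> real) \<Rightarrow> ('a \<Rightarrow> 'e \<Rightarrow> 'e \<Rightarrow> real) \<Rightarrow> bool" where
  "almost_contact_metric A \<phi> \<xi> \<eta> g \<longleftrightarrow>
     riemannian_metric A g \<and>
     (\<forall>p. linear (\<phi> p)) \<and> (\<forall>U X. open U \<and> smooth_vf A U X \<longrightarrow> smooth_vf A U (\<lambda>p. \<phi> p (X p))) \<and>
     smooth_vf A UNIV \<xi> \<and>
     (\<forall>p. linear (\<eta> p)) \<and> (\<forall>U X. open U \<and> smooth_vf A U X \<longrightarrow> smooth_fun A U (\<lambda>p. \<eta> p (X p))) \<and>
     (\<forall>p. \<phi> p (\<xi> p) = 0 \<and> \<eta> p (\<xi> p) = 1 \<and>
        (\<forall>u. \<eta> p (\<phi> p u) = 0 \<and> \<phi> p (\<phi> p u) = - u + \<eta> p u *\<^sub>R \<xi> p) \<and>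
        (\<forall>u v. g p (\<phi> p u) (\<phi> p v) = g p u v - \<eta> p u * \<eta> p v))"

text \<open>Here \<open>D\<close> is the Levi-Civita connection of \<open>g\<close>. The sign convention is the one opposite to
  \<open>\<nabla>\<xi> = - \<phi>\<close>; the left-hand side of the first condition is \<open>(\<nabla>\<^sub>X\<phi>)Y\<close>.\<close>

definition sasakian ::
  "('a::topological_space, 'e::euclidean_space) chart set \<Rightarrow> ('a \<Rightarrow> 'e \<Rightarrow> 'e) \<Rightarrow> ('a \<Rightarrow> 'e) \<Rightarrow>
   ('a \<Rightarrow> 'e \<Rightarrow> real) \<Rightarrow> ('a \<Rightarrow> 'e \<Rightarrow> 'e \<Rightarrow> real) \<Rightarrow> ('a \<Rightarrow> 'e \<Rightarrow> ('a \<Rightarrow> 'e) \<Rightarrow> 'e) \<Rightarrow> bool" where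
  "sasakian A \<phi> \<xi> \<eta> g D \<longleftrightarrow>
     almost_contact_metric A \<phi> \<xi> \<eta> g \<and> levi_civita A g D \<and>
     (\<forall>U X Y. open U \<and> smooth_vf A U X \<and> smooth_vf A U Y \<longrightarrow>
        (\<forall>p\<in>U. D p (X p) (\<lambda>q. \<phi> q (Y q)) - \<phi> p (D p (X p) Y) =
                - g p (X p) (Y p) *\<^sub>R \<xi> p + \<eta> p (Y p) *\<^sub>R X p)) \<and>
     (\<forall>p v. D p v \<xi> = \<phi> p v)"


section \<open>Horizontally conformal submersions\<close>

definition vertical ::
  "('a, 'e::euclidean_space) chart set \<Rightarrow> ('b, 'k::euclidean_space) chart set \<Rightarrow>
   ('a \<Rightarrow> 'b) \<Rightarrow> 'a \<Rightarrow> 'e set" where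
  "vertical A B \<pi> p = {v. differential A B \<pi> p v = 0}"

definition horizontal ::
  "('a, 'e::euclidean_space) chart set \<Rightarrow> ('b, 'k::euclidean_space) chart set \<Rightarrow>
   ('a \<Rightarrow> 'e \<Rightarrow> 'e \<Rightarrow> real) \<Rightarrow> ('a \<Rightarrow> 'b) \<Rightarrow> 'a \<Rightarrow> 'e set" where
  "horizontal A B g \<pi> p = {w. \<forall>v \<in> vertical A B \<pi> p. g p w v = 0}"

definition horizontal_proj ::
  "('a, 'e::euclidean_space) chart set \<Rightarrow> ('b, 'k::euclidean_space) chart set \<Rightarrow>
   ('a \<Rightarrow> 'e \<Rightarrow> 'e \<Rightarrow> real) \<Rightarrow> ('a \<Rightarrow> 'b) \<Rightarrow> 'a \<Rightarrow> 'e \<Rightarrow> 'e" where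
  "horizontal_proj A B g \<pi> p u =
     (THE w. w \<in> horizontal A B g \<pi> p \<and> u - w \<in> vertical A B \<pi> p)"

definition submersion ::
  "('a::topological_space, 'e::euclidean_space) chart set \<Rightarrow>
   ('b::topological_space, 'k::euclidean_space) chart set \<Rightarrow> ('a \<Rightarrow> 'b) \<Rightarrow> bool" where
  "submersion A B \<pi> \<longleftrightarrow> smooth_map A B \<pi> \<and> (\<forall>p. surj (differential A B \<pi> p))"

definition horizontally_conformal_submersion ::
  "('a::topological_space, 'e::euclidean_space) chart set \<Rightarrow>
   ('b::topological_space, 'k::euclidean_space) chart set \<Rightarrow>
   ('a \<Rightarrow> 'e \<Rightarrow> 'e \<Rightarrow> real) \<Rightarrow> ('b \<Rightarrow> 'k \<Rightarrow> 'k \<Rightarrow> real) \<Rightarrow> ('a \<Rightarrow> real) \<Rightarrow> ('a \<Rightarrow> 'b) \<Rightarrow> bool" where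
  "horizontally_conformal_submersion A B gM gN \<Lambda> \<pi> \<longleftrightarrow>
     submersion A B \<pi> \<and> smooth_fun A UNIV \<Lambda> \<and> (\<forall>p. \<Lambda> p > 0) \<and>
     (\<forall>p. \<forall>u \<in> horizontal A B gM \<pi> p. \<forall>v \<in> horizontal A B gM \<pi> p.
        (\<Lambda> p)\<^sup>2 * gM p u v = gN (\<pi> p) (differential A B \<pi> p u) (differential A B \<pi> p v))"

definition horizontally_homothetic ::
  "('a, 'e::euclidean_space) chart set \<Rightarrow> ('b, 'k::euclidean_space) chart set \<Rightarrow>
   ('a \<Rightarrow> 'e \<Rightarrow> 'e \<Rightarrow> real) \<Rightarrow> ('a \<Rightarrow> real) \<Rightarrow> ('a \<Rightarrow> 'b) \<Rightarrow> bool" where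
  "horizontally_homothetic A B gM \<Lambda> \<pi> \<longleftrightarrow>
     (\<forall>p. horizontal_proj A B gM \<pi> p (gradient A gM \<Lambda> p) = 0)"

definition conformal_anti_invariant_xi_perp_submersion ::
  "('a::topological_space, 'e::euclidean_space) chart set \<Rightarrow>
   ('b::topological_space, 'k::euclidean_space) chart set \<Rightarrow>
   ('a \<Rightarrow> 'e \<Rightarrow> 'e) \<Rightarrow> ('a \<Rightarrow> 'e) \<Rightarrow> ('a \<Rightarrow> 'e \<Rightarrow> real) \<Rightarrow> ('a \<Rightarrow> 'e \<Rightarrow> 'e \<Rightarrow> real) \<Rightarrow>
   ('b \<Rightarrow> 'k \<Rightarrow> 'k \<Rightarrow> real) \<Rightarrow> ('a \<Rightarrow> real) \<Rightarrow> ('a \<Rightarrow> 'b) \<Rightarrow> bool" where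
  "conformal_anti_invariant_xi_perp_submersion A B \<phi> \<xi> \<eta> gM gN \<Lambda> \<pi> \<longleftrightarrow>
     almost_contact_metric A \<phi> \<xi> \<eta> gM \<and> riemannian_metric B gN \<and>
     horizontally_conformal_submersion A B gM gN \<Lambda> \<pi> \<and>
     (\<forall>p. \<xi> p \<in> horizontal A B gM \<pi> p) \<and>
     (\<forall>p. \<phi> p ` vertical A B \<pi> p \<subseteq> horizontal A B gM \<pi> p)"


section \<open>Harmonic maps and minimal fibres\<close>

text \<open>\<open>(\<nabla>\<pi>\<^sub>*)(X, Y)\<close> at \<open>p\<close>, where \<open>DM\<close> is the Levi-Civita connection of the source and \<open>DP\<close> is
  the pullback of the Levi-Civita connection of the target.\<close>

definition second_fundamental_form ::
  "('a, 'e::euclidean_space) chart set \<Rightarrow> ('b, 'k::euclidean_space) chart set \<Rightarrow>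
   ('a \<Rightarrow> 'e \<Rightarrow> ('a \<Rightarrow> 'e) \<Rightarrow> 'e) \<Rightarrow> ('a \<Rightarrow> 'e \<Rightarrow> ('a \<Rightarrow> 'k) \<Rightarrow> 'k) \<Rightarrow>
   ('a \<Rightarrow> 'b) \<Rightarrow> ('a \<Rightarrow> 'e) \<Rightarrow> ('a \<Rightarrow> 'e) \<Rightarrow> 'a \<Rightarrow> 'k" where
  "second_fundamental_form A B DM DP \<pi> X Y p =
     DP p (X p) (\<lambda>q. differential A B \<pi> q (Y q)) - differential A B \<pi> p (DM p (X p) Y)"

text \<open>In the next two definitions the value at \<open>p\<close> does not depend on the chosen frame, and
  frames exist: around each point the coordinate frame, respectively any local frame of the
  kernel of a submersion, can be orthonormalised.\<close>

definition tension_field ::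
  "('a::topological_space, 'e::euclidean_space) chart set \<Rightarrow>
   ('b::topological_space, 'k::euclidean_space) chart set \<Rightarrow> ('a \<Rightarrow> 'e \<Rightarrow> 'e \<Rightarrow> real) \<Rightarrow>
   ('a \<Rightarrow> 'e \<Rightarrow> ('a \<Rightarrow> 'e) \<Rightarrow> 'e) \<Rightarrow> ('a \<Rightarrow> 'e \<Rightarrow> ('a \<Rightarrow> 'k) \<Rightarrow> 'k) \<Rightarrow> ('a \<Rightarrow> 'b) \<Rightarrow> 'a \<Rightarrow> 'k" where
  "tension_field A B gM DM DP \<pi> p =
     (let E = (SOME E. local_orthonormal_frame A gM (\<lambda>q. UNIV) p (DIM('e)) E)
      in \<Sum>i<DIM('e). second_fundamental_form A B DM DP \<pi> (E i) (E i) p)"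

definition harmonic ::
  "('a::topological_space, 'e::euclidean_space) chart set \<Rightarrow>
   ('b::topological_space, 'k::euclidean_space) chart set \<Rightarrow> ('a \<Rightarrow> 'e \<Rightarrow> 'e \<Rightarrow> real) \<Rightarrow>
   ('a \<Rightarrow> 'e \<Rightarrow> ('a \<Rightarrow> 'e) \<Rightarrow> 'e) \<Rightarrow> ('a \<Rightarrow> 'e \<Rightarrow> ('a \<Rightarrow> 'k) \<Rightarrow> 'k) \<Rightarrow> ('a \<Rightarrow> 'b) \<Rightarrow> bool" where
  "harmonic A B gM DM DP \<pi> \<longleftrightarrow> (\<forall>p. tension_field A B gM DM DP \<pi> p = 0)"

text \<open>Mean curvature vector at \<open>p\<close> of the fibre through \<open>p\<close>: the second fundamental form of the
  fibre in \<open>M\<close> is the horizontal part of \<open>\<nabla>\<^sub>VW\<close> for vertical \<open>V, W\<close>. If the fibres are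
  zero-dimensional the value is \<open>0\<close>.\<close>

definition fibre_mean_curvature ::
  "('a::topological_space, 'e::euclidean_space) chart set \<Rightarrow>
   ('b::topological_space, 'k::euclidean_space) chart set \<Rightarrow> ('a \<Rightarrow> 'e \<Rightarrow> 'e \<Rightarrow> real) \<Rightarrow>
   ('a \<Rightarrow> 'e \<Rightarrow> ('a \<Rightarrow> 'e) \<Rightarrow> 'e) \<Rightarrow> ('a \<Rightarrow> 'b) \<Rightarrow> 'a \<Rightarrow> 'e" where
  "fibre_mean_curvature A B gM DM \<pi> p =
     (let k = dim (vertical A B \<pi> p);
          V = (SOME V. local_orthonormal_frame A gM (vertical A B \<pi>) p k V)
      in (1 / real k) *\<^sub>R (\<Sum>i<k. horizontal_proj A B gM \<pi> p (DM p (V i p) (V i))))"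

definition minimal_fibres ::
  "('a::topological_space, 'e::euclidean_space) chart set \<Rightarrow>
   ('b::topological_space, 'k::euclidean_space) chart set \<Rightarrow> ('a \<Rightarrow> 'e \<Rightarrow> 'e \<Rightarrow> real) \<Rightarrow>
   ('a \<Rightarrow> 'e \<Rightarrow> ('a \<Rightarrow> 'e) \<Rightarrow> 'e) \<Rightarrow> ('a \<Rightarrow> 'b) \<Rightarrow> bool" where
  "minimal_fibres A B gM DM \<pi> \<longleftrightarrow> (\<forall>p. fibre_mean_curvature A B gM DM \<pi> p = 0)"

end

theory Submission
  imports Defs
begin

text \<open>Write \<open>r\<close> for the dimension of \<open>N\<close>, \<open>k\<close> for that of the fibres, \<open>\<lambda>\<close> for the dilation, \<open>\<tau>\<close> for the
  tension field and \<open>\<mu>\<close> for the mean curvature vector of the fibres. The three conditions are tied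
  together by the fundamental equation of a horizontally conformal submersion: for every
  horizontal \<open>Z\<close>,

  \<open>g\<^sub>N(\<tau>, \<pi>\<^sub>* Z) = - (r - 2) \<lambda> Z(\<lambda>) - \<lambda>\<^sup>2 k g\<^sub>M(\<mu>, Z)\<close>

  (lemma \<open>tension_field_formula\<close>). Since \<open>\<pi>\<^sub>*\<close> maps the horizontal space onto the tangent space of \<open>N\<close>,
  the left-hand side vanishes for all \<open>Z\<close> exactly when \<open>\<tau> = 0\<close>; the last term vanishes for all \<open>Z\<close>
  exactly when \<open>\<mu> = 0\<close>; and, as \<open>r = m + 2n + 1\<close> differs from \<open>2\<close>, the middle term vanishes for all \<open>Z\<close>
  exactly when the horizontal gradient of \<open>\<lambda>\<close> does. Hence two of the conditions imply the third.

  The equation comes from splitting the trace of the second fundamental form \<open>S = \<nabla>\<pi>\<^sub>*\<close> along a local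
  orthonormal frame whose first \<open>r\<close> members are horizontal and whose other members are vertical
  (lemma \<open>adapted_frame_exists\<close>).

  \<^item> For vertical \<open>V\<close> we have \<open>\<pi>\<^sub>* V = 0\<close>, so \<open>S(V, V) = - \<pi>\<^sub>*(\<nabla>\<^sub>V V)\<close>, and summing over the vertical part
    of the frame gives \<open>- k \<pi>\<^sub>* \<mu>\<close>.

  \<^item> For horizontal \<open>Y, Z\<close>, differentiating \<open>g\<^sub>N(\<pi>\<^sub>* Y, \<pi>\<^sub>* Z) = \<lambda>\<^sup>2 g\<^sub>M(Y, Z)\<close> along \<open>X\<close> gives
    \<open>g\<^sub>N(S(X, Y), \<pi>\<^sub>* Z) + g\<^sub>N(\<pi>\<^sub>* Y, S(X, Z)) = 2 \<lambda> X(\<lambda>) g\<^sub>M(Y, Z)\<close>. As \<open>S\<close> is symmetric, this determines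
    \<open>g\<^sub>N(S(Y, Y), \<pi>\<^sub>* Z)\<close>, and summing over the horizontal part of the frame gives
    \<open>- (r - 2) \<lambda> Z(\<lambda>)\<close>.

  Three facts are needed to make this work with the tension field and the mean curvature, which are
  computed in frames chosen arbitrarily. The pullback connection is torsion-free along \<open>\<pi>\<close> and metric
  (\<open>D_torsion_free\<close>, \<open>D_metric\<close>), which follows from the same properties on \<open>N\<close> by expanding sections in
  coordinate fields of \<open>N\<close>. The form \<open>S\<close> is tensorial (\<open>second_fundamental_form_tensor\<close>), so its traces do
  not depend on the frame (\<open>trace_on_frame\<close>). Smooth frames exist: the horizontal distribution is
  spanned by the gradients of the coordinates of \<open>\<pi>\<close>, and Gram-Schmidt with smooth coefficients
  orthonormalises these together with any completion to a basis (\<open>smooth_gram_schmidt\<close>).\<close>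

section \<open>Calculus on open subsets of Euclidean spaces\<close>

lemma C_on_subset: "C_on k S f \<Longrightarrow> T \<subseteq> S \<Longrightarrow> C_on k T f"
  by (induction k arbitrary: f) (auto intro: continuous_on_subset differentiable_on_subset)

lemma C_on_cong:
  assumes "open S" "\<And>x. x \<in> S \<Longrightarrow> f x = g x" "C_on k S f"
  shows "C_on k S g"
  using assms(2,3)
proof (induction k arbitrary: f g)
  case 0
  then show ?case using continuous_on_cong[of S S f g] by simp
next
  case (Suc k)
  have d: "f differentiable at x" if "x \<in> S" for x
    using Suc.prems(2) that assms(1) by (simp add: differentiable_on_eq_differentiable_at)
  have e: "frechet_derivative f (at x) = frechet_derivative g (at x)" if "x \<in> S" for x
    by (rule frechet_derivative_transform_within_open[OF d[OF that] assms(1) that]) (use Suc.prems in auto)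
  have "g differentiable at x" if "x \<in> S" for x
    using d[OF that] assms(1) that Suc.prems(1) unfolding differentiable_def
    by (meson has_derivative_transform_within_open)
  moreover have "C_on k S (\<lambda>x. frechet_derivative g (at x) v)" for v
    by (rule Suc.IH[of "\<lambda>x. frechet_derivative f (at x) v"]) (use Suc.prems e in auto)
  ultimately show ?case
    using assms(1) by (simp add: differentiable_on_eq_differentiable_at)
qed

lemma C_on_Suc_D: "C_on (Suc k) S f \<Longrightarrow> C_on k S f"
proof (induction k arbitrary: f)
  case 0
  then show ?case by (simp add: differentiable_imp_continuous_on)
next
  case (Suc k)
  then show ?case by (metis C_on.simps(2))
qed

lemma C_on_SucI:
  assumes "open S" "\<And>x. x \<in> S \<Longrightarrow> (f has_derivative f' x) (at x)" "\<And>v. C_on k S (\<lambda>x. f' x v)"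
  shows "C_on (Suc k) S f"
proof -
  have "frechet_derivative f (at x) = f' x" if "x \<in> S" for x
    using assms(2)[OF that] frechet_derivative_at by metis
  then have "C_on k S (\<lambda>x. frechet_derivative f (at x) v)" for v
    using C_on_cong[OF assms(1) _ assms(3)[of v]] by simp
  moreover have "f differentiable_on S"
    using assms(1,2) by (auto simp: differentiable_on_eq_differentiable_at differentiable_def)
  ultimately show ?thesis by simp
qed

lemma C_on_Suc_has_derivative:
  "open S \<Longrightarrow> C_on (Suc k) S f \<Longrightarrow> x \<in> S \<Longrightarrow> (f has_derivative frechet_derivative f (at x)) (at x)"
  by (auto simp: differentiable_on_eq_differentiable_at frechet_derivative_works)

lemma C_on_const: "C_on k S (\<lambda>x. c)"
  by (induction k arbitrary: c) auto

lemma C_on_bounded_linear_compose: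
  assumes L: "bounded_linear L" and S: "open S" and f: "C_on k S f"
  shows "C_on k S (\<lambda>x. L (f x))"
  using f
proof (induction k arbitrary: f)
  case 0
  then show ?case using L by (simp add: bounded_linear.continuous_on)
next
  case (Suc k)
  show ?case
  proof (rule C_on_SucI[OF S])
    show "((\<lambda>x. L (f x)) has_derivative (\<lambda>v. L (frechet_derivative f (at x) v))) (at x)" if "x \<in> S" for x
      by (rule bounded_linear.has_derivative[OF L C_on_Suc_has_derivative[OF S Suc.prems that]])
    show "C_on k S (\<lambda>x. L (frechet_derivative f (at x) v))" for v
      using Suc by simp
  qed
qed

lemma C_on_add:
  assumes S: "open S" and "C_on k S f" "C_on k S g"
  shows "C_on k S (\<lambda>x. f x + g x)"
  using assms(2,3)
proof (induction k arbitrary: f g)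
  case 0
  then show ?case by (simp add: continuous_on_add)
next
  case (Suc k)
  show ?case
  proof (rule C_on_SucI[OF S])
    show "((\<lambda>x. f x + g x) has_derivative
        (\<lambda>v. frechet_derivative f (at x) v + frechet_derivative g (at x) v)) (at x)" if "x \<in> S" for x
      using C_on_Suc_has_derivative[OF S Suc.prems(1) that] C_on_Suc_has_derivative[OF S Suc.prems(2) that]
      by (rule has_derivative_add)
    show "C_on k S (\<lambda>x. frechet_derivative f (at x) v + frechet_derivative g (at x) v)" for v
      using Suc by simp
  qed
qed

text \<open>The induction closes because the product rule expresses a derivative as a sum of two
  products whose factors are all of class \<open>k\<close>.\<close>

lemma C_on_bilinear:
  assumes P: "bounded_bilinear P" and S: "open S" and "C_on k S f" "C_on k S g"
  shows "C_on k S (\<lambda>x. P (f x) (g x))"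
  using assms(3,4)
proof (induction k arbitrary: f g)
  case 0
  then show ?case using bounded_bilinear.continuous_on[OF P] by simp
next
  case (Suc k)
  show ?case
  proof (rule C_on_SucI[OF S])
    show "((\<lambda>x. P (f x) (g x)) has_derivative
        (\<lambda>v. P (f x) (frechet_derivative g (at x) v) + P (frechet_derivative f (at x) v) (g x))) (at x)"
      if "x \<in> S" for x
      using C_on_Suc_has_derivative[OF S Suc.prems(1) that] C_on_Suc_has_derivative[OF S Suc.prems(2) that]
      by (rule bounded_bilinear.FDERIV[OF P])
    show "C_on k S (\<lambda>x. P (f x) (frechet_derivative g (at x) v) + P (frechet_derivative f (at x) v) (g x))" for v
      using C_on_Suc_D[OF Suc.prems(1)] C_on_Suc_D[OF Suc.prems(2)] Suc.prems
      by (intro C_on_add[OF S] Suc.IH) auto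
  qed
qed

lemma C_on_sum:
  "open S \<Longrightarrow> (\<And>i. i \<in> I \<Longrightarrow> C_on k S (f i)) \<Longrightarrow> C_on k S (\<lambda>x. \<Sum>i\<in>I. f i x)"
  by (induction I rule: infinite_finite_induct) (auto simp: C_on_const C_on_add)

lemma linear_euclidean_expansion:
  assumes "linear L"
  shows "L w = (\<Sum>b\<in>Basis. (w \<bullet> b) *\<^sub>R L b)"
proof -
  have "L w = L (\<Sum>b\<in>Basis. (w \<bullet> b) *\<^sub>R b)"
    by (simp only: euclidean_representation)
  then show ?thesis
    by (simp only: linear_sum[OF assms] linear_cmul[OF assms])
qed

text \<open>In coordinates the chain rule writes a derivative of \<open>g \<circ> f\<close> as a
  sum of products of a derivative of \<open>f\<close> with a derivative of \<open>g\<close> composed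
  with \<open>f\<close>, to which the induction hypothesis, stated for all \<open>g\<close>,
  applies.\<close>

lemma C_on_compose:
  fixes f :: "'a::euclidean_space \<Rightarrow> 'b::euclidean_space" and g :: "'b \<Rightarrow> 'c::real_normed_vector"
  assumes S: "open S" and T: "open T" and fS: "f ` S \<subseteq> T" and "C_on k S f" "C_on k T g"
  shows "C_on k S (\<lambda>x. g (f x))"
  using assms(4,5)
proof (induction k arbitrary: g)
  case 0
  then show ?case using continuous_on_compose2[of T g S f] fS by simp
next
  case (Suc k)
  have lin: "linear (frechet_derivative g (at (f x)))" if "x \<in> S" for x
    using C_on_Suc_has_derivative[OF T Suc.prems(2), of "f x"] that fS has_derivative_linear by blast
  show ?case
  proof (rule C_on_SucI[OF S])
    show "((\<lambda>x. g (f x)) has_derivative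
        (\<lambda>v. \<Sum>b\<in>Basis. (frechet_derivative f (at x) v \<bullet> b) *\<^sub>R frechet_derivative g (at (f x)) b)) (at x)"
      if x: "x \<in> S" for x
    proof -
      have "((\<lambda>x. g (f x)) has_derivative
          (\<lambda>v. frechet_derivative g (at (f x)) (frechet_derivative f (at x) v))) (at x)"
        using has_derivative_compose[OF C_on_Suc_has_derivative[OF S Suc.prems(1) x]
            C_on_Suc_has_derivative[OF T Suc.prems(2), of "f x"]] x fS by auto
      then show ?thesis
        by (rule has_derivative_eq_rhs) (intro ext linear_euclidean_expansion lin x)
    qed
    show "C_on k S (\<lambda>x. \<Sum>b\<in>Basis. (frechet_derivative f (at x) v \<bullet> b) *\<^sub>R
        frechet_derivative g (at (f x)) b)" for v
    proof (intro C_on_sum[OF S] C_on_bilinear[OF bounded_bilinear_scaleR S])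
      fix b :: 'b
      show "C_on k S (\<lambda>x. frechet_derivative f (at x) v \<bullet> b)"
        using Suc.prems(1) by (intro C_on_bounded_linear_compose[OF bounded_linear_inner_left S]) simp
      show "C_on k S (\<lambda>x. frechet_derivative g (at (f x)) b)"
        using Suc.IH[of "\<lambda>y. frechet_derivative g (at y) b"] C_on_Suc_D[OF Suc.prems(1)] Suc.prems(2)
        by simp
    qed
  qed
qed

text \<open>This provides the factor \<open>N powr (-1/2)\<close> by which a vector of squared
  length \<open>N\<close> is normalised. The constant \<open>c\<close> makes the family closed under
  differentiation.\<close>

lemma C_on_powr: "C_on k {0<..} (\<lambda>x::real. c * x powr a)"
proof (induction k arbitrary: c a)
  case 0
  show ?case by (auto intro!: continuous_intros)
next
  case (Suc k)
  show ?case
  proof (rule C_on_SucI)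
    show "((\<lambda>x. c * x powr a) has_derivative (\<lambda>v. v * (c * a) * x powr (a - 1))) (at x)"
      if "x \<in> {0<..}" for x
      using that by (auto intro!: derivative_eq_intros simp: powr_diff field_simps)
    show "C_on k {0<..} (\<lambda>x. v * (c * a) * x powr (a - 1))" for v
      by (rule Suc.IH)
  qed auto
qed

lemma smooth_on_subset: "smooth_on S f \<Longrightarrow> T \<subseteq> S \<Longrightarrow> smooth_on T f"
  unfolding smooth_on_def using C_on_subset by blast

lemma smooth_on_cong: "open S \<Longrightarrow> (\<And>x. x \<in> S \<Longrightarrow> f x = g x) \<Longrightarrow> smooth_on S f \<Longrightarrow> smooth_on S g"
  unfolding smooth_on_def using C_on_cong by metis

lemma smooth_on_const: "smooth_on S (\<lambda>x. c)"
  by (simp add: smooth_on_def C_on_const)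

lemma smooth_on_add: "open S \<Longrightarrow> smooth_on S f \<Longrightarrow> smooth_on S g \<Longrightarrow> smooth_on S (\<lambda>x. f x + g x)"
  by (simp add: smooth_on_def C_on_add)

lemma smooth_on_bilinear:
  "bounded_bilinear P \<Longrightarrow> open S \<Longrightarrow> smooth_on S f \<Longrightarrow> smooth_on S g \<Longrightarrow> smooth_on S (\<lambda>x. P (f x) (g x))"
  by (simp add: smooth_on_def C_on_bilinear)

lemma smooth_on_linear:
  "bounded_linear L \<Longrightarrow> open S \<Longrightarrow> smooth_on S f \<Longrightarrow> smooth_on S (\<lambda>x. L (f x))"
  by (simp add: smooth_on_def C_on_bounded_linear_compose)

lemma smooth_on_sum:
  "open S \<Longrightarrow> (\<And>i. i \<in> I \<Longrightarrow> smooth_on S (f i)) \<Longrightarrow> smooth_on S (\<lambda>x. \<Sum>i\<in>I. f i x)"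
  by (simp add: smooth_on_def C_on_sum)

lemma smooth_on_compose:
  fixes f :: "'a::euclidean_space \<Rightarrow> 'b::euclidean_space"
  shows "open S \<Longrightarrow> open T \<Longrightarrow> f ` S \<subseteq> T \<Longrightarrow> smooth_on S f \<Longrightarrow> smooth_on T g \<Longrightarrow> smooth_on S (\<lambda>x. g (f x))"
  unfolding smooth_on_def by (blast intro: C_on_compose)

lemma smooth_on_powr: "smooth_on {0<..} (\<lambda>x::real. x powr a)"
  using C_on_powr[of _ 1 a] by (simp add: smooth_on_def)

lemma smooth_on_frechet_derivative: "smooth_on S f \<Longrightarrow> smooth_on S (\<lambda>x. frechet_derivative f (at x) v)"
  unfolding smooth_on_def by (metis C_on.simps(2))

lemma smooth_on_has_derivative:
  "open S \<Longrightarrow> smooth_on S f \<Longrightarrow> x \<in> S \<Longrightarrow> (f has_derivative frechet_derivative f (at x)) (at x)"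
  unfolding smooth_on_def using C_on_Suc_has_derivative by blast

lemma smooth_on_differentiable: "open S \<Longrightarrow> smooth_on S f \<Longrightarrow> x \<in> S \<Longrightarrow> f differentiable at x"
  using smooth_on_has_derivative differentiableI by blast

lemma smooth_on_frechet_derivative_along:
  assumes "open S" "smooth_on S f" "smooth_on S w"
  shows "smooth_on S (\<lambda>x. frechet_derivative f (at x) (w x))"
proof (rule smooth_on_cong[OF assms(1)])
  show "smooth_on S (\<lambda>x. \<Sum>b\<in>Basis. (w x \<bullet> b) *\<^sub>R frechet_derivative f (at x) b)"
    using assms by (intro smooth_on_sum smooth_on_bilinear[OF bounded_bilinear_scaleR]
        smooth_on_linear[OF bounded_linear_inner_left] smooth_on_frechet_derivative)
  show "(\<Sum>b\<in>Basis. (w x \<bullet> b) *\<^sub>R frechet_derivative f (at x) b) = frechet_derivative f (at x) (w x)"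
    if "x \<in> S" for x
    using smooth_on_has_derivative[OF assms(1,2) that] linear_euclidean_expansion has_derivative_linear by metis
qed

text \<open>The symmetry of second derivatives: the second difference quotient is symmetric in the
  two directions, and two applications of the mean value theorem express it by either of the mixed
  derivatives at a nearby point.\<close>

lemma second_difference_mean_value:
  fixes f :: "'a::euclidean_space \<Rightarrow> real"
  assumes S: "open S" and f: "C_on 2 S f" and h: "0 < h"
    and sub: "\<And>s t. 0 \<le> s \<Longrightarrow> s \<le> h \<Longrightarrow> 0 \<le> t \<Longrightarrow> t \<le> h \<Longrightarrow> x + s *\<^sub>R u + t *\<^sub>R v \<in> S"
  obtains s t where "0 < s" "s < h" "0 < t" "t < h"
    "f (x + h *\<^sub>R u + h *\<^sub>R v) - f (x + h *\<^sub>R u) - f (x + h *\<^sub>R v) + f x =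
     h * h * frechet_derivative (\<lambda>y. frechet_derivative f (at y) u) (at (x + s *\<^sub>R u + t *\<^sub>R v)) v"
proof -
  let ?Df = "\<lambda>y. frechet_derivative f (at y)"
  let ?D2 = "\<lambda>y. frechet_derivative (\<lambda>y. ?Df y u) (at y)"
  have f2: "C_on (Suc (Suc 0)) S f" using f by (simp add: numeral_2_eq_2)
  then have g1: "C_on (Suc 0) S (\<lambda>y. ?Df y u)" by (metis C_on.simps(2))
  have f': "(f has_derivative ?Df y) (at y)" if "y \<in> S" for y
    using C_on_Suc_has_derivative[OF S f2 that] .
  have g': "((\<lambda>y. ?Df y u) has_derivative ?D2 y) (at y)" if "y \<in> S" for y
    using C_on_Suc_has_derivative[OF S g1 that] .
  have lin: "linear (?Df y)" "linear (?D2 y)" if "y \<in> S" for y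
    using f'[OF that] g'[OF that] has_derivative_linear by blast+
  \<comment> \<open>The second difference is the increment of \<open>G\<close> over the interval
    from \<open>0\<close> to \<open>h\<close>.\<close>
  define G where "G s = f (x + s *\<^sub>R u + h *\<^sub>R v) - f (x + s *\<^sub>R u)" for s
  have line: "((\<lambda>s. x + s *\<^sub>R u + r) has_derivative (\<lambda>d. d *\<^sub>R u)) (at s)" for s r
    by (auto intro!: derivative_eq_intros)
  have fl: "((\<lambda>s. f (x + s *\<^sub>R u + t *\<^sub>R v)) has_real_derivative ?Df (x + s *\<^sub>R u + t *\<^sub>R v) u) (at s)"
    if "0 \<le> s" "s \<le> h" "0 \<le> t" "t \<le> h" for s t
    using has_derivative_compose[OF line[of "t *\<^sub>R v" s] f'[OF sub[OF that]]]
    by (simp add: has_field_derivative_def linear_cmul[OF lin(1)[OF sub[OF that]]] mult_commute_abs)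
  have "\<exists>z. 0 < z \<and> z < h \<and> G h - G 0 =
      (h - 0) * (?Df (x + z *\<^sub>R u + h *\<^sub>R v) u - ?Df (x + z *\<^sub>R u) u)"
  proof (rule MVT2[OF h])
    show "(G has_real_derivative ?Df (x + z *\<^sub>R u + h *\<^sub>R v) u - ?Df (x + z *\<^sub>R u) u) (at z)"
      if "0 \<le> z" "z \<le> h" for z
      unfolding G_def using fl[OF that, of h] fl[OF that, of 0] h by (auto intro!: DERIV_diff)
  qed
  then obtain s where s: "0 < s" "s < h"
    "G h - G 0 = h * (?Df (x + s *\<^sub>R u + h *\<^sub>R v) u - ?Df (x + s *\<^sub>R u) u)" by auto
  have "\<exists>z. 0 < z \<and> z < h \<and> ?Df (x + s *\<^sub>R u + h *\<^sub>R v) u - ?Df (x + s *\<^sub>R u + 0 *\<^sub>R v) u =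
      (h - 0) * ?D2 (x + s *\<^sub>R u + z *\<^sub>R v) v"
  proof (rule MVT2[OF h])
    show "((\<lambda>t. ?Df (x + s *\<^sub>R u + t *\<^sub>R v) u) has_real_derivative ?D2 (x + s *\<^sub>R u + z *\<^sub>R v) v) (at z)"
      if "0 \<le> z" "z \<le> h" for z
    proof -
      have "x + s *\<^sub>R u + z *\<^sub>R v \<in> S" using s that by (intro sub) auto
      moreover have "((\<lambda>t. x + s *\<^sub>R u + t *\<^sub>R v) has_derivative (\<lambda>d. d *\<^sub>R v)) (at z)"
        by (auto intro!: derivative_eq_intros)
      ultimately show ?thesis
        using has_derivative_compose[of "\<lambda>t. x + s *\<^sub>R u + t *\<^sub>R v" "\<lambda>d. d *\<^sub>R v" z UNIV, OF _ g'] lin(2)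
        by (simp add: has_field_derivative_def linear_cmul mult_commute_abs)
    qed
  qed
  then obtain t where t: "0 < t" "t < h" "?Df (x + s *\<^sub>R u + h *\<^sub>R v) u - ?Df (x + s *\<^sub>R u) u =
      h * ?D2 (x + s *\<^sub>R u + t *\<^sub>R v) v" by auto
  show thesis
    by (rule that[OF s(1,2) t(1,2)]) (use s(3) t(3) in \<open>simp add: G_def algebra_simps\<close>)
qed

lemma symmetric_second_derivative:
  fixes f :: "'a::euclidean_space \<Rightarrow> real"
  assumes S: "open S" and f: "C_on 2 S f" and x: "x \<in> S"
  shows "frechet_derivative (\<lambda>y. frechet_derivative f (at y) u) (at x) v =
         frechet_derivative (\<lambda>y. frechet_derivative f (at y) v) (at x) u"
proof -
  define D where "D u v y = frechet_derivative (\<lambda>y. frechet_derivative f (at y) u) (at y) v" for u v y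
  have cont: "isCont (D u v) x" for u v
    using f S x unfolding D_def by (auto simp: numeral_2_eq_2 continuous_on_eq_continuous_at)
  have "\<bar>D u v x - D v u x\<bar> \<le> e" if "e > 0" for e
  proof -
    obtain d1 where d1: "d1 > 0" "\<And>y. dist y x < d1 \<Longrightarrow> dist (D u v y) (D u v x) < e/2"
      using cont[of u v] \<open>e > 0\<close> unfolding continuous_at_eps_delta by (meson half_gt_zero)
    obtain d2 where d2: "d2 > 0" "\<And>y. dist y x < d2 \<Longrightarrow> dist (D v u y) (D v u x) < e/2"
      using cont[of v u] \<open>e > 0\<close> unfolding continuous_at_eps_delta by (meson half_gt_zero)
    obtain d3 where d3: "d3 > 0" "ball x d3 \<subseteq> S" using S x openE by blast
    define d where "d = min d1 (min d2 d3)"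
    have "d > 0" using d1 d2 d3 by (simp add: d_def)
    \<comment> \<open>With this step every point of the parallelogram spanned by \<open>h
      u\<close> and \<open>h v\<close> at \<open>x\<close> lies within distance \<open>d\<close> of
      \<open>x\<close>; the summand \<open>1\<close> avoids a division by zero.\<close>
    define h where "h = d / (2 * (norm u + norm v + 1))"
    have h: "h > 0" unfolding h_def using \<open>d > 0\<close>
      by (intro divide_pos_pos mult_pos_pos) (auto intro: add_nonneg_pos)
    have close: "dist (x + s *\<^sub>R u + t *\<^sub>R v) x < d" if "0 \<le> s" "s \<le> h" "0 \<le> t" "t \<le> h" for s t
    proof -
      have "dist (x + s *\<^sub>R u + t *\<^sub>R v) x \<le> s * norm u + t * norm v"
        using norm_triangle_ineq[of "s *\<^sub>R u" "t *\<^sub>R v"] that by (simp add: dist_norm add.assoc)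
      also have "\<dots> \<le> h * norm u + h * norm v"
        using that by (intro add_mono mult_right_mono) auto
      also have "\<dots> < h * (2 * (norm u + norm v + 1))"
        using h by (simp add: distrib_left add_nonneg_pos add.commute add_strict_increasing2)
      also have "\<dots> = d"
        using add_nonneg_pos[of "norm u + norm v" 1] by (simp add: h_def)
      finally show ?thesis .
    qed
    have sub: "x + s *\<^sub>R u + t *\<^sub>R v \<in> S" if "0 \<le> s" "s \<le> h" "0 \<le> t" "t \<le> h" for s t
      using close[OF that] d3(2) by (auto simp: d_def dist_commute)
    have sub': "x + s *\<^sub>R v + t *\<^sub>R u \<in> S" if "0 \<le> s" "s \<le> h" "0 \<le> t" "t \<le> h" for s t
      using sub[of t s] that by (simp add: algebra_simps)
    obtain s t where st: "0 < s" "s < h" "0 < t" "t < h"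
      "f (x + h *\<^sub>R u + h *\<^sub>R v) - f (x + h *\<^sub>R u) - f (x + h *\<^sub>R v) + f x =
       h * h * D u v (x + s *\<^sub>R u + t *\<^sub>R v)"
      by (rule second_difference_mean_value[OF S f h sub, folded D_def], assumption+)
    obtain s' t' where st': "0 < s'" "s' < h" "0 < t'" "t' < h"
      "f (x + h *\<^sub>R v + h *\<^sub>R u) - f (x + h *\<^sub>R v) - f (x + h *\<^sub>R u) + f x =
       h * h * D v u (x + s' *\<^sub>R v + t' *\<^sub>R u)"
      by (rule second_difference_mean_value[OF S f h sub', folded D_def], assumption+)
    have "h * h * D u v (x + s *\<^sub>R u + t *\<^sub>R v) = h * h * D v u (x + s' *\<^sub>R v + t' *\<^sub>R u)"
      using st(5) st'(5) by (simp add: algebra_simps)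
    then have eq: "D u v (x + s *\<^sub>R u + t *\<^sub>R v) = D v u (x + s' *\<^sub>R v + t' *\<^sub>R u)"
      using h by simp
    have "dist (D u v (x + s *\<^sub>R u + t *\<^sub>R v)) (D u v x) < e/2"
      using close[of s t] st by (intro d1) (auto simp: d_def)
    moreover have "dist (D v u (x + s' *\<^sub>R v + t' *\<^sub>R u)) (D v u x) < e/2"
      using close[of t' s'] st' by (intro d2) (auto simp: d_def algebra_simps)
    ultimately show ?thesis unfolding eq dist_real_def by arith
  qed
  then have "\<bar>D u v x - D v u x\<bar> \<le> 0" by (rule field_le_epsilon[of _ 0, simplified])
  then show ?thesis by (simp add: D_def)
qed

section \<open>Derivatives on a manifold and change of charts\<close>

context
  fixes A :: "('a::{t2_space,second_countable_topology}, 'e::euclidean_space) chart set"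
  assumes A: "smooth_atlas A"
begin

lemma chart_open: "c \<in> A \<Longrightarrow> open (fst c)"
  using A by (auto simp: smooth_atlas_def)

lemma chart_homeomorphism: "c \<in> A \<Longrightarrow> homeomorphism (fst c) (snd c ` fst c) (snd c) (chart_inv c)"
  using A by (auto simp: smooth_atlas_def)

lemma chart_inv_snd: "c \<in> A \<Longrightarrow> q \<in> fst c \<Longrightarrow> chart_inv c (snd c q) = q"
  using chart_homeomorphism homeomorphism_apply1 by blast

lemma chart_image_open:
  assumes c: "c \<in> A" and U: "open U"
  shows "open (snd c ` (U \<inter> fst c))"
proof -
  have "openin (top_of_set (snd c ` fst c)) (snd c ` (U \<inter> fst c))"
    by (rule homeomorphism_imp_open_map[OF chart_homeomorphism[OF c]]) (use U in \<open>auto simp: openin_open\<close>)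
  moreover have "open (snd c ` fst c)" using A c by (auto simp: smooth_atlas_def)
  ultimately show ?thesis by (simp add: openin_open_eq)
qed

lemma chart_at_mem: "chart_at A p \<in> A" "p \<in> fst (chart_at A p)"
proof -
  have "p \<in> (\<Union>c\<in>A. fst c)" using A by (simp add: smooth_atlas_def)
  then have "\<exists>c. c \<in> A \<and> p \<in> fst c" by blast
  then have "chart_at A p \<in> A \<and> p \<in> fst (chart_at A p)" unfolding chart_at_def by (rule someI_ex)
  then show "chart_at A p \<in> A" "p \<in> fst (chart_at A p)" by auto
qed

lemma transition_smooth:
  "c \<in> A \<Longrightarrow> d \<in> A \<Longrightarrow> smooth_on (snd c ` (fst c \<inter> fst d)) (snd d \<circ> chart_inv c)"
  using A by (auto simp: smooth_atlas_def)

lemma transition_open: "c \<in> A \<Longrightarrow> d \<in> A \<Longrightarrow> open (snd c ` (fst c \<inter> fst d))"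
  using chart_image_open[of c "fst d"] chart_open[of d] by (simp add: Int_commute)

lemma transition_has_derivative:
  assumes "c \<in> A" "d \<in> A" "q \<in> fst c" "q \<in> fst d"
  shows "((snd d \<circ> chart_inv c) has_derivative frechet_derivative (snd d \<circ> chart_inv c) (at (snd c q)))
    (at (snd c q))"
  by (rule smooth_on_has_derivative[OF transition_open transition_smooth]) (use assms in auto)

text \<open>The preferred chart jumps from point to point, whereas derivatives of fields have to
  be taken in a fixed chart; this lemma and its consequence \<open>deriv_at_chart\<close> mediate
  between the two.\<close>

lemma has_derivative_change_chart:
  assumes cd: "c \<in> A" "d \<in> A" and q: "q \<in> fst c" "q \<in> fst d"
    and f: "(f \<circ> chart_inv d has_derivative f') (at (snd d q))"
  shows "(f \<circ> chart_inv c has_derivative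
    (\<lambda>v. f' (frechet_derivative (snd d \<circ> chart_inv c) (at (snd c q)) v))) (at (snd c q))"
proof (rule has_derivative_transform_within_open)
  have "(snd d \<circ> chart_inv c) (snd c q) = snd d q"
    using cd q by (simp add: chart_inv_snd)
  then show "((\<lambda>y. (f \<circ> chart_inv d) ((snd d \<circ> chart_inv c) y)) has_derivative
      (\<lambda>v. f' (frechet_derivative (snd d \<circ> chart_inv c) (at (snd c q)) v))) (at (snd c q))"
    using has_derivative_compose[OF transition_has_derivative[OF cd q], of "f \<circ> chart_inv d" f'] f by simp
  show "open (snd c ` (fst c \<inter> fst d))" by (rule transition_open[OF cd])
  show "snd c q \<in> snd c ` (fst c \<inter> fst d)" using q by blast
  show "(f \<circ> chart_inv d) ((snd d \<circ> chart_inv c) y) = (f \<circ> chart_inv c) y"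
    if "y \<in> snd c ` (fst c \<inter> fst d)" for y
    using that cd by (auto simp: chart_inv_snd)
qed

end

text \<open>Differentiability at \<open>p\<close> is read in the preferred chart, like
  \<open>deriv_at\<close>; by \<open>diff_at_chart_iff\<close> every chart around \<open>p\<close>
  gives the same notion.\<close>

definition diff_at ::
  "('a, 'e::euclidean_space) chart set \<Rightarrow> ('a \<Rightarrow> 'f::real_normed_vector) \<Rightarrow> 'a \<Rightarrow> bool" where
  "diff_at A f p \<longleftrightarrow> (f \<circ> chart_inv (chart_at A p)) differentiable (at (coord_at A p))"

lemma deriv_at_has_derivative:
  "diff_at A f p \<Longrightarrow> (f \<circ> chart_inv (chart_at A p) has_derivative deriv_at A f p) (at (coord_at A p))"
  unfolding diff_at_def deriv_at_def[abs_def] by (simp add: frechet_derivative_works)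

lemma deriv_atI:
  assumes "(f \<circ> chart_inv (chart_at A p) has_derivative f') (at (coord_at A p))"
  shows "diff_at A f p" "deriv_at A f p = f'"
  using assms frechet_derivative_at[OF assms] unfolding diff_at_def deriv_at_def[abs_def]
  by (auto simp: differentiable_def)

lemma linear_deriv_at: "diff_at A f p \<Longrightarrow> linear (deriv_at A f p)"
  by (rule has_derivative_linear[OF deriv_at_has_derivative])

lemma deriv_at_const: "diff_at A (\<lambda>q. c) p" "deriv_at A (\<lambda>q. c) p v = 0"
proof -
  have "((\<lambda>q. c) \<circ> chart_inv (chart_at A p) has_derivative (\<lambda>v. 0)) (at (coord_at A p))"
    by (simp add: o_def)
  from deriv_atI[OF this] show "diff_at A (\<lambda>q. c) p" "deriv_at A (\<lambda>q. c) p v = 0" by auto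
qed

lemma deriv_at_bilinear:
  assumes "bounded_bilinear P" "diff_at A f p" "diff_at A g p" "smooth_atlas A"
  shows "diff_at A (\<lambda>q. P (f q) (g q)) p"
    "deriv_at A (\<lambda>q. P (f q) (g q)) p v = P (f p) (deriv_at A g p v) + P (deriv_at A f p v) (g p)"
proof -
  have p: "chart_inv (chart_at A p) (coord_at A p) = p"
    unfolding coord_at_def using chart_inv_snd chart_at_mem assms(4) by metis
  have "((\<lambda>q. P (f q) (g q)) \<circ> chart_inv (chart_at A p) has_derivative
      (\<lambda>v. P (f p) (deriv_at A g p v) + P (deriv_at A f p v) (g p))) (at (coord_at A p))"
    using bounded_bilinear.FDERIV[OF assms(1) deriv_at_has_derivative[OF assms(2)]
        deriv_at_has_derivative[OF assms(3)]] by (simp add: o_def p)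
  from deriv_atI[OF this] show "diff_at A (\<lambda>q. P (f q) (g q)) p"
    "deriv_at A (\<lambda>q. P (f q) (g q)) p v = P (f p) (deriv_at A g p v) + P (deriv_at A f p v) (g p)" by auto
qed

lemma deriv_at_compose:
  assumes "diff_at A u p" "(g has_derivative g') (at (u p))" "smooth_atlas A"
  shows "diff_at A (\<lambda>q. g (u q)) p" "deriv_at A (\<lambda>q. g (u q)) p v = g' (deriv_at A u p v)"
proof -
  have p: "chart_inv (chart_at A p) (coord_at A p) = p"
    unfolding coord_at_def using chart_inv_snd chart_at_mem assms(3) by metis
  have "((\<lambda>q. g (u q)) \<circ> chart_inv (chart_at A p) has_derivative (\<lambda>v. g' (deriv_at A u p v)))
      (at (coord_at A p))"
    using has_derivative_compose[OF deriv_at_has_derivative[OF assms(1)], of g g'] assms(2)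
    by (simp add: o_def p)
  from deriv_atI[OF this] show "diff_at A (\<lambda>q. g (u q)) p"
    "deriv_at A (\<lambda>q. g (u q)) p v = g' (deriv_at A u p v)" by auto
qed

lemma deriv_at_bounded_linear:
  assumes "bounded_linear L" "diff_at A u p" "smooth_atlas A"
  shows "diff_at A (\<lambda>q. L (u q)) p" "deriv_at A (\<lambda>q. L (u q)) p v = L (deriv_at A u p v)"
  using deriv_at_compose[OF assms(2) bounded_linear_imp_has_derivative[OF assms(1)] assms(3)] by auto

lemma deriv_at_inner:
  assumes "diff_at A u p" "smooth_atlas A"
  shows "diff_at A (\<lambda>q. u q \<bullet> b) p" "deriv_at A (\<lambda>q. u q \<bullet> b) p v = deriv_at A u p v \<bullet> b"
  using deriv_at_bounded_linear[OF bounded_linear_inner_left assms] by auto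

lemma deriv_at_add:
  assumes "diff_at A f p" "diff_at A g p"
  shows "diff_at A (\<lambda>q. f q + g q) p"
    "deriv_at A (\<lambda>q. f q + g q) p v = deriv_at A f p v + deriv_at A g p v"
proof -
  have "((\<lambda>q. f q + g q) \<circ> chart_inv (chart_at A p) has_derivative
      (\<lambda>v. deriv_at A f p v + deriv_at A g p v)) (at (coord_at A p))"
    using has_derivative_add[OF deriv_at_has_derivative[OF assms(1)]
        deriv_at_has_derivative[OF assms(2)]] by (simp add: o_def)
  from deriv_atI[OF this] show "diff_at A (\<lambda>q. f q + g q) p"
    "deriv_at A (\<lambda>q. f q + g q) p v = deriv_at A f p v + deriv_at A g p v" by auto
qed

lemma deriv_at_sum:
  assumes "\<And>i. i \<in> I \<Longrightarrow> diff_at A (f i) p"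
  shows "diff_at A (\<lambda>q. \<Sum>i\<in>I. f i q) p \<and>
    deriv_at A (\<lambda>q. \<Sum>i\<in>I. f i q) p v = (\<Sum>i\<in>I. deriv_at A (f i) p v)"
  using assms
  by (induction I rule: infinite_finite_induct) (auto simp: deriv_at_const deriv_at_add)

lemma deriv_at_mult:
  fixes f g :: "'a::{t2_space,second_countable_topology} \<Rightarrow> real"
  assumes "diff_at A f p" "diff_at A g p" "smooth_atlas A"
  shows "diff_at A (\<lambda>q. f q * g q) p"
    "deriv_at A (\<lambda>q. f q * g q) p v = f p * deriv_at A g p v + deriv_at A f p v * g p"
  using deriv_at_bilinear[OF bounded_bilinear_mult assms] by auto

context
  fixes A :: "('a::{t2_space,second_countable_topology}, 'e::euclidean_space) chart set"
  assumes A: "smooth_atlas A"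
begin

lemma diff_at_cong:
  assumes U: "open U" "p \<in> U" and eq: "\<And>q. q \<in> U \<Longrightarrow> f q = g q" and f: "diff_at A f p"
  shows "diff_at A g p" "deriv_at A g p v = deriv_at A f p v"
proof -
  let ?c = "chart_at A p"
  note c = chart_at_mem[OF A, of p]
  have "(g \<circ> chart_inv ?c has_derivative deriv_at A f p) (at (coord_at A p))"
  proof (rule has_derivative_transform_within_open[OF deriv_at_has_derivative[OF f]
        chart_image_open[OF A c(1) U(1)]])
    show "coord_at A p \<in> snd ?c ` (U \<inter> fst ?c)" unfolding coord_at_def using U c by blast
    show "(f \<circ> chart_inv ?c) y = (g \<circ> chart_inv ?c) y" if "y \<in> snd ?c ` (U \<inter> fst ?c)" for y
      using that eq c by (auto simp: chart_inv_snd[OF A])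
  qed
  from deriv_atI[OF this] show "diff_at A g p" "deriv_at A g p v = deriv_at A f p v" by auto
qed

lemma diff_at_chart_iff:
  assumes "c \<in> A" "p \<in> fst c"
  shows "diff_at A f p \<longleftrightarrow> (f \<circ> chart_inv c) differentiable (at (snd c p))"
  unfolding diff_at_def coord_at_def differentiable_def
  using has_derivative_change_chart[OF A] assms chart_at_mem[OF A] by metis

lemma deriv_at_chart:
  assumes "c \<in> A" "p \<in> fst c" "diff_at A f p"
  shows "deriv_at A f p v = frechet_derivative (f \<circ> chart_inv c) (at (snd c p)) (components A c p v)"
proof -
  have "(f \<circ> chart_inv c has_derivative frechet_derivative (f \<circ> chart_inv c) (at (snd c p))) (at (snd c p))"
    using assms diff_at_chart_iff[OF assms(1,2), of f] by (simp add: frechet_derivative_works[symmetric])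
  from has_derivative_change_chart[OF A chart_at_mem(1)[OF A] assms(1) chart_at_mem(2)[OF A] assms(2) this]
  show ?thesis
    unfolding components_def coord_at_def[symmetric] by (simp add: deriv_atI deriv_at_def)
qed

lemma diff_at_chart: "c \<in> A \<Longrightarrow> p \<in> fst c \<Longrightarrow> diff_at A (snd c) p"
  using transition_has_derivative[OF A chart_at_mem(1)[OF A], of c p] chart_at_mem(2)[OF A, of p]
  unfolding diff_at_def coord_at_def differentiable_def by blast

lemma linear_components: "c \<in> A \<Longrightarrow> p \<in> fst c \<Longrightarrow> linear (components A c p)"
  unfolding components_def[abs_def] by (rule linear_deriv_at[OF diff_at_chart])

lemma frechet_chart_chart_inv:
  assumes "c \<in> A" "p \<in> fst c"
  shows "frechet_derivative (snd c \<circ> chart_inv c) (at (snd c p)) v = v"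
proof -
  have "(snd c \<circ> chart_inv c has_derivative (\<lambda>v. v)) (at (snd c p))"
  proof (rule has_derivative_transform_within_open[OF has_derivative_ident chart_image_open[OF A assms(1) open_UNIV]])
    show "snd c p \<in> snd c ` (UNIV \<inter> fst c)" using assms by auto
  qed (use assms in \<open>auto simp: chart_inv_snd[OF A]\<close>)
  then show ?thesis using frechet_derivative_at by metis
qed

lemma components_chart_at: "components A (chart_at A p) p v = v"
  unfolding components_def deriv_at_def coord_at_def
  using frechet_chart_chart_inv[OF chart_at_mem[OF A]] .

lemma components_transition:
  assumes "c \<in> A" "d \<in> A" "p \<in> fst c" "p \<in> fst d"
  shows "components A d p v = frechet_derivative (snd d \<circ> chart_inv c) (at (snd c p)) (components A c p v)"
  using deriv_at_chart[OF assms(1,3) diff_at_chart[OF assms(2,4)]] unfolding components_def .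

end

text \<open>The coordinate field of the chart \<open>c\<close> in the direction \<open>b\<close>:
  its components in \<open>c\<close> are constantly \<open>b\<close> (lemma
  \<open>components_coord_field_same\<close>).\<close>

definition coord_field ::
  "('a, 'e::euclidean_space) chart set \<Rightarrow> ('a, 'e) chart \<Rightarrow> 'e \<Rightarrow> 'a \<Rightarrow> 'e" where
  "coord_field A c b p = frechet_derivative (snd (chart_at A p) \<circ> chart_inv c) (at (snd c p)) b"

context
  fixes A :: "('a::{t2_space,second_countable_topology}, 'e::euclidean_space) chart set"
  assumes A: "smooth_atlas A"
begin

lemma coord_field_components:
  assumes "c \<in> A" "p \<in> fst c"
  shows "coord_field A c (components A c p v) p = v"
  unfolding coord_field_def using components_transition[OF A assms(1) chart_at_mem(1)[OF A] assms(2) chart_at_mem(2)[OF A]]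
  by (simp add: components_chart_at[OF A])

lemma components_coord_field:
  assumes "c \<in> A" "p \<in> fst c" "d \<in> A" "p \<in> fst d"
  shows "components A d p (coord_field A c b p) = frechet_derivative (snd d \<circ> chart_inv c) (at (snd c p)) b"
proof -
  have inj: "inj (components A c p)"
    by (metis coord_field_components[OF assms(1,2)] injI)
  then have "surj (components A c p)"
    using linear_components[OF A assms(1,2)] linear_injective_imp_surjective by blast
  then obtain v where "b = components A c p v" by blast
  then show ?thesis
    using coord_field_components[OF assms(1,2), of v] components_transition[OF A assms(1,3,2,4), of v] by simp
qed

lemma components_coord_field_same:
  "c \<in> A \<Longrightarrow> p \<in> fst c \<Longrightarrow> components A c p (coord_field A c b p) = b"
  by (simp add: components_coord_field frechet_chart_chart_inv[OF A])

lemma components_inject: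
  "c \<in> A \<Longrightarrow> p \<in> fst c \<Longrightarrow> components A c p v = components A c p w \<Longrightarrow> v = w"
  by (metis coord_field_components)

lemma linear_coord_field: "c \<in> A \<Longrightarrow> p \<in> fst c \<Longrightarrow> linear (\<lambda>b. coord_field A c b p)"
  unfolding coord_field_def
  by (rule has_derivative_linear[OF transition_has_derivative[OF A _ chart_at_mem(1)[OF A] _ chart_at_mem(2)[OF A]]])

text \<open>The fields \<open>coord_field A c b\<close> with \<open>b\<close> in the standard
  basis form a frame on the domain of \<open>c\<close>, with coefficients that are smooth for smooth
  fields.\<close>

lemma coord_field_expansion:
  assumes "c \<in> A" "p \<in> fst c"
  shows "w = (\<Sum>b\<in>Basis. (components A c p w \<bullet> b) *\<^sub>R coord_field A c b p)"
  using linear_euclidean_expansion[OF linear_coord_field[OF assms], of "components A c p w"]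
  by (simp add: coord_field_components assms)

end

section \<open>Smooth functions, vector fields and sections along a map\<close>

text \<open>The product rule for a directional derivative whose direction varies; it splits off
  the symmetric second derivative, which is what cancels in a commutator.\<close>

lemma frechet_derivative_along_has_derivative:
  fixes h :: "'a::euclidean_space \<Rightarrow> real"
  assumes S: "open S" and h: "smooth_on S h" and Y: "smooth_on S Y" and x: "x \<in> S"
  shows "((\<lambda>y. frechet_derivative h (at y) (Y y)) has_derivative
    (\<lambda>v. frechet_derivative h (at x) (frechet_derivative Y (at x) v) +
      frechet_derivative (\<lambda>y. frechet_derivative h (at y) (Y x)) (at x) v)) (at x)"
proof -
  let ?Dh = "\<lambda>y. frechet_derivative h (at y)"
  let ?DY = "frechet_derivative Y (at x)"
  let ?D2 = "\<lambda>b. frechet_derivative (\<lambda>y. ?Dh y b) (at x)"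
  have lin: "linear (?Dh y)" if "y \<in> S" for y
    using has_derivative_linear[OF smooth_on_has_derivative[OF S h that]] .
  have exp: "?Dh y w = (\<Sum>b\<in>Basis. (w \<bullet> b) * ?Dh y b)" if "y \<in> S" for y w
    using linear_euclidean_expansion[OF lin[OF that], of w] by simp
  have D2: "((\<lambda>y. ?Dh y b) has_derivative ?D2 b) (at x)" for b
    using smooth_on_has_derivative[OF S smooth_on_frechet_derivative[OF h] x] .
  have DY: "((\<lambda>y. Y y \<bullet> b) has_derivative (\<lambda>v. ?DY v \<bullet> b)) (at x)" for b
    using bounded_linear.has_derivative[OF bounded_linear_inner_left smooth_on_has_derivative[OF S Y x]] .
  have "((\<lambda>y. \<Sum>b\<in>Basis. (w \<bullet> b) * ?Dh y b) has_derivative (\<lambda>v. \<Sum>b\<in>Basis. (w \<bullet> b) * ?D2 b v)) (at x)" for w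
    by (intro has_derivative_sum has_derivative_mult_right D2)
  then have "((\<lambda>y. ?Dh y w) has_derivative (\<lambda>v. \<Sum>b\<in>Basis. (w \<bullet> b) * ?D2 b v)) (at x)" for w
    by (rule has_derivative_transform_within_open[OF _ S x]) (rule exp[symmetric])
  then have D2exp: "?D2 w = (\<lambda>v. \<Sum>b\<in>Basis. (w \<bullet> b) * ?D2 b v)" for w
    by (rule frechet_derivative_at[symmetric])
  have "((\<lambda>y. \<Sum>b\<in>Basis. (Y y \<bullet> b) * ?Dh y b) has_derivative
      (\<lambda>v. \<Sum>b\<in>Basis. (Y x \<bullet> b) * ?D2 b v + (?DY v \<bullet> b) * ?Dh x b)) (at x)"
    by (intro has_derivative_sum has_derivative_mult DY D2)
  then have "((\<lambda>y. ?Dh y (Y y)) has_derivative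
      (\<lambda>v. \<Sum>b\<in>Basis. (Y x \<bullet> b) * ?D2 b v + (?DY v \<bullet> b) * ?Dh x b)) (at x)"
    by (rule has_derivative_transform_within_open[OF _ S x]) (rule exp[symmetric])
  then show ?thesis
    by (rule has_derivative_eq_rhs)
      (simp add: sum.distrib exp[OF x, of "?DY _"] fun_cong[OF D2exp[of "Y x"]] add.commute)
qed

text \<open>The version of \<open>smooth_fun\<close> for functions with values in a normed space.
  Smooth sections and smooth maps reduce to it through \<open>smooth_section_iff\<close> and
  \<open>smooth_map_iff\<close>, because their components are such functions.\<close>

definition csmooth ::
  "('a::topological_space, 'e::euclidean_space) chart set \<Rightarrow> 'a set \<Rightarrow> ('a \<Rightarrow> 'f::real_normed_vector) \<Rightarrow> bool" where
  "csmooth A U f \<longleftrightarrow> (\<forall>c\<in>A. smooth_on (snd c ` (U \<inter> fst c)) (f \<circ> chart_inv c))"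

lemma smooth_fun_iff: "smooth_fun A U f \<longleftrightarrow> csmooth A U f"
  by (simp add: smooth_fun_def csmooth_def)

lemma smooth_section_iff:
  "smooth_section A B f U W \<longleftrightarrow> (\<forall>d\<in>B. csmooth A (U \<inter> f -` fst d) (\<lambda>p. components B d (f p) (W p)))"
  unfolding smooth_section_def csmooth_def by (auto simp: Int_ac)

lemma smooth_map_iff:
  "smooth_map A B f \<longleftrightarrow> continuous_on UNIV f \<and> (\<forall>d\<in>B. csmooth A (f -` fst d) (\<lambda>q. snd d (f q)))"
  unfolding smooth_map_def csmooth_def by (auto simp: Int_ac o_def)

lemma csmooth_subset: "csmooth A U f \<Longrightarrow> V \<subseteq> U \<Longrightarrow> csmooth A V f"
  unfolding csmooth_def by (meson Int_mono image_mono order_refl smooth_on_subset)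

lemma csmooth_const: "csmooth A U (\<lambda>q. c)"
  unfolding csmooth_def by (simp add: o_def smooth_on_const)

context
  fixes A :: "('a::{t2_space,second_countable_topology}, 'e::euclidean_space) chart set"
  assumes A: "smooth_atlas A"
begin

lemma csmooth_cong:
  assumes "open U" "\<And>q. q \<in> U \<Longrightarrow> f q = g q" "csmooth A U f"
  shows "csmooth A U g"
  unfolding csmooth_def
proof
  fix c assume c: "c \<in> A"
  show "smooth_on (snd c ` (U \<inter> fst c)) (g \<circ> chart_inv c)"
    by (rule smooth_on_cong[of _ "f \<circ> chart_inv c"])
      (use assms c in \<open>auto simp: csmooth_def chart_image_open[OF A] chart_inv_snd[OF A]\<close>)
qed

lemma csmooth_add:
  assumes "open U" "csmooth A U f" "csmooth A U g"
  shows "csmooth A U (\<lambda>q. f q + g q)"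
  unfolding csmooth_def
proof
  fix c assume c: "c \<in> A"
  show "smooth_on (snd c ` (U \<inter> fst c)) ((\<lambda>q. f q + g q) \<circ> chart_inv c)"
    using assms(2,3) c smooth_on_add[OF chart_image_open[OF A c assms(1)], of "f \<circ> chart_inv c" "g \<circ> chart_inv c"]
    by (simp add: csmooth_def o_def)
qed

lemma csmooth_bilinear:
  assumes "bounded_bilinear P" "open U" "csmooth A U f" "csmooth A U g"
  shows "csmooth A U (\<lambda>q. P (f q) (g q))"
  unfolding csmooth_def
proof
  fix c assume c: "c \<in> A"
  show "smooth_on (snd c ` (U \<inter> fst c)) ((\<lambda>q. P (f q) (g q)) \<circ> chart_inv c)"
    using smooth_on_bilinear[OF assms(1) chart_image_open[OF A c assms(2)]] assms(3,4) c
    by (simp add: csmooth_def o_def)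
qed

lemma csmooth_compose:
  fixes u :: "'a \<Rightarrow> 'f::euclidean_space"
  assumes "open U" "open T" "u ` U \<subseteq> T" "csmooth A U u" "smooth_on T g"
  shows "csmooth A U (\<lambda>q. g (u q))"
  unfolding csmooth_def
proof
  fix c assume c: "c \<in> A"
  have "(u \<circ> chart_inv c) ` (snd c ` (U \<inter> fst c)) \<subseteq> T"
    using assms(3) c by (auto simp: chart_inv_snd[OF A])
  then show "smooth_on (snd c ` (U \<inter> fst c)) ((\<lambda>q. g (u q)) \<circ> chart_inv c)"
    using smooth_on_compose[OF chart_image_open[OF A c assms(1)] assms(2), of "u \<circ> chart_inv c" g] assms(4,5) c
    by (simp add: csmooth_def o_def)
qed

lemma csmooth_inner:
  "open U \<Longrightarrow> csmooth A U u \<Longrightarrow> csmooth A U (\<lambda>q. u q \<bullet> b)"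
  by (rule csmooth_bilinear[OF bounded_bilinear_inner _ _ csmooth_const])

lemma csmooth_diff_at:
  assumes "open U" "csmooth A U f" "p \<in> U"
  shows "diff_at A f p"
  unfolding diff_at_def coord_at_def
  by (rule smooth_on_differentiable[OF chart_image_open[OF A chart_at_mem(1)[OF A] assms(1)]])
    (use assms chart_at_mem[OF A] in \<open>auto simp: csmooth_def\<close>)

lemma csmooth_chart: "c \<in> A \<Longrightarrow> csmooth A (fst c) (snd c)"
  unfolding csmooth_def using transition_smooth[OF A] by (simp add: Int_commute)

lemma smooth_map_ident: "smooth_map A A (\<lambda>p. p)"
  unfolding smooth_map_iff using csmooth_chart by simp

lemma smooth_vf_iff:
  "smooth_vf A U X \<longleftrightarrow> (\<forall>d\<in>A. csmooth A (U \<inter> fst d) (\<lambda>p. components A d p (X p)))"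
  by (simp add: smooth_section_iff)

lemma csmooth_deriv_at:
  assumes U: "open U" and h: "csmooth A U h" and X: "smooth_vf A U X"
  shows "csmooth A U (\<lambda>q. deriv_at A h q (X q))"
  unfolding csmooth_def
proof
  fix c assume c: "c \<in> A"
  let ?S = "snd c ` (U \<inter> fst c)"
  note S = chart_image_open[OF A c U]
  have "csmooth A (U \<inter> fst c) (\<lambda>p. components A c p (X p))" using X c by (simp add: smooth_vf_iff)
  then have "smooth_on ?S ((\<lambda>p. components A c p (X p)) \<circ> chart_inv c)"
    using c by (auto simp: csmooth_def)
  moreover have "smooth_on ?S (h \<circ> chart_inv c)" using h c by (simp add: csmooth_def)
  ultimately have "smooth_on ?S (\<lambda>y. frechet_derivative (h \<circ> chart_inv c) (at y)
      (((\<lambda>p. components A c p (X p)) \<circ> chart_inv c) y))"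
    by (intro smooth_on_frechet_derivative_along[OF S])
  then show "smooth_on ?S ((\<lambda>q. deriv_at A h q (X q)) \<circ> chart_inv c)"
    by (rule smooth_on_cong[OF S, rotated])
      (use c csmooth_diff_at[OF U h] in \<open>auto simp: chart_inv_snd[OF A] deriv_at_chart[OF A c]\<close>)
qed

text \<open>The bracket acts on functions as the commutator of the two derivations: in the chart
  preferred at \<open>p\<close> the second derivatives of \<open>h\<close> cancel by symmetry, and
  the derivatives of the components of the fields that remain make up the bracket.\<close>

lemma deriv_at_commutator:
  fixes h :: "'a \<Rightarrow> real"
  assumes U: "open U" and p: "p \<in> U" and h: "csmooth A U h"
    and X: "smooth_vf A U X" and Y: "smooth_vf A U Y"
  shows "deriv_at A (\<lambda>q. deriv_at A h q (Y q)) p (X p) - deriv_at A (\<lambda>q. deriv_at A h q (X q)) p (Y p) =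
    deriv_at A h p (lie_bracket A X Y p)"
proof -
  define c where "c = chart_at A p"
  have c: "c \<in> A" "p \<in> fst c" using chart_at_mem[OF A] by (auto simp: c_def)
  define S where "S = snd c ` (U \<inter> fst c)"
  define x where "x = snd c p"
  have S: "open S" unfolding S_def by (rule chart_image_open[OF A c(1) U])
  have x: "x \<in> S" using p c by (auto simp: S_def x_def)
  have inv: "chart_inv c x = p" using c by (simp add: x_def chart_inv_snd[OF A])
  have dat: "deriv_at A f p v = frechet_derivative (f \<circ> chart_inv c) (at x) v" for f v
    by (simp add: deriv_at_def c_def x_def coord_at_def)
  define loc where "loc Z y = components A c (chart_inv c y) (Z (chart_inv c y))" for Z y
  define H where "H = h \<circ> chart_inv c"
  have H: "smooth_on S H" using h c by (simp add: csmooth_def S_def H_def)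
  have loc: "smooth_on S (loc Z)" if "smooth_vf A U Z" for Z
  proof -
    have "csmooth A (U \<inter> fst c) (\<lambda>p. components A c p (Z p))" using that c by (simp add: smooth_vf_iff)
    then show ?thesis using c by (auto simp: csmooth_def S_def loc_def[abs_def] o_def)
  qed
  have locx: "loc Z x = Z p" for Z
    by (simp add: loc_def inv) (simp add: c_def components_chart_at[OF A])
  have D: "deriv_at A (\<lambda>q. deriv_at A h q (Z q)) p v =
      frechet_derivative H (at x) (frechet_derivative (loc Z) (at x) v) +
      frechet_derivative (\<lambda>y. frechet_derivative H (at y) (Z p)) (at x) v"
    if Z: "smooth_vf A U Z" for Z v
  proof -
    have "((\<lambda>y. frechet_derivative H (at y) (loc Z y)) has_derivative
        (\<lambda>v. frechet_derivative H (at x) (frechet_derivative (loc Z) (at x) v) +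
          frechet_derivative (\<lambda>y. frechet_derivative H (at y) (loc Z x)) (at x) v)) (at x)"
      by (rule frechet_derivative_along_has_derivative[OF S H loc[OF Z] x])
    then have "(((\<lambda>q. deriv_at A h q (Z q)) \<circ> chart_inv c) has_derivative
        (\<lambda>v. frechet_derivative H (at x) (frechet_derivative (loc Z) (at x) v) +
          frechet_derivative (\<lambda>y. frechet_derivative H (at y) (loc Z x)) (at x) v)) (at x)"
      by (rule has_derivative_transform_within_open[OF _ S x])
        (use c csmooth_diff_at[OF U h] in \<open>auto simp: S_def loc_def H_def chart_inv_snd[OF A] deriv_at_chart[OF A c(1)]\<close>)
    from frechet_derivative_at[OF this, symmetric] show ?thesis by (simp add: dat locx)
  qed
  have sym: "frechet_derivative (\<lambda>y. frechet_derivative H (at y) (Y p)) (at x) (X p) =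
      frechet_derivative (\<lambda>y. frechet_derivative H (at y) (X p)) (at x) (Y p)"
    by (rule symmetric_second_derivative[OF S _ x]) (use H in \<open>simp add: smooth_on_def\<close>)
  have lie: "lie_bracket A X Y p =
      frechet_derivative (loc Y) (at x) (X p) - frechet_derivative (loc X) (at x) (Y p)"
    unfolding lie_bracket_def dat c_def[symmetric] by (simp add: loc_def[abs_def] o_def)
  have lin: "linear (frechet_derivative H (at x))"
    by (rule has_derivative_linear[OF smooth_on_has_derivative[OF S H x]])
  show ?thesis
    unfolding D[OF X] D[OF Y] sym lie dat H_def[symmetric] by (simp add: linear_diff[OF lin])
qed

end

text \<open>Vector fields are the sections along the identity, so through
  \<open>manifold_map_ident\<close> everything proved here about sections along \<open>f\<close>
  also holds for vector fields.\<close>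

locale manifold_map =
  fixes A :: "('a::{t2_space,second_countable_topology}, 'e::euclidean_space) chart set"
    and B :: "('b::{t2_space,second_countable_topology}, 'k::euclidean_space) chart set"
    and f :: "'a \<Rightarrow> 'b"
  assumes A: "smooth_atlas A" and B: "smooth_atlas B" and f: "smooth_map A B f"
begin

lemma open_vimage_map: "open V \<Longrightarrow> open (f -` V)"
  using f by (auto simp: smooth_map_iff intro: open_vimage)

lemma csmooth_coord: "d \<in> B \<Longrightarrow> csmooth A (f -` fst d) (\<lambda>q. snd d (f q))"
  using f by (simp add: smooth_map_iff)

lemma diff_at_coord: "d \<in> B \<Longrightarrow> f p \<in> fst d \<Longrightarrow> diff_at A (\<lambda>q. snd d (f q)) p"
  by (rule csmooth_diff_at[OF A open_vimage_map[OF chart_open[OF B]] csmooth_coord]) auto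

lemma deriv_at_compose_map:
  assumes h: "diff_at B h (f p)"
  shows "diff_at A (\<lambda>q. h (f q)) p"
    "deriv_at A (\<lambda>q. h (f q)) p v = deriv_at B h (f p) (differential A B f p v)"
proof -
  define d where "d = chart_at B (f p)"
  have d: "d \<in> B" "f p \<in> fst d" using chart_at_mem[OF B] by (auto simp: d_def)
  have h': "((h \<circ> chart_inv d) has_derivative deriv_at B h (f p)) (at (snd d (f p)))"
    using deriv_at_has_derivative[OF h] by (simp add: d_def coord_at_def)
  note 1 = deriv_at_compose[OF diff_at_coord[OF d] h' A]
  have V: "open (f -` fst d)" "p \<in> f -` fst d" using d open_vimage_map chart_open[OF B] by auto
  have eq: "(h \<circ> chart_inv d) (snd d (f q)) = h (f q)" if "q \<in> f -` fst d" for q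
    using that d by (simp add: chart_inv_snd[OF B])
  note 2 = diff_at_cong[OF A V eq 1(1)]
  show "diff_at A (\<lambda>q. h (f q)) p" by (rule 2)
  show "deriv_at A (\<lambda>q. h (f q)) p v = deriv_at B h (f p) (differential A B f p v)"
    using 1(2)[of v] 2(2)[of v] by (simp add: differential_def d_def o_def)
qed

lemma components_differential:
  "d \<in> B \<Longrightarrow> f p \<in> fst d \<Longrightarrow>
    components B d (f p) (differential A B f p v) = deriv_at A (\<lambda>q. snd d (f q)) p v"
  unfolding components_def using deriv_at_compose_map(2)[OF diff_at_chart[OF B]] by simp

lemma linear_differential: "linear (differential A B f p)"
  unfolding differential_def[abs_def] o_def
  by (rule linear_deriv_at[OF diff_at_coord[OF chart_at_mem[OF B]]])

lemma open_chart_vimage: "open U \<Longrightarrow> d \<in> B \<Longrightarrow> open (U \<inter> f -` fst d)"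
  using open_Int[OF _ open_vimage_map[OF chart_open[OF B]]] .

lemma section_components:
  "smooth_section A B f U W \<Longrightarrow> d \<in> B \<Longrightarrow> csmooth A (U \<inter> f -` fst d) (\<lambda>p. components B d (f p) (W p))"
  by (simp add: smooth_section_iff)

lemma smooth_section_subset: "smooth_section A B f U W \<Longrightarrow> V \<subseteq> U \<Longrightarrow> smooth_section A B f V W"
  unfolding smooth_section_iff by (meson Int_mono csmooth_subset order_refl)

lemma smooth_section_cong:
  assumes "open U" "\<And>q. q \<in> U \<Longrightarrow> W q = W' q" "smooth_section A B f U W"
  shows "smooth_section A B f U W'"
  unfolding smooth_section_iff
proof
  fix d assume d: "d \<in> B"
  show "csmooth A (U \<inter> f -` fst d) (\<lambda>p. components B d (f p) (W' p))"
    by (rule csmooth_cong[OF A open_chart_vimage[OF assms(1) d] _ section_components[OF assms(3) d]])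
      (simp add: assms(2))
qed

lemma smooth_section_zero: "open U \<Longrightarrow> smooth_section A B f U (\<lambda>q. 0)"
  unfolding smooth_section_iff
proof
  fix d assume d: "d \<in> B" and U: "open U"
  show "csmooth A (U \<inter> f -` fst d) (\<lambda>p. components B d (f p) 0)"
    by (rule csmooth_cong[OF A open_chart_vimage[OF U d] _ csmooth_const[of _ _ 0]])
      (use d in \<open>auto simp: linear_0[OF linear_components[OF B]]\<close>)
qed

lemma smooth_section_add:
  assumes U: "open U" and "smooth_section A B f U W" "smooth_section A B f U W'"
  shows "smooth_section A B f U (\<lambda>q. W q + W' q)"
  unfolding smooth_section_iff
proof
  fix d assume d: "d \<in> B"
  note V = open_chart_vimage[OF U d]
  show "csmooth A (U \<inter> f -` fst d) (\<lambda>p. components B d (f p) (W p + W' p))"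
    by (rule csmooth_cong[OF A V _ csmooth_add[OF A V section_components[OF assms(2) d] section_components[OF assms(3) d]]])
      (use d in \<open>auto simp: linear_add[OF linear_components[OF B]]\<close>)
qed

lemma smooth_section_scaleR:
  assumes U: "open U" and h: "csmooth A U h" and W: "smooth_section A B f U W"
  shows "smooth_section A B f U (\<lambda>q. h q *\<^sub>R W q)"
  unfolding smooth_section_iff
proof
  fix d assume d: "d \<in> B"
  note V = open_chart_vimage[OF U d]
  have h': "csmooth A (U \<inter> f -` fst d) h" using csmooth_subset[OF h] by auto
  show "csmooth A (U \<inter> f -` fst d) (\<lambda>p. components B d (f p) (h p *\<^sub>R W p))"
    by (rule csmooth_cong[OF A V _ csmooth_bilinear[OF A bounded_bilinear_scaleR V h' section_components[OF W d]]])
      (use d in \<open>auto simp: linear_cmul[OF linear_components[OF B]]\<close>)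
qed

lemma smooth_section_sum:
  "open U \<Longrightarrow> (\<And>i. i \<in> I \<Longrightarrow> smooth_section A B f U (W i)) \<Longrightarrow> smooth_section A B f U (\<lambda>q. \<Sum>i\<in>I. W i q)"
  by (induction I rule: infinite_finite_induct) (auto simp: smooth_section_zero smooth_section_add)

lemma smooth_section_coord_field:
  assumes d: "d \<in> B"
  shows "smooth_section A B f (f -` fst d) (\<lambda>q. coord_field B d b (f q))"
  unfolding smooth_section_iff
proof
  fix d' assume d': "d' \<in> B"
  note V = open_chart_vimage[OF open_vimage_map[OF chart_open[OF B d]] d']
  show "csmooth A (f -` fst d \<inter> f -` fst d') (\<lambda>p. components B d' (f p) (coord_field B d b (f p)))"
  proof (rule csmooth_cong[OF A V])
    show "csmooth A (f -` fst d \<inter> f -` fst d') (\<lambda>p. frechet_derivative (snd d' \<circ> chart_inv d) (at (snd d (f p))) b)"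
      by (rule csmooth_compose[OF A V transition_open[OF B d d']  _ csmooth_subset[OF csmooth_coord[OF d]]
            smooth_on_frechet_derivative[OF transition_smooth[OF B d d']]]) auto
  qed (use d d' in \<open>auto simp: components_coord_field[OF B]\<close>)
qed

lemma smooth_section_differential:
  assumes U: "open U" and X: "smooth_vf A U X"
  shows "smooth_section A B f U (\<lambda>q. differential A B f q (X q))"
  unfolding smooth_section_iff
proof
  fix d assume d: "d \<in> B"
  note V = open_chart_vimage[OF U d]
  have X': "smooth_vf A (U \<inter> f -` fst d) X"
    using X unfolding smooth_section_iff by (meson Int_mono Int_lower1 csmooth_subset order_refl)
  show "csmooth A (U \<inter> f -` fst d) (\<lambda>p. components B d (f p) (differential A B f p (X p)))"
    by (rule csmooth_cong[OF A V _ csmooth_deriv_at[OF A V csmooth_subset[OF csmooth_coord[OF d]] X']])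
      (use d in \<open>auto simp: components_differential\<close>)
qed

end

lemma manifold_map_ident: "smooth_atlas A \<Longrightarrow> manifold_map A A (\<lambda>p. p)"
  by (simp add: manifold_map_def smooth_map_ident)

section \<open>The pullback of the Levi-Civita connection\<close>

locale map_connection = manifold_map A B f
  for A :: "('a::{t2_space,second_countable_topology}, 'e::euclidean_space) chart set"
    and B :: "('b::{t2_space,second_countable_topology}, 'k::euclidean_space) chart set"
    and f :: "'a \<Rightarrow> 'b" +
  fixes D :: "'a \<Rightarrow> 'e \<Rightarrow> ('a \<Rightarrow> 'k) \<Rightarrow> 'k"
  assumes D: "connection_along A B f D"
begin

lemmas connection_rule = D[unfolded connection_along_def, THEN spec, THEN spec, THEN mp, OF conjI]

lemma D_linear: "open U \<Longrightarrow> smooth_section A B f U W \<Longrightarrow> p \<in> U \<Longrightarrow> linear (\<lambda>v. D p v W)"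
  by (rule connection_rule[THEN conjunct1, THEN bspec])

lemma D_add:
  "open U \<Longrightarrow> smooth_section A B f U W \<Longrightarrow> smooth_section A B f U W' \<Longrightarrow> p \<in> U \<Longrightarrow>
    D p v (\<lambda>q. W q + W' q) = D p v W + D p v W'"
  by (rule connection_rule[THEN conjunct2, THEN conjunct1, THEN spec, THEN mp, THEN bspec, THEN spec])

lemma D_scaleR:
  "open U \<Longrightarrow> smooth_section A B f U W \<Longrightarrow> csmooth A U h \<Longrightarrow> p \<in> U \<Longrightarrow>
    D p v (\<lambda>q. h q *\<^sub>R W q) = deriv_at A h p v *\<^sub>R W p + h p *\<^sub>R D p v W"
  by (rule connection_rule[THEN conjunct2, THEN conjunct2, THEN conjunct1, unfolded smooth_fun_iff,
        THEN spec, THEN mp, THEN bspec, THEN spec])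

lemma D_zero: "D p v (\<lambda>q. 0) = 0"
  using D_add[of UNIV "\<lambda>q. 0" "\<lambda>q. 0" p v] smooth_section_zero[of UNIV] by simp

text \<open>A connection is local. Two sections that agree on \<open>U\<close> differ by a section
  \<open>Z\<close> that vanishes on \<open>U\<close>. Take \<open>h\<close> to be \<open>0\<close>
  on \<open>U\<close> and \<open>1\<close> elsewhere; as smoothness is required on \<open>U\<close>
  only, \<open>h\<close> is admissible in the Leibniz rule, and \<open>Z = h Z\<close> gives a
  vanishing covariant derivative.\<close>

lemma D_cong:
  assumes U: "open U" and W: "smooth_section A B f U W" and eq: "\<And>q. q \<in> U \<Longrightarrow> W q = W' q" and p: "p \<in> U"
  shows "D p v W = D p v W'"
proof -
  define Z where "Z q = W' q - W q" for q
  define h :: "'a \<Rightarrow> real" where "h q = (if q \<in> U then 0 else 1)" for q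
  have Z: "smooth_section A B f U Z"
    by (rule smooth_section_cong[OF U _ smooth_section_zero[OF U]]) (simp add: Z_def eq)
  have h: "csmooth A U h"
    by (rule csmooth_cong[OF A U _ csmooth_const[of _ _ 0]]) (simp add: h_def)
  have "(\<lambda>q. h q *\<^sub>R Z q) = Z" by (auto simp: h_def Z_def eq)
  then have "D p v Z = 0"
    using D_scaleR[OF U Z h p, of v] p by (simp add: Z_def eq h_def)
  moreover have "(\<lambda>q. W q + Z q) = W'" by (auto simp: Z_def)
  ultimately show ?thesis using D_add[OF U W Z p, of v] by simp
qed

lemma D_sum:
  assumes U: "open U" and p: "p \<in> U"
    and "finite I" "\<And>i. i \<in> I \<Longrightarrow> csmooth A U (h i)" "\<And>i. i \<in> I \<Longrightarrow> smooth_section A B f U (W i)"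
  shows "D p v (\<lambda>q. \<Sum>i\<in>I. h i q *\<^sub>R W i q) =
    (\<Sum>i\<in>I. deriv_at A (h i) p v *\<^sub>R W i p + h i p *\<^sub>R D p v (W i))"
  using assms(3-5)
proof (induction I rule: finite_induct)
  case empty
  then show ?case by (simp add: D_zero)
next
  case (insert j I)
  have "smooth_section A B f U (\<lambda>q. \<Sum>i\<in>I. h i q *\<^sub>R W i q)"
    using insert.prems by (intro smooth_section_sum U smooth_section_scaleR) auto
  moreover have "smooth_section A B f U (\<lambda>q. h j q *\<^sub>R W j q)"
    using insert.prems by (intro U smooth_section_scaleR) auto
  ultimately show ?case
    using insert D_add[OF U _ _ p, of "\<lambda>q. h j q *\<^sub>R W j q" "\<lambda>q. \<Sum>i\<in>I. h i q *\<^sub>R W i q" v]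
      D_scaleR[OF U _ _ p, of "W j" "h j" v] by simp
qed

end

lemma levi_civita_connection: "levi_civita A g D \<Longrightarrow> connection_along A A (\<lambda>p. p) D"
  by (simp add: levi_civita_def)

lemma levi_civita_torsion_free:
  assumes "levi_civita A g D" "open U" "smooth_vf A U X" "smooth_vf A U Y" "p \<in> U"
  shows "D p (X p) Y - D p (Y p) X = lie_bracket A X Y p"
  by (rule assms(1)[unfolded levi_civita_def, THEN conjunct2, THEN spec, THEN spec, THEN spec, THEN mp,
        OF conjI[OF assms(2) conjI[OF assms(3,4)]], THEN conjunct1, THEN bspec, OF assms(5)])

lemma levi_civita_metric:
  assumes "levi_civita A g D" "open U" "smooth_vf A U X" "smooth_vf A U Y" "p \<in> U"
  shows "deriv_at A (\<lambda>q. g q (X q) (Y q)) p v = g p (D p v X) (Y p) + g p (X p) (D p v Y)"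
  by (rule assms(1)[unfolded levi_civita_def, THEN conjunct2, THEN spec, THEN spec, THEN spec, THEN mp,
        OF conjI[OF assms(2) conjI[OF assms(3,4)]], THEN conjunct2, THEN bspec, OF assms(5), THEN spec])

lemma bilinear_sum_real:
  fixes h :: "'v::real_vector \<Rightarrow> 'w::real_vector \<Rightarrow> real"
  assumes h: "bilinear h"
  shows "h (\<Sum>i\<in>I. x i) y = (\<Sum>i\<in>I. h (x i) y)" "h x' (\<Sum>j\<in>J. y' j) = (\<Sum>j\<in>J. h x' (y' j))"
    "h (c *\<^sub>R u) w = c * h u w" "h u (c *\<^sub>R w) = c * h u w"
    "h (u + u') w = h u w + h u' w" "h u (w + w') = h u w + h u w'"
  using h linear_sum[of "\<lambda>x. h x y" x I] linear_sum[of "h x'" y' J]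
  by (auto simp: bilinear_def linear_cmul linear_add bilinear_lmul bilinear_rmul bilinear_ladd bilinear_radd)

lemma bilinear_double_sum:
  fixes h :: "'v::real_vector \<Rightarrow> 'w::real_vector \<Rightarrow> real"
  assumes h: "bilinear h"
  shows "h (\<Sum>i\<in>I. x i) (\<Sum>j\<in>J. y j) = (\<Sum>i\<in>I. \<Sum>j\<in>J. h (x i) (y j))"
  unfolding bilinear_sum_real(1)[OF h] by (simp only: bilinear_sum_real(2)[OF h])

locale pullback_setting = map_connection A B f D
  for A :: "('a::{t2_space,second_countable_topology}, 'e::euclidean_space) chart set"
    and B :: "('b::{t2_space,second_countable_topology}, 'k::euclidean_space) chart set"
    and f :: "'a \<Rightarrow> 'b" and D :: "'a \<Rightarrow> 'e \<Rightarrow> ('a \<Rightarrow> 'k) \<Rightarrow> 'k" +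
  fixes gN :: "'b \<Rightarrow> 'k \<Rightarrow> 'k \<Rightarrow> real" and DN :: "'b \<Rightarrow> 'k \<Rightarrow> ('b \<Rightarrow> 'k) \<Rightarrow> 'k"
  assumes gN: "riemannian_metric B gN" and DN: "levi_civita B gN DN"
    and pullback: "pullback_connection A B f DN D"
begin

lemma D_pullback:
  "open V \<Longrightarrow> smooth_vf B V W \<Longrightarrow> f p \<in> V \<Longrightarrow>
    D p v (\<lambda>q. W (f q)) = DN (f p) (differential A B f p v) W"
  using pullback unfolding pullback_connection_def o_def by blast

lemma smooth_vf_coord_field: "d \<in> B \<Longrightarrow> smooth_vf B (fst d) (coord_field B d b)"
  using manifold_map.smooth_section_coord_field[OF manifold_map_ident[OF B]] by simp

lemma D_coord_field:
  "d \<in> B \<Longrightarrow> f p \<in> fst d \<Longrightarrow>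
    D p v (\<lambda>q. coord_field B d b (f q)) = DN (f p) (differential A B f p v) (coord_field B d b)"
  by (rule D_pullback[OF chart_open[OF B] smooth_vf_coord_field])

lemma csmooth_section_coord:
  assumes "open U" "smooth_section A B f U W" "d \<in> B"
  shows "csmooth A (U \<inter> f -` fst d) (\<lambda>q. components B d (f q) (W q) \<bullet> b)"
  by (rule csmooth_inner[OF A open_chart_vimage[OF assms(1,3)] section_components[OF assms(2,3)]])

text \<open>A section along \<open>f\<close> is near \<open>p\<close> a combination of pulled back
  coordinate fields, on which \<open>D\<close> is known; locality and the Leibniz rule give
  \<open>D\<close> on all sections.\<close>

lemma D_expansion:
  assumes U: "open U" and W: "smooth_section A B f U W" and p: "p \<in> U" and d: "d \<in> B" "f p \<in> fst d"
  shows "D p v W = (\<Sum>b\<in>Basis. deriv_at A (\<lambda>q. components B d (f q) (W q) \<bullet> b) p v *\<^sub>R coord_field B d b (f p) +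
    (components B d (f p) (W p) \<bullet> b) *\<^sub>R DN (f p) (differential A B f p v) (coord_field B d b))"
proof -
  let ?V = "U \<inter> f -` fst d"
  have V: "open ?V" "p \<in> ?V" using open_chart_vimage[OF U d(1)] p d by auto
  have "D p v W = D p v (\<lambda>q. \<Sum>b\<in>Basis. (components B d (f q) (W q) \<bullet> b) *\<^sub>R coord_field B d b (f q))"
  proof (rule D_cong[OF V(1) smooth_section_subset[OF W] _ V(2)])
    show "W q = (\<Sum>b\<in>Basis. (components B d (f q) (W q) \<bullet> b) *\<^sub>R coord_field B d b (f q))" if "q \<in> ?V" for q
      by (rule coord_field_expansion[OF B d(1)]) (use that in auto)
  qed auto
  also have "\<dots> = (\<Sum>b\<in>Basis. deriv_at A (\<lambda>q. components B d (f q) (W q) \<bullet> b) p v *\<^sub>R coord_field B d b (f p) +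
    (components B d (f p) (W p) \<bullet> b) *\<^sub>R D p v (\<lambda>q. coord_field B d b (f q)))"
    by (rule D_sum[OF V finite_Basis csmooth_section_coord[OF U W d(1)]])
      (rule smooth_section_subset[OF smooth_section_coord_field[OF d(1)]], auto)
  finally show ?thesis using d by (simp add: D_coord_field)
qed

text \<open>The bracket at \<open>y\<close> is computed in the chart preferred at
  \<open>y\<close>, so for the coordinate fields of that chart all the components to be
  differentiated are constant.\<close>

lemma lie_bracket_coord_fields: "lie_bracket B (coord_field B (chart_at B y) a) (coord_field B (chart_at B y) b) y = 0"
proof -
  let ?d = "chart_at B y"
  have "deriv_at B (\<lambda>q. components B ?d q (coord_field B ?d c q)) y v = 0" for c v
    using diff_at_cong(2)[OF B chart_open[OF B chart_at_mem(1)[OF B, of y]] chart_at_mem(2)[OF B] _ deriv_at_const(1), of c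
        "\<lambda>q. components B ?d q (coord_field B ?d c q)"]
    by (simp add: components_coord_field_same[OF B chart_at_mem(1)[OF B]] deriv_at_const)
  then show ?thesis by (simp add: lie_bracket_def)
qed

text \<open>Let \<open>u b\<close> be the coordinates of \<open>f\<close> and \<open>e b\<close>
  the coordinate fields around \<open>f p\<close>. The components of the pushforward of
  \<open>Y\<close> are the functions \<open>Y(u b)\<close>. After expansion, the difference of the
  two covariant derivatives consists of the commutators \<open>X(Y(u b)) - Y(X(u b))\<close>, which
  are the components of the pushforward of the bracket, and of terms in which the covariant
  derivatives of the \<open>e b\<close> cancel, because they are symmetric: the \<open>e b\<close>
  commute and \<open>DN\<close> is torsion-free.\<close>

lemma D_torsion_free:
  assumes U: "open U" and p: "p \<in> U" and X: "smooth_vf A U X" and Y: "smooth_vf A U Y"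
  shows "D p (X p) (\<lambda>q. differential A B f q (Y q)) - D p (Y p) (\<lambda>q. differential A B f q (X q)) =
    differential A B f p (lie_bracket A X Y p)"
proof -
  define d where "d = chart_at B (f p)"
  have d: "d \<in> B" "f p \<in> fst d" using chart_at_mem[OF B] by (auto simp: d_def)
  let ?V = "U \<inter> f -` fst d"
  have V: "open ?V" "p \<in> ?V" using open_chart_vimage[OF U d(1)] p d by auto
  define u where "u b q = snd d (f q) \<bullet> b" for b q
  define e where "e b = coord_field B d b" for b
  have u: "csmooth A ?V (u b)" for b
    unfolding u_def[abs_def]
    by (rule csmooth_inner[OF A V(1) csmooth_subset[OF csmooth_coord[OF d(1)]]]) auto
  have comp: "components B d (f q) (differential A B f q v) \<bullet> b = deriv_at A (u b) q v" if "q \<in> ?V" for q v b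
    using that d diff_at_coord[OF d(1), of q]
    by (simp add: components_differential u_def[abs_def] deriv_at_inner(2)[OF _ A])
  have df: "differential A B f p v = (\<Sum>b\<in>Basis. deriv_at A (u b) p v *\<^sub>R e b (f p))" for v
    using coord_field_expansion[OF B d, of "differential A B f p v"] V(2) by (simp add: comp e_def)
  have restrict: "smooth_vf A ?V Z" if "smooth_vf A U Z" for Z
    using manifold_map.smooth_section_subset[OF manifold_map_ident[OF A] that] by auto
  have ve: "smooth_vf B (fst d) (e b)" for b unfolding e_def by (rule smooth_vf_coord_field[OF d(1)])
  have linN: "linear (\<lambda>v. DN (f p) v (e b))" for b
    by (rule levi_civita_connection[OF DN, unfolded connection_along_def, THEN spec, THEN spec, THEN mp,
          OF conjI[OF chart_open[OF B d(1)] ve], THEN conjunct1, THEN bspec, OF d(2)])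
  have exp: "D p v (\<lambda>q. differential A B f q (Z q)) =
      (\<Sum>b\<in>Basis. deriv_at A (\<lambda>q. deriv_at A (u b) q (Z q)) p v *\<^sub>R e b (f p)) +
      (\<Sum>b\<in>Basis. \<Sum>a\<in>Basis. (deriv_at A (u b) p (Z p) * deriv_at A (u a) p v) *\<^sub>R DN (f p) (e a (f p)) (e b))"
    if Z: "smooth_vf A U Z" for Z v
  proof -
    have 1: "deriv_at A (\<lambda>q. components B d (f q) (differential A B f q (Z q)) \<bullet> b) p v =
        deriv_at A (\<lambda>q. deriv_at A (u b) q (Z q)) p v" for b
      by (rule diff_at_cong(2)[OF A V _ csmooth_diff_at[OF A V(1) csmooth_deriv_at[OF A V(1) u restrict[OF Z]] V(2)]])
        (simp add: comp)
    have 2: "DN (f p) (differential A B f p v) (e b) =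
        (\<Sum>a\<in>Basis. deriv_at A (u a) p v *\<^sub>R DN (f p) (e a (f p)) (e b))" for b
      unfolding df by (simp add: linear_sum[OF linN] linear_cmul[OF linN])
    show ?thesis
      using D_expansion[OF U smooth_section_differential[OF U Z] p d, of v] V(2)
      by (simp add: 1 2 comp e_def[symmetric] sum.distrib scaleR_sum_right)
  qed
  have symN: "DN (f p) (e a (f p)) (e b) = DN (f p) (e b (f p)) (e a)" for a b
  proof -
    have "DN (f p) (e a (f p)) (e b) - DN (f p) (e b (f p)) (e a) = lie_bracket B (e a) (e b) (f p)"
      by (rule levi_civita_torsion_free[OF DN chart_open[OF B d(1)] ve ve d(2)])
    also have "\<dots> = 0" unfolding e_def d_def by (rule lie_bracket_coord_fields)
    finally show ?thesis by simp
  qed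
  have swap: "(\<Sum>b\<in>Basis. \<Sum>a\<in>Basis. (deriv_at A (u b) p (Y p) * deriv_at A (u a) p (X p)) *\<^sub>R DN (f p) (e a (f p)) (e b)) =
      (\<Sum>b\<in>Basis. \<Sum>a\<in>Basis. (deriv_at A (u b) p (X p) * deriv_at A (u a) p (Y p)) *\<^sub>R DN (f p) (e a (f p)) (e b))"
    by (subst sum.swap) (intro sum.cong refl, simp add: symN mult.commute)
  have comm: "deriv_at A (\<lambda>q. deriv_at A (u b) q (Y q)) p (X p) - deriv_at A (\<lambda>q. deriv_at A (u b) q (X q)) p (Y p) =
      deriv_at A (u b) p (lie_bracket A X Y p)" for b
    by (rule deriv_at_commutator[OF A V u restrict[OF X] restrict[OF Y]])
  have "D p (X p) (\<lambda>q. differential A B f q (Y q)) - D p (Y p) (\<lambda>q. differential A B f q (X q)) =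
      (\<Sum>b\<in>Basis. deriv_at A (\<lambda>q. deriv_at A (u b) q (Y q)) p (X p) *\<^sub>R e b (f p)) -
      (\<Sum>b\<in>Basis. deriv_at A (\<lambda>q. deriv_at A (u b) q (X q)) p (Y p) *\<^sub>R e b (f p))"
    unfolding exp[OF X] exp[OF Y] swap by simp
  also have "\<dots> = (\<Sum>b\<in>Basis. deriv_at A (u b) p (lie_bracket A X Y p) *\<^sub>R e b (f p))"
    unfolding sum_subtractf[symmetric] scaleR_diff_left[symmetric] comm ..
  finally show ?thesis by (simp add: df)
qed

lemma bilinear_gN: "bilinear (gN y)"
  using gN unfolding riemannian_metric_def by blast

lemma metric_expansion:
  assumes "d \<in> B" "f q \<in> fst d"
  shows "gN (f q) u w = (\<Sum>a\<in>Basis. \<Sum>b\<in>Basis. (components B d (f q) u \<bullet> a) * ((components B d (f q) w \<bullet> b) *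
    gN (f q) (coord_field B d a (f q)) (coord_field B d b (f q))))"
proof -
  have "gN (f q) u w = gN (f q) (\<Sum>a\<in>Basis. (components B d (f q) u \<bullet> a) *\<^sub>R coord_field B d a (f q))
      (\<Sum>b\<in>Basis. (components B d (f q) w \<bullet> b) *\<^sub>R coord_field B d b (f q))"
    by (simp only: coord_field_expansion[OF B assms, symmetric])
  then show ?thesis
    unfolding bilinear_double_sum[OF bilinear_gN] bilinear_sum_real(3,4)[OF bilinear_gN]
    by (simp only: mult.left_commute)
qed

lemma csmooth_metric_coeff:
  "d \<in> B \<Longrightarrow> csmooth B (fst d) (\<lambda>y. gN y (coord_field B d a y) (coord_field B d b y))"
  using gN chart_open[OF B] smooth_vf_coord_field unfolding riemannian_metric_def smooth_fun_iff by blast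

text \<open>For pulled back coordinate fields this is the metric property of \<open>DN\<close>
  combined with the chain rule. Both sides obey the same Leibniz rule in each of the two sections,
  so it extends to linear combinations with smooth coefficients, hence to all sections.\<close>

lemma D_metric:
  assumes U: "open U" and p: "p \<in> U" and W: "smooth_section A B f U W" and W': "smooth_section A B f U W'"
  shows "deriv_at A (\<lambda>q. gN (f q) (W q) (W' q)) p v = gN (f p) (D p v W) (W' p) + gN (f p) (W p) (D p v W')"
proof -
  define d where "d = chart_at B (f p)"
  have d: "d \<in> B" "f p \<in> fst d" using chart_at_mem[OF B] by (auto simp: d_def)
  let ?V = "U \<inter> f -` fst d"
  have V: "open ?V" "p \<in> ?V" using open_chart_vimage[OF U d(1)] p d by auto
  define e where "e b = coord_field B d b" for b
  define w where "w Z b q = components B d (f q) (Z q) \<bullet> b" for Z b q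
  define G where "G a b q = gN (f q) (e a (f q)) (e b (f q))" for a b q
  define dv where "dv = differential A B f p v"
  define De where "De b = DN (f p) dv (e b)" for b
  have w: "diff_at A (w Z b) p" if "smooth_section A B f U Z" for Z b
    unfolding w_def[abs_def] by (rule csmooth_diff_at[OF A V(1) csmooth_section_coord[OF U that d(1)] V(2)])
  have g: "diff_at B (\<lambda>y. gN y (e a y) (e b y)) (f p)" for a b
    unfolding e_def by (rule csmooth_diff_at[OF B chart_open[OF B d(1)] csmooth_metric_coeff[OF d(1)] d(2)])
  have ve: "smooth_vf B (fst d) (e b)" for b unfolding e_def by (rule smooth_vf_coord_field[OF d(1)])
  have gd: "deriv_at B (\<lambda>y. gN y (e a y) (e b y)) (f p) dv =
      gN (f p) (De a) (e b (f p)) + gN (f p) (e a (f p)) (De b)" for a b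
    unfolding De_def by (rule levi_civita_metric[OF DN chart_open[OF B d(1)] ve ve d(2)])
  have G: "diff_at A (G a b) p" "deriv_at A (G a b) p v = gN (f p) (De a) (e b (f p)) + gN (f p) (e a (f p)) (De b)" for a b
    using deriv_at_compose_map[OF g[of a b]] gd[of a b] by (auto simp: G_def[abs_def] dv_def)
  note wW = w[OF W] and wW' = w[OF W']
  have 1: "diff_at A (\<lambda>q. w W' b q * G a b q) p" for a b
    by (rule deriv_at_mult(1)[OF wW' G(1) A])
  have 2: "diff_at A (\<lambda>q. w W a q * (w W' b q * G a b q)) p" for a b
    by (rule deriv_at_mult(1)[OF wW 1 A])
  have 3: "diff_at A (\<lambda>q. \<Sum>b\<in>Basis. w W a q * (w W' b q * G a b q)) p" for a
    using deriv_at_sum[of Basis A "\<lambda>b q. w W a q * (w W' b q * G a b q)" p, OF 2] by blast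
  have 4: "diff_at A (\<lambda>q. \<Sum>a\<in>Basis. \<Sum>b\<in>Basis. w W a q * (w W' b q * G a b q)) p"
    using deriv_at_sum[of Basis A "\<lambda>a q. \<Sum>b\<in>Basis. w W a q * (w W' b q * G a b q)" p, OF 3] by blast
  have "deriv_at A (\<lambda>q. gN (f q) (W q) (W' q)) p v =
      deriv_at A (\<lambda>q. \<Sum>a\<in>Basis. \<Sum>b\<in>Basis. w W a q * (w W' b q * G a b q)) p v"
    by (rule diff_at_cong(2)[OF A V _ 4]) (use d in \<open>simp add: w_def G_def e_def metric_expansion[symmetric]\<close>)
  also have "\<dots> = (\<Sum>a\<in>Basis. \<Sum>b\<in>Basis. deriv_at A (\<lambda>q. w W a q * (w W' b q * G a b q)) p v)"
    using deriv_at_sum[of Basis A "\<lambda>a q. \<Sum>b\<in>Basis. w W a q * (w W' b q * G a b q)" p, OF 3]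
      deriv_at_sum[of Basis A "\<lambda>b q. w W _ q * (w W' b q * G _ b q)" p, OF 2] by simp
  also have "\<dots> = (\<Sum>a\<in>Basis. \<Sum>b\<in>Basis. w W a p * (w W' b p * deriv_at A (G a b) p v + deriv_at A (w W' b) p v * G a b p) +
      deriv_at A (w W a) p v * (w W' b p * G a b p))"
    by (simp only: deriv_at_mult(2)[OF wW 1 A] deriv_at_mult(2)[OF wW' G(1) A])
  finally have L: "deriv_at A (\<lambda>q. gN (f q) (W q) (W' q)) p v = \<dots>" .
  have exp: "Z p = (\<Sum>b\<in>Basis. w Z b p *\<^sub>R e b (f p))" for Z
    unfolding w_def e_def by (rule coord_field_expansion[OF B d])
  have DZ: "D p v Z = (\<Sum>b\<in>Basis. deriv_at A (w Z b) p v *\<^sub>R e b (f p) + w Z b p *\<^sub>R De b)"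
    if "smooth_section A B f U Z" for Z
    unfolding w_def[abs_def] e_def De_def dv_def by (rule D_expansion[OF U that p d])
  have R1: "gN (f p) (D p v W) (W' p) = (\<Sum>a\<in>Basis. \<Sum>b\<in>Basis. deriv_at A (w W a) p v * (w W' b p * G a b p) +
      w W a p * (w W' b p * gN (f p) (De a) (e b (f p))))"
    unfolding DZ[OF W] exp[of W']
      bilinear_double_sum[OF bilinear_gN] bilinear_sum_real(3-6)[OF bilinear_gN] G_def
    by (intro sum.cong refl) (simp add: algebra_simps)
  have R2: "gN (f p) (W p) (D p v W') = (\<Sum>a\<in>Basis. \<Sum>b\<in>Basis. w W a p * (deriv_at A (w W' b) p v * G a b p) +
      w W a p * (w W' b p * gN (f p) (e a (f p)) (De b)))"
    unfolding DZ[OF W'] exp[of W]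
      bilinear_double_sum[OF bilinear_gN] bilinear_sum_real(3-6)[OF bilinear_gN] G_def
    by (intro sum.cong refl) (simp add: algebra_simps)
  show ?thesis
    unfolding L R1 R2 sum.distrib[symmetric] G(2) by (intro sum.cong refl) (simp add: algebra_simps)
qed

end

section \<open>Orthonormal frames adapted to a submersion\<close>

locale inner_form =
  fixes g :: "'e::euclidean_space \<Rightarrow> 'e \<Rightarrow> real"
  assumes bilinear: "bilinear g" and sym: "g u v = g v u" and pos: "v \<noteq> 0 \<Longrightarrow> g v v > 0"
begin

definition orthonormal :: "nat \<Rightarrow> (nat \<Rightarrow> 'e) \<Rightarrow> bool" where
  "orthonormal n E \<longleftrightarrow> (\<forall>i<n. \<forall>j<n. g (E i) (E j) = (if i = j then 1 else 0))"

lemmas sums = bilinear_sum_real[OF bilinear]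

lemma zero [simp]: "g 0 v = 0" "g v 0 = 0"
  using bilinear by (auto simp: bilinear_lzero bilinear_rzero)

lemma diff: "g (u - u') w = g u w - g u' w" "g w (u - u') = g w u - g w u'"
  using bilinear by (auto simp: bilinear_lsub bilinear_rsub)

lemma subspace_orthogonal: "subspace {w. g v w = 0}"
  by (auto simp: subspace_def sums)

lemma span_orthogonal: "(\<And>s. s \<in> S \<Longrightarrow> g v s = 0) \<Longrightarrow> w \<in> span S \<Longrightarrow> g v w = 0"
  using span_minimal[OF _ subspace_orthogonal, of S v] by blast

lemma eq_zero: "g v v = 0 \<Longrightarrow> v = 0"
  using pos[of v] by fastforce

lemma orthonormal_coeff:
  assumes "orthonormal n E" "j < n"
  shows "g (\<Sum>i<n. c i *\<^sub>R E i) (E j) = c j"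
proof -
  have "g (\<Sum>i<n. c i *\<^sub>R E i) (E j) = (\<Sum>i<n. if i = j then c i else 0)"
    unfolding sums(1) sums(3) using assms by (intro sum.cong refl) (simp add: orthonormal_def)
  then show ?thesis using assms(2) by simp
qed

lemma orthonormal_expansion:
  assumes E: "orthonormal n E" and v: "v \<in> span (E ` {..<n})"
  shows "v = (\<Sum>i<n. g v (E i) *\<^sub>R E i)"
proof -
  have "subspace {v. v = (\<Sum>i<n. g v (E i) *\<^sub>R E i)}"
  proof (rule subspaceI)
    fix x y c
    assume x: "x \<in> {v. v = (\<Sum>i<n. g v (E i) *\<^sub>R E i)}" and y: "y \<in> {v. v = (\<Sum>i<n. g v (E i) *\<^sub>R E i)}"
    have "(\<Sum>i<n. g (x + y) (E i) *\<^sub>R E i) = (\<Sum>i<n. g x (E i) *\<^sub>R E i) + (\<Sum>i<n. g y (E i) *\<^sub>R E i)"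
      by (simp add: sums scaleR_add_left sum.distrib)
    also have "\<dots> = x + y" using x y by simp
    finally show "x + y \<in> {v. v = (\<Sum>i<n. g v (E i) *\<^sub>R E i)}" by simp
    have "(\<Sum>i<n. g (c *\<^sub>R x) (E i) *\<^sub>R E i) = c *\<^sub>R (\<Sum>i<n. g x (E i) *\<^sub>R E i)"
      by (simp add: sums scaleR_sum_right)
    also have "\<dots> = c *\<^sub>R x" using x by simp
    finally show "c *\<^sub>R x \<in> {v. v = (\<Sum>i<n. g v (E i) *\<^sub>R E i)}" by simp
  qed simp
  moreover have "E ` {..<n} \<subseteq> {v. v = (\<Sum>i<n. g v (E i) *\<^sub>R E i)}"
  proof clarify
    fix j assume j: "j < n"
    have "(\<Sum>i<n. g (E j) (E i) *\<^sub>R E i) = (\<Sum>i<n. if i = j then E i else 0)"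
      using E j by (intro sum.cong refl) (auto simp: orthonormal_def)
    then show "E j = (\<Sum>i<n. g (E j) (E i) *\<^sub>R E i)" using j by simp
  qed
  ultimately show ?thesis using span_minimal v by blast
qed

lemma orthonormal_independent:
  assumes E: "orthonormal n E"
  shows "inj_on E {..<n}" "independent (E ` {..<n})"
proof -
  show "inj_on E {..<n}"
  proof (rule inj_onI, rule ccontr)
    fix i j assume ij: "i \<in> {..<n}" "j \<in> {..<n}" and eq: "E i = E j" and ne: "i \<noteq> j"
    from ij ne have "g (E i) (E i) = 1" "g (E i) (E j) = 0" using E by (auto simp: orthonormal_def)
    then show False using eq by simp
  qed
  have "E j \<notin> span (E ` {..<n} - {E j})" if j: "j < n" for j
  proof
    assume "E j \<in> span (E ` {..<n} - {E j})"
    then have "g (E j) (E j) = 0"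
    proof (rule span_orthogonal[rotated])
      fix s assume "s \<in> E ` {..<n} - {E j}"
      then obtain i where "i < n" "i \<noteq> j" "s = E i" by auto
      then show "g (E j) s = 0" using E j by (simp add: orthonormal_def)
    qed
    then show False using E j by (simp add: orthonormal_def)
  qed
  then show "independent (E ` {..<n})" by (auto simp: dependent_def)
qed

lemma orthonormal_span_UNIV:
  assumes E: "orthonormal n E"
  shows "span (E ` {..<n}) = UNIV \<longleftrightarrow> n = DIM('e)"
proof -
  have card: "card (E ` {..<n}) = n" using card_image[OF orthonormal_independent(1)[OF E]] by simp
  have "UNIV \<subseteq> span (E ` {..<n})" if "n = DIM('e)"
    by (rule card_ge_dim_independent[OF _ orthonormal_independent(2)[OF E]]) (use card that in auto)
  moreover have "n = DIM('e)" if "span (E ` {..<n}) = UNIV"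
    using dim_span_eq_card_independent[OF orthonormal_independent(2)[OF E]] that card by simp
  ultimately show ?thesis by blast
qed

lemma orthonormal_parseval:
  assumes E: "orthonormal n E" and v: "v \<in> span (E ` {..<n})"
  shows "g v w = (\<Sum>i<n. g v (E i) * g w (E i))"
proof -
  have "g v w = g (\<Sum>i<n. g v (E i) *\<^sub>R E i) w" using orthonormal_expansion[OF E v] by simp
  also have "\<dots> = (\<Sum>i<n. g v (E i) * g w (E i))" unfolding sums(1) sums(3) by (simp add: sym)
  finally show ?thesis .
qed

end

lemma riemannian_inner_form: "riemannian_metric A g \<Longrightarrow> inner_form (g p)"
  unfolding riemannian_metric_def inner_form_def by blast

text \<open>One step of Gram-Schmidt replaces \<open>v\<close> by a nonzero multiple of \<open>v -
  w\<close>, where \<open>w\<close> is in the span already treated; this does not change the span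
  obtained by adding the vector.\<close>

lemma span_insert_shift:
  fixes v w :: "'v::real_vector"
  assumes "span S = span T" "w \<in> span T" "c \<noteq> 0"
  shows "span (insert (c *\<^sub>R (v - w)) S) = span (insert v T)"
proof (rule set_eqI)
  fix x
  have "x \<in> span (insert (c *\<^sub>R (v - w)) S) \<longleftrightarrow> (\<exists>k. x - k *\<^sub>R (c *\<^sub>R (v - w)) \<in> span T)"
    by (simp add: span_breakdown_eq assms(1))
  also have "\<dots> \<longleftrightarrow> (\<exists>k. x - k *\<^sub>R v \<in> span T)"
  proof -
    have *: "x - (k * c) *\<^sub>R (v - w) \<in> span T \<longleftrightarrow> x - (k * c) *\<^sub>R v \<in> span T" for k
      using span_add_eq[OF span_scale[OF assms(2), of "k * c"], of "x - (k * c) *\<^sub>R v"]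
        span_add_eq2[OF span_scale[OF assms(2), of "k * c"], of "x - (k * c) *\<^sub>R v"]
      by (simp add: algebra_simps)
    show ?thesis
    proof
      assume "\<exists>k. x - k *\<^sub>R (c *\<^sub>R (v - w)) \<in> span T"
      then show "\<exists>k. x - k *\<^sub>R v \<in> span T" using * by auto
    next
      assume "\<exists>k. x - k *\<^sub>R v \<in> span T"
      then obtain k where "x - k *\<^sub>R v \<in> span T" by blast
      then have "x - (k / c * c) *\<^sub>R (v - w) \<in> span T" using *[of "k / c"] assms(3) by simp
      then show "\<exists>k. x - k *\<^sub>R (c *\<^sub>R (v - w)) \<in> span T" by (intro exI[of _ "k / c"]) simp
    qed
  qed
  also have "\<dots> \<longleftrightarrow> x \<in> span (insert v T)" by (simp add: span_breakdown_eq)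
  finally show "x \<in> span (insert (c *\<^sub>R (v - w)) S) \<longleftrightarrow> x \<in> span (insert v T)" .
qed

text \<open>Linear independence in the sequential form in which Gram-Schmidt consumes it.\<close>

lemma independent_enumeration:
  fixes S :: "'v::euclidean_space set"
  assumes "independent S"
  shows "\<exists>\<beta>. bij_betw \<beta> {..<card S} S \<and> (\<forall>i<card S. \<beta> i \<notin> span (\<beta> ` {..<i}))"
proof -
  obtain \<beta> where b: "bij_betw \<beta> {..<card S} S"
    using ex_bij_betw_nat_finite[OF independent_imp_finite[OF assms]] by (auto simp: lessThan_atLeast0)
  have "\<beta> i \<notin> span (\<beta> ` {..<i})" if i: "i < card S" for i
  proof
    assume "\<beta> i \<in> span (\<beta> ` {..<i})"
    moreover have "\<beta> ` {..<i} \<subseteq> S - {\<beta> i}"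
      using b i by (auto simp: bij_betw_def inj_on_def)
    ultimately have "\<beta> i \<in> span (S - {\<beta> i})" using span_mono by blast
    moreover have "\<beta> i \<in> S" using b i by (auto simp: bij_betw_def)
    ultimately show False using assms by (auto simp: dependent_def)
  qed
  then show ?thesis using b by blast
qed

context
  fixes A :: "('a::{t2_space,second_countable_topology}, 'e::euclidean_space) chart set"
    and g :: "'a \<Rightarrow> 'e \<Rightarrow> 'e \<Rightarrow> real"
  assumes A: "smooth_atlas A" and g: "riemannian_metric A g"
begin

interpretation I: manifold_map A A "\<lambda>p. p" by (rule manifold_map_ident[OF A])

lemma csmooth_continuous:
  fixes f :: "'a \<Rightarrow> 'f::real_normed_vector"
  assumes U: "open U" and f: "csmooth A U f"
  shows "continuous_on U f"
proof (rule continuous_at_imp_continuous_on, rule ballI)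
  fix p assume p: "p \<in> U"
  define c where "c = chart_at A p"
  have c: "c \<in> A" "p \<in> fst c" using chart_at_mem[OF A] by (auto simp: c_def)
  let ?W = "U \<inter> fst c"
  have "continuous_on (snd c ` ?W) (f \<circ> chart_inv c)"
    using f c by (metis C_on.simps(1) csmooth_def smooth_on_def)
  moreover have "continuous_on ?W (snd c)"
    using chart_homeomorphism[OF A c(1)] by (meson Int_lower2 continuous_on_subset homeomorphism_def)
  ultimately have "continuous_on ?W ((f \<circ> chart_inv c) \<circ> snd c)"
    by (rule continuous_on_compose[rotated])
  then have "continuous_on ?W f"
    by (rule continuous_on_cong[THEN iffD1, rotated 2]) (use c in \<open>auto simp: chart_inv_snd[OF A]\<close>)
  moreover have "open ?W" using U chart_open[OF A c(1)] by blast
  ultimately show "isCont f p" using p c by (simp add: continuous_on_eq_continuous_at)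
qed

lemma csmooth_inner_fields:
  "open U \<Longrightarrow> smooth_vf A U X \<Longrightarrow> smooth_vf A U Y \<Longrightarrow> csmooth A U (\<lambda>q. g q (X q) (Y q))"
  using g[unfolded riemannian_metric_def, THEN conjunct2, THEN spec, THEN spec, THEN spec, THEN mp, OF conjI[OF _ conjI]]
  by (simp add: smooth_fun_iff)

text \<open>Fields that are linearly independent at \<open>p\<close> are orthonormalised on a
  possibly smaller neighbourhood: in each step the squared length \<open>N\<close> of the residual
  field \<open>Z\<close> is positive at \<open>p\<close>, hence near \<open>p\<close>. The equality
  of all initial spans is needed so that an initial segment spanning a given distribution still does
  so after orthonormalisation.\<close>

lemma smooth_gram_schmidt:
  assumes "open U" "p \<in> U" "\<And>i. i < n \<Longrightarrow> smooth_vf A U (V i)"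
    and "\<And>i. i < n \<Longrightarrow> V i p \<notin> span ((\<lambda>j. V j p) ` {..<i})"
  shows "\<exists>U' E. open U' \<and> p \<in> U' \<and> U' \<subseteq> U \<and> (\<forall>i<n. smooth_vf A U' (E i)) \<and>
    (\<forall>q\<in>U'. inner_form.orthonormal (g q) n (\<lambda>i. E i q) \<and>
      (\<forall>j\<le>n. span ((\<lambda>i. E i q) ` {..<j}) = span ((\<lambda>i. V i q) ` {..<j})))"
  using assms(3,4)
proof (induction n)
  case 0
  have "inner_form.orthonormal (g q) 0 E" for q E
    by (simp add: inner_form.orthonormal_def[OF riemannian_inner_form[OF g]])
  then show ?case using assms(1,2) by (intro exI[of _ U]) auto
next
  case (Suc n)
  then obtain U1 E where U1: "open U1" "p \<in> U1" "U1 \<subseteq> U"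
    and E: "\<And>i. i < n \<Longrightarrow> smooth_vf A U1 (E i)"
    and on: "\<And>q. q \<in> U1 \<Longrightarrow> inner_form.orthonormal (g q) n (\<lambda>i. E i q)"
    and sp: "\<And>q j. q \<in> U1 \<Longrightarrow> j \<le> n \<Longrightarrow> span ((\<lambda>i. E i q) ` {..<j}) = span ((\<lambda>i. V i q) ` {..<j})"
    by (metis less_SucI)
  have V: "smooth_vf A U1 (V n)" using I.smooth_section_subset[OF Suc.prems(1)[of n] U1(3)] by simp
  define w where "w q = (\<Sum>i<n. g q (V n q) (E i q) *\<^sub>R E i q)" for q
  have w: "smooth_vf A U1 w"
    unfolding w_def[abs_def]
    by (intro I.smooth_section_sum I.smooth_section_scaleR U1(1) csmooth_inner_fields V E) auto
  define Z where "Z q = V n q + (-1) *\<^sub>R w q" for q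
  have Z: "smooth_vf A U1 Z"
    unfolding Z_def[abs_def]
    by (intro I.smooth_section_add I.smooth_section_scaleR[where h = "\<lambda>_. -1"] U1(1) V w csmooth_const)
  have Zd: "Z q = V n q - w q" for q by (simp add: Z_def)
  define N where "N q = g q (Z q) (Z q)" for q
  have N: "csmooth A U1 N" unfolding N_def[abs_def] by (intro csmooth_inner_fields U1(1) Z)
  define U2 where "U2 = U1 \<inter> N -` {0<..}"
  have U2: "open U2" unfolding U2_def
    by (rule continuous_open_preimage[OF csmooth_continuous[OF U1(1) N] U1(1)]) simp
  have w_span: "w q \<in> span ((\<lambda>i. E i q) ` {..<n})" for q
    unfolding w_def by (intro span_sum span_scale span_base) auto
  have p2: "p \<in> U2"
  proof -
    interpret G: inner_form "g p" by (rule riemannian_inner_form[OF g])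
    have "Z p \<noteq> 0"
    proof
      assume "Z p = 0"
      then have "V n p \<in> span ((\<lambda>i. V i p) ` {..<n})"
        using w_span[of p] sp[OF U1(2), of n] by (simp add: Zd)
      then show False using Suc.prems(2)[of n] by simp
    qed
    then show ?thesis using G.pos[of "Z p"] U1(2) by (simp add: U2_def N_def)
  qed
  define F where "F i q = (if i = n then (N q powr (-1/2)) *\<^sub>R Z q else E i q)" for i q
  have sub: "smooth_vf A U2 X" if "smooth_vf A U1 X" for X
    by (rule I.smooth_section_subset[OF that]) (auto simp: U2_def)
  have "smooth_vf A U2 (F i)" if i: "i < Suc n" for i
  proof (cases "i = n")
    case True
    have "csmooth A U2 (\<lambda>q. N q powr (-1/2))"
      by (rule csmooth_compose[OF A U2 open_greaterThan[of 0] _ csmooth_subset[OF N] smooth_on_powr])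
        (auto simp: U2_def)
    from I.smooth_section_scaleR[OF U2 this sub[OF Z]] show ?thesis
      using True by (simp add: F_def[abs_def])
  next
    case False
    then show ?thesis using i sub[OF E, of i] by (simp add: F_def[abs_def])
  qed
  moreover have "inner_form.orthonormal (g q) (Suc n) (\<lambda>i. F i q) \<and>
      (\<forall>j\<le>Suc n. span ((\<lambda>i. F i q) ` {..<j}) = span ((\<lambda>i. V i q) ` {..<j}))" if q: "q \<in> U2" for q
  proof
    interpret G: inner_form "g q" by (rule riemannian_inner_form[OF g])
    have q1: "q \<in> U1" and Nq: "N q > 0" using q by (auto simp: U2_def)
    have oE: "G.orthonormal n (\<lambda>i. E i q)" by (rule on[OF q1])
    have ZE: "g q (Z q) (E j q) = 0" if "j < n" for j
      unfolding Zd G.diff w_def by (simp add: G.orthonormal_coeff[OF oE that])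
    have "N q powr (-1/2) * (N q powr (-1/2) * g q (Z q) (Z q)) = 1"
      using Nq powr_add[of "N q" "-1/2" "-1/2"]
      by (simp add: N_def[symmetric] mult.assoc[symmetric] powr_minus_divide)
    then have FF: "g q (F n q) (F n q) = 1" by (simp add: F_def G.sums)
    have FE: "g q (F n q) (F j q) = 0" "g q (F j q) (F n q) = 0" if "j < n" for j
      using ZE[OF that] that by (auto simp: F_def G.sums G.sym[of "E j q"])
    show "G.orthonormal (Suc n) (\<lambda>i. F i q)"
      unfolding G.orthonormal_def
    proof (intro allI impI)
      fix i j assume "i < Suc n" "j < Suc n"
      then show "g q (F i q) (F j q) = (if i = j then 1 else 0)"
        using FF FE[of i] FE[of j] oE[unfolded G.orthonormal_def]
        by (cases "i = n"; cases "j = n") (auto simp: F_def)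
    qed
    have low: "(\<lambda>i. F i q) ` {..<j} = (\<lambda>i. E i q) ` {..<j}" if "j \<le> n" for j
      using that by (auto simp: F_def image_iff)
    show "\<forall>j\<le>Suc n. span ((\<lambda>i. F i q) ` {..<j}) = span ((\<lambda>i. V i q) ` {..<j})"
    proof (intro allI impI)
      fix j assume "j \<le> Suc n"
      show "span ((\<lambda>i. F i q) ` {..<j}) = span ((\<lambda>i. V i q) ` {..<j})"
      proof (cases "j \<le> n")
        case True
        then show ?thesis using sp[OF q1] low by simp
      next
        case False
        then have j: "j = Suc n" using \<open>j \<le> Suc n\<close> by simp
        have "span (insert ((N q powr (-1/2)) *\<^sub>R (V n q - w q)) ((\<lambda>i. E i q) ` {..<n})) =
            span (insert (V n q) ((\<lambda>i. V i q) ` {..<n}))"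
          by (rule span_insert_shift[OF sp[OF q1]]) (use w_span[of q] sp[OF q1] Nq in auto)
        then show ?thesis
          unfolding j lessThan_Suc image_insert low[OF order_refl] by (simp add: F_def Zd)
      qed
    qed
  qed
  ultimately show ?case
    using U2 p2 U1(3) by (intro exI[of _ U2] exI[of _ F]) (auto simp: U2_def)
qed

lemma smooth_vf_coord_field_chart: "c \<in> A \<Longrightarrow> smooth_vf A (fst c) (coord_field A c b)"
  using I.smooth_section_coord_field by simp

text \<open>Tangent vectors at \<open>p\<close> are extended to smooth fields in this way; so
  bases of subspaces of the tangent space at \<open>p\<close> can enter Gram-Schmidt.\<close>

lemma coord_field_chart_at: "coord_field A (chart_at A p) u p = u"
  using coord_field_components[OF A chart_at_mem[OF A], of p u] by (simp add: components_chart_at[OF A])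

lemma orthonormal_frame_exists:
  obtains U E where "open U" "p \<in> U" "\<And>i. i < DIM('e) \<Longrightarrow> smooth_vf A U (E i)"
    "\<And>q. q \<in> U \<Longrightarrow> inner_form.orthonormal (g q) (DIM('e)) (\<lambda>i. E i q)"
proof -
  obtain \<beta> :: "nat \<Rightarrow> 'e" where b: "\<And>i. i < DIM('e) \<Longrightarrow> \<beta> i \<notin> span (\<beta> ` {..<i})"
    using independent_enumeration[OF independent_Basis[where 'a = 'e]] by auto
  let ?c = "chart_at A p"
  have "\<exists>U' E. open U' \<and> p \<in> U' \<and> U' \<subseteq> fst ?c \<and> (\<forall>i<DIM('e). smooth_vf A U' (E i)) \<and>
    (\<forall>q\<in>U'. inner_form.orthonormal (g q) (DIM('e)) (\<lambda>i. E i q) \<and>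
      (\<forall>j\<le>DIM('e). span ((\<lambda>i. E i q) ` {..<j}) = span ((\<lambda>i. coord_field A ?c (\<beta> i) q) ` {..<j})))"
    by (rule smooth_gram_schmidt[OF chart_open[OF A chart_at_mem(1)[OF A]] chart_at_mem(2)[OF A]
          smooth_vf_coord_field_chart[OF chart_at_mem(1)[OF A]]])
      (use b in \<open>simp add: coord_field_chart_at\<close>)
  then show ?thesis using that by blast
qed

end

locale submersion_setting = manifold_map A B f
  for A :: "('a::{t2_space,second_countable_topology}, 'e::euclidean_space) chart set"
    and B :: "('b::{t2_space,second_countable_topology}, 'k::euclidean_space) chart set"
    and f :: "'a \<Rightarrow> 'b" +
  fixes g :: "'a \<Rightarrow> 'e \<Rightarrow> 'e \<Rightarrow> real"
  assumes g: "riemannian_metric A g" and surj_differential: "surj (differential A B f p)"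
begin

sublocale I: manifold_map A A "\<lambda>p. p" by (rule manifold_map_ident[OF A])

sublocale G: inner_form "g p" for p by (rule riemannian_inner_form[OF g])

lemma subspace_vertical: "subspace (vertical A B f q)"
  using linear_differential[of q]
  by (auto simp: vertical_def subspace_def linear_0 linear_add linear_cmul)

lemma subspace_horizontal: "subspace (horizontal A B g f q)"
  by (auto simp: horizontal_def subspace_def G.sums)

lemma vertical_horizontal_zero: "u \<in> vertical A B f q \<Longrightarrow> u \<in> horizontal A B g f q \<Longrightarrow> u = 0"
  by (auto simp: horizontal_def intro: G.eq_zero)

text \<open>Near \<open>p\<close> let \<open>u a\<close> be the coordinates of \<open>f\<close>.
  Their gradients \<open>h a\<close> are smooth, they are horizontal because the \<open>u a\<close>
  are constant along vertical directions, and they are independent because \<open>f\<close> is a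
  submersion. Gram-Schmidt is applied to the \<open>h a\<close>, followed by extensions of a basis
  \<open>\<gamma>\<close> of the vertical space at \<open>p\<close>. The first members of the
  resulting frame have the same span as the \<open>h a\<close>; a vector orthogonal to that span is
  annihilated by all differentials of the \<open>u a\<close>, so it is vertical, and this applies to
  the remaining members at every point, not only at \<open>p\<close>.\<close>

lemma adapted_frame_exists:
  obtains U F where "open U" "p \<in> U" "\<And>i. i < DIM('e) \<Longrightarrow> smooth_vf A U (F i)"
    "\<And>q. q \<in> U \<Longrightarrow> G.orthonormal q (DIM('e)) (\<lambda>i. F i q)"
    "\<And>q i. q \<in> U \<Longrightarrow> i < DIM('k) \<Longrightarrow> F i q \<in> horizontal A B g f q"
    "\<And>q i. q \<in> U \<Longrightarrow> DIM('k) \<le> i \<Longrightarrow> i < DIM('e) \<Longrightarrow> F i q \<in> vertical A B f q"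
    "DIM('e) = DIM('k) + dim (vertical A B f p)"
proof -
  define r where "r = DIM('k)"
  define k where "k = dim (vertical A B f p)"
  obtain U0 E where U0: "open U0" "p \<in> U0" and E: "\<And>i. i < DIM('e) \<Longrightarrow> smooth_vf A U0 (E i)"
    and oE: "\<And>q. q \<in> U0 \<Longrightarrow> G.orthonormal q (DIM('e)) (\<lambda>i. E i q)"
    using orthonormal_frame_exists[OF A g] by blast
  obtain \<beta> where \<beta>: "bij_betw \<beta> {..<r} (Basis :: 'k set)"
    unfolding r_def using independent_enumeration[OF independent_Basis[where 'a = 'k]] by auto
  have \<beta>\<beta>: "\<beta> i \<bullet> \<beta> j = (if j = i then 1 else 0)" if "i < r" "j < r" for i j
  proof -
    have "\<beta> i \<in> Basis" "\<beta> j \<in> Basis" "\<beta> i = \<beta> j \<longleftrightarrow> i = j"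
      using \<beta> that by (auto simp: bij_betw_def inj_on_eq_iff)
    then show ?thesis by (auto simp: inner_Basis)
  qed
  define d where "d = chart_at B (f p)"
  have d: "d \<in> B" "f p \<in> fst d" using chart_at_mem[OF B] by (auto simp: d_def)
  define c where "c = chart_at A p"
  have c: "c \<in> A" "p \<in> fst c" using chart_at_mem[OF A] by (auto simp: c_def)
  define U1 where "U1 = (U0 \<inter> f -` fst d) \<inter> fst c"
  have U1: "open U1" "p \<in> U1"
    using open_chart_vimage[OF U0(1) d(1)] U0 d c chart_open[OF A c(1)] by (auto simp: U1_def)
  define u where "u a q = snd d (f q) \<bullet> \<beta> a" for a q
  have u: "csmooth A U1 (u a)" for a
    unfolding u_def[abs_def]
    by (rule csmooth_inner[OF A U1(1) csmooth_subset[OF csmooth_coord[OF d(1)]]]) (auto simp: U1_def)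
  have linu: "linear (deriv_at A (u a) q)" if "q \<in> U1" for a q
    by (rule linear_deriv_at[OF csmooth_diff_at[OF A U1(1) u that]])
  have du: "deriv_at A (u a) q v = components B d (f q) (differential A B f q v) \<bullet> \<beta> a" if "q \<in> U1" for a q v
    using that d by (simp add: U1_def components_differential u_def[abs_def] deriv_at_inner(2)[OF diff_at_coord A])
  have ver_iff: "v \<in> vertical A B f q \<longleftrightarrow> (\<forall>a<r. deriv_at A (u a) q v = 0)" if q: "q \<in> U1" for q v
  proof
    assume "v \<in> vertical A B f q"
    then show "\<forall>a<r. deriv_at A (u a) q v = 0"
      using q d linear_0[OF linear_components[OF B d(1), of "f q"]] by (simp add: du vertical_def U1_def)
  next
    assume 0: "\<forall>a<r. deriv_at A (u a) q v = 0"
    have fq: "f q \<in> fst d" using q by (simp add: U1_def)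
    have "components B d (f q) (differential A B f q v) \<bullet> b = 0" if b: "b \<in> Basis" for b
    proof -
      obtain a where "a < r" "b = \<beta> a" using \<beta> b by (auto simp: bij_betw_def)
      then show ?thesis using 0 du[OF q] by simp
    qed
    then have "components B d (f q) (differential A B f q v) = 0" using euclidean_all_zero_iff by blast
    then show "v \<in> vertical A B f q"
      using components_inject[OF B d(1) fq, of "differential A B f q v" 0]
        linear_0[OF linear_components[OF B d(1) fq]] by (simp add: vertical_def)
  qed
  \<comment> \<open>The gradient of \<open>u a\<close>, written in an orthonormal frame to make
    its smoothness evident.\<close>
  define h where "h a q = (\<Sum>i<DIM('e). deriv_at A (u a) q (E i q) *\<^sub>R E i q)" for a q
  have E1: "smooth_vf A U1 (E i)" if "i < DIM('e)" for i
    by (rule I.smooth_section_subset[OF E[OF that]]) (auto simp: U1_def)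
  have h: "smooth_vf A U1 (h a)" for a
    unfolding h_def[abs_def]
    by (intro I.smooth_section_sum I.smooth_section_scaleR csmooth_deriv_at[OF A] u U1(1) E1) auto
  have gh: "g q (h a q) v = deriv_at A (u a) q v" if q: "q \<in> U1" for a q v
  proof -
    have oq: "G.orthonormal q (DIM('e)) (\<lambda>i. E i q)" using oE q by (simp add: U1_def)
    then have v: "v = (\<Sum>i<DIM('e). g q v (E i q) *\<^sub>R E i q)"
      using G.orthonormal_expansion[OF oq, of v] G.orthonormal_span_UNIV[OF oq] by blast
    have "deriv_at A (u a) q v = deriv_at A (u a) q (\<Sum>i<DIM('e). g q v (E i q) *\<^sub>R E i q)"
      using v by (rule arg_cong)
    also have "\<dots> = (\<Sum>i<DIM('e). g q v (E i q) * deriv_at A (u a) q (E i q))"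
      by (simp add: linear_sum[OF linu[OF q]] linear_cmul[OF linu[OF q]])
    also have "\<dots> = g q (h a q) v"
      unfolding h_def G.sums(1) G.sums(3) by (intro sum.cong refl) (simp add: G.sym mult.commute)
    finally show ?thesis by simp
  qed
  have h_hor: "h a q \<in> horizontal A B g f q" if "q \<in> U1" "a < r" for a q
    using that ver_iff[OF that(1)] by (auto simp: horizontal_def gh)
  obtain S where S: "S \<subseteq> vertical A B f p" "independent S" "span S = vertical A B f p" "card S = k"
    using basis_subspace_exists[OF subspace_vertical[of p]] unfolding k_def by metis
  obtain \<gamma> where \<gamma>: "bij_betw \<gamma> {..<k} S" "\<And>i. i < k \<Longrightarrow> \<gamma> i \<notin> span (\<gamma> ` {..<i})"
    using independent_enumeration[OF S(2)] unfolding S(4) by auto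
  have \<gamma>v: "\<gamma> i \<in> vertical A B f p" if "i < k" for i using \<gamma>(1) that S(1) by (auto simp: bij_betw_def)
  define V where "V i q = (if i < r then h i q else coord_field A c (\<gamma> (i - r)) q)" for i q
  have Vp: "V i p = (if i < r then h i p else \<gamma> (i - r))" for i
    by (simp add: V_def c_def coord_field_chart_at[OF A g])
  have V: "smooth_vf A U1 (V i)" for i
  proof (cases "i < r")
    case True
    then show ?thesis using h by (simp add: V_def[abs_def])
  next
    case False
    have "smooth_vf A U1 (coord_field A c (\<gamma> (i - r)))"
      by (rule I.smooth_section_subset[OF smooth_vf_coord_field_chart[OF A g c(1)]]) (auto simp: U1_def)
    then show ?thesis using False by (simp add: V_def[abs_def])
  qed
  have indep: "V i p \<notin> span ((\<lambda>j. V j p) ` {..<i})" if i: "i < r + k" for i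
  proof (cases "i < r")
    case True
    \<comment> \<open>A vector orthogonal to all the gradients but the \<open>i\<close>-th
      one.\<close>
    obtain v where v: "differential A B f p v = coord_field B d (\<beta> i) (f p)"
      using surj_differential[of p] by (metis surjD)
    have "g p (h j p) v = (if j = i then 1 else 0)" if "j < r" for j
      using that True d by (simp add: gh[OF U1(2)] du[OF U1(2)] v components_coord_field_same[OF B] \<beta>\<beta>)
    then have 1: "g p v (h j p) = (if j = i then 1 else 0)" if "j < r" for j
      using that by (simp add: G.sym[of p v])
    show ?thesis
    proof
      assume "V i p \<in> span ((\<lambda>j. V j p) ` {..<i})"
      then have "g p v (V i p) = 0"
        by (rule G.span_orthogonal[rotated]) (use 1 True in \<open>auto simp: Vp\<close>)
      then show False using 1[of i] True by (simp add: Vp)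
    qed
  next
    case False
    let ?j = "i - r"
    have j: "?j < k" using i False by simp
    show ?thesis
    proof
      assume "V i p \<in> span ((\<lambda>j. V j p) ` {..<i})"
      moreover have "(\<lambda>j. V j p) ` {..<i} \<subseteq> (\<lambda>j. h j p) ` {..<r} \<union> \<gamma> ` {..<?j}"
        using False by (auto simp: Vp)
      ultimately have "V i p \<in> span ((\<lambda>j. h j p) ` {..<r} \<union> \<gamma> ` {..<?j})"
        by (rule subsetD[OF span_mono, rotated])
      then have "\<gamma> ?j \<in> span ((\<lambda>j. h j p) ` {..<r} \<union> \<gamma> ` {..<?j})"
        using False by (simp add: Vp)
      then obtain x y where xy: "\<gamma> ?j = x + y" "x \<in> span ((\<lambda>j. h j p) ` {..<r})" "y \<in> span (\<gamma> ` {..<?j})"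
        unfolding span_Un by auto
      have "x \<in> horizontal A B g f p"
        by (rule subsetD[OF span_minimal[OF _ subspace_horizontal] xy(2)]) (use h_hor[OF U1(2)] in auto)
      moreover have "\<gamma> ` {..<?j} \<subseteq> vertical A B f p"
        using j by (auto intro!: \<gamma>v)
      then have "y \<in> vertical A B f p"
        by (rule subsetD[OF span_minimal[OF _ subspace_vertical] xy(3)])
      then have "x \<in> vertical A B f p"
        using subspace_diff[OF subspace_vertical \<gamma>v[OF j], of y] xy(1) by simp
      ultimately have "x = 0" by (rule vertical_horizontal_zero[rotated])
      then show False using xy \<gamma>(2)[OF j] by simp
    qed
  qed
  have GS: "\<exists>U F. open U \<and> p \<in> U \<and> U \<subseteq> U1 \<and> (\<forall>i<r + k. smooth_vf A U (F i)) \<and>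
    (\<forall>q\<in>U. G.orthonormal q (r + k) (\<lambda>i. F i q) \<and>
      (\<forall>j\<le>r + k. span ((\<lambda>i. F i q) ` {..<j}) = span ((\<lambda>i. V i q) ` {..<j})))"
    by (rule smooth_gram_schmidt[OF A g U1 V indep])
  obtain U F where UF: "open U \<and> p \<in> U \<and> U \<subseteq> U1 \<and> (\<forall>i<r + k. smooth_vf A U (F i)) \<and>
    (\<forall>q\<in>U. G.orthonormal q (r + k) (\<lambda>i. F i q) \<and>
      (\<forall>j\<le>r + k. span ((\<lambda>i. F i q) ` {..<j}) = span ((\<lambda>i. V i q) ` {..<j})))"
    using GS by (elim exE)
  then have U: "open U" "p \<in> U" "U \<subseteq> U1" and F: "\<And>i. i < r + k \<Longrightarrow> smooth_vf A U (F i)"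
    and oF: "\<And>q. q \<in> U \<Longrightarrow> G.orthonormal q (r + k) (\<lambda>i. F i q)"
    and spF: "\<And>q j. q \<in> U \<Longrightarrow> j \<le> r + k \<Longrightarrow> span ((\<lambda>i. F i q) ` {..<j}) = span ((\<lambda>i. V i q) ` {..<j})"
    by simp_all
  have hor: "F i q \<in> horizontal A B g f q" if q: "q \<in> U" and i: "i < r" for i q
  proof -
    have "F i q \<in> span ((\<lambda>i. F i q) ` {..<r})" using i by (auto intro: span_base)
    also have "\<dots> = span ((\<lambda>i. V i q) ` {..<r})" using spF[OF q] by simp
    also have "\<dots> \<subseteq> horizontal A B g f q"
      using h_hor q U(3) by (intro span_minimal subspace_horizontal) (auto simp: V_def)
    finally show ?thesis .
  qed
  have ver_perp: "v \<in> vertical A B f q" if q: "q \<in> U" and 0: "\<And>i. i < r \<Longrightarrow> g q v (F i q) = 0" for v q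
  proof -
    have q1: "q \<in> U1" using q U(3) by blast
    have "deriv_at A (u a) q v = 0" if a: "a < r" for a
    proof -
      have "V a q \<in> span ((\<lambda>i. V i q) ` {..<r})" using a by (auto intro: span_base)
      also have "\<dots> = span ((\<lambda>i. F i q) ` {..<r})" using spF[OF q] by simp
      finally have "g q v (V a q) = 0" by (rule G.span_orthogonal[rotated]) (use 0 in auto)
      then show ?thesis using a by (simp add: V_def G.sym[of q v] gh[OF q1])
    qed
    then show ?thesis using ver_iff[OF q1] by simp
  qed
  have ver: "F i q \<in> vertical A B f q" if q: "q \<in> U" and i: "r \<le> i" "i < r + k" for i q
    by (rule ver_perp[OF q]) (use oF[OF q, unfolded G.orthonormal_def] i in auto)
  have "span ((\<lambda>i. F i p) ` {..<r + k}) = UNIV"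
  proof (rule ccontr)
    let ?Fs = "(\<lambda>i. F i p) ` {..<r + k}"
    assume "span ?Fs \<noteq> UNIV"
    then obtain v where v: "v \<notin> span ?Fs" by blast
    \<comment> \<open>The residual of \<open>v\<close> is orthogonal to the frame, hence vertical,
      hence in the span of \<open>\<gamma>\<close>, which is contained in the span of the
      frame.\<close>
    define z where "z = v - (\<Sum>i<r + k. g p v (F i p) *\<^sub>R F i p)"
    have z: "g p z (F j p) = 0" if "j < r + k" for j
      unfolding z_def G.diff by (simp add: G.orthonormal_coeff[OF oF[OF U(2)] that])
    have "z \<in> vertical A B f p" by (rule ver_perp[OF U(2)]) (simp add: z)
    then have "z \<in> span (\<gamma> ` {..<k})" using S(3) \<gamma>(1) by (simp add: bij_betw_def)
    also have "\<dots> \<subseteq> span ((\<lambda>i. V i p) ` {..<r + k})"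
    proof (rule span_mono, clarify)
      fix i assume "i < k"
      then show "\<gamma> i \<in> (\<lambda>i. V i p) ` {..<r + k}" by (intro image_eqI[of _ _ "r + i"]) (auto simp: Vp)
    qed
    also have "\<dots> = span ?Fs" using spF[OF U(2)] by simp
    finally have zs: "z \<in> span ?Fs" .
    then have "g p z z = 0" by (rule G.span_orthogonal[rotated]) (use z in auto)
    then have "z = 0" by (rule G.eq_zero)
    then have "v = (\<Sum>i<r + k. g p v (F i p) *\<^sub>R F i p)" by (simp add: z_def)
    moreover have "(\<Sum>i<r + k. g p v (F i p) *\<^sub>R F i p) \<in> span ?Fs"
      by (intro span_sum span_scale span_base) auto
    ultimately show False using v by simp
  qed
  then have dim: "DIM('e) = r + k" using G.orthonormal_span_UNIV[OF oF[OF U(2)]] by simp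
  show ?thesis
    by (rule that[OF U(1,2)]) (use F oF hor ver dim in \<open>auto simp: r_def k_def\<close>)
qed

end

section \<open>The tension field of a horizontally conformal submersion\<close>

locale conformal_setting = pullback_setting A B f D gN DN + submersion_setting A B f g
  for A :: "('a::{t2_space,second_countable_topology}, 'e::euclidean_space) chart set"
    and B :: "('b::{t2_space,second_countable_topology}, 'k::euclidean_space) chart set"
    and f :: "'a \<Rightarrow> 'b" and D :: "'a \<Rightarrow> 'e \<Rightarrow> ('a \<Rightarrow> 'k) \<Rightarrow> 'k"
    and gN :: "'b \<Rightarrow> 'k \<Rightarrow> 'k \<Rightarrow> real" and DN :: "'b \<Rightarrow> 'k \<Rightarrow> ('b \<Rightarrow> 'k) \<Rightarrow> 'k"
    and g :: "'a \<Rightarrow> 'e \<Rightarrow> 'e \<Rightarrow> real" +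
  fixes DM :: "'a \<Rightarrow> 'e \<Rightarrow> ('a \<Rightarrow> 'e) \<Rightarrow> 'e" and dil :: "'a \<Rightarrow> real"
  assumes DM: "levi_civita A g DM" and dil: "csmooth A UNIV dil" and dil_pos: "dil q > 0"
    and conformal: "u \<in> horizontal A B g f q \<Longrightarrow> v \<in> horizontal A B g f q \<Longrightarrow>
      (dil q)\<^sup>2 * g q u v = gN (f q) (differential A B f q u) (differential A B f q v)"
begin

sublocale M: map_connection A A "\<lambda>p. p" DM
  by unfold_locales (rule levi_civita_connection[OF DM])

sublocale GN: inner_form "gN y" for y by (rule riemannian_inner_form[OF gN])

abbreviation df :: "'a \<Rightarrow> 'e \<Rightarrow> 'k" where "df \<equiv> differential A B f"

abbreviation S :: "('a \<Rightarrow> 'e) \<Rightarrow> ('a \<Rightarrow> 'e) \<Rightarrow> 'a \<Rightarrow> 'k" where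
  "S \<equiv> second_fundamental_form A B DM D f"

lemmas df_linear = linear_add[OF linear_differential] linear_cmul[OF linear_differential]
  linear_sum[OF linear_differential] linear_diff[OF linear_differential] linear_0[OF linear_differential]

text \<open>Both connections are torsion-free, and the bracket terms cancel.\<close>

lemma second_fundamental_form_sym:
  assumes "open U" "p \<in> U" "smooth_vf A U X" "smooth_vf A U Y"
  shows "S X Y p = S Y X p"
proof -
  have "df p (DM p (X p) Y) - df p (DM p (Y p) X) = df p (lie_bracket A X Y p)"
    using levi_civita_torsion_free[OF DM assms(1,3,4,2)] by (simp add: df_linear[symmetric])
  then show ?thesis
    using D_torsion_free[OF assms] by (simp add: second_fundamental_form_def algebra_simps)
qed

lemma second_fundamental_form_vertical:
  assumes U: "open U" and p: "p \<in> U" and V: "smooth_vf A U V" "\<And>q. q \<in> U \<Longrightarrow> V q \<in> vertical A B f q"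
  shows "S X V p = - df p (DM p (X p) V)"
proof -
  have "D p (X p) (\<lambda>q. df q (V q)) = D p (X p) (\<lambda>q. 0)"
    by (rule D_cong[OF U smooth_section_differential[OF U V(1)] _ p]) (use V(2) in \<open>auto simp: vertical_def\<close>)
  then show ?thesis by (simp add: second_fundamental_form_def D_zero)
qed

lemma dil_diff: "diff_at A dil q"
  by (rule csmooth_diff_at[OF A open_UNIV dil]) simp

end

text \<open>A point \<open>p\<close> with a frame as in \<open>adapted_frame_exists\<close>. The
  numbers \<open>n\<close>, \<open>r\<close> and \<open>k\<close> are the dimensions of the source,
  of the target and of the fibre through \<open>p\<close>.\<close>

locale adapted_frame = conformal_setting A B f D gN DN g DM dil
  for A :: "('a::{t2_space,second_countable_topology}, 'e::euclidean_space) chart set"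
    and B :: "('b::{t2_space,second_countable_topology}, 'k::euclidean_space) chart set"
    and f :: "'a \<Rightarrow> 'b" and D :: "'a \<Rightarrow> 'e \<Rightarrow> ('a \<Rightarrow> 'k) \<Rightarrow> 'k"
    and gN :: "'b \<Rightarrow> 'k \<Rightarrow> 'k \<Rightarrow> real" and DN :: "'b \<Rightarrow> 'k \<Rightarrow> ('b \<Rightarrow> 'k) \<Rightarrow> 'k"
    and g :: "'a \<Rightarrow> 'e \<Rightarrow> 'e \<Rightarrow> real"
    and DM :: "'a \<Rightarrow> 'e \<Rightarrow> ('a \<Rightarrow> 'e) \<Rightarrow> 'e" and dil :: "'a \<Rightarrow> real" +
  fixes p :: 'a and U :: "'a set" and F :: "nat \<Rightarrow> 'a \<Rightarrow> 'e" and n r k :: nat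
  assumes U: "open U" "p \<in> U" and F: "i < n \<Longrightarrow> smooth_vf A U (F i)"
    and orth: "q \<in> U \<Longrightarrow> G.orthonormal q n (\<lambda>i. F i q)"
    and hor: "q \<in> U \<Longrightarrow> i < r \<Longrightarrow> F i q \<in> horizontal A B g f q"
    and ver: "q \<in> U \<Longrightarrow> r \<le> i \<Longrightarrow> i < n \<Longrightarrow> F i q \<in> vertical A B f q"
    and n_eq: "n = DIM('e)" and r_eq: "r = DIM('k)" and k_eq: "k = dim (vertical A B f p)"
    and dims: "n = r + k"
begin

lemma r_le_n: "i < r \<Longrightarrow> i < n"
  using dims by simp

lemma frame_inner: "q \<in> U \<Longrightarrow> i < n \<Longrightarrow> j < n \<Longrightarrow> g q (F i q) (F j q) = (if i = j then 1 else 0)"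
  using orth unfolding G.orthonormal_def by blast

lemma frame_span: "q \<in> U \<Longrightarrow> v \<in> span ((\<lambda>i. F i q) ` {..<n})"
  using G.orthonormal_span_UNIV[OF orth] n_eq by simp

lemma frame_expansion: "q \<in> U \<Longrightarrow> v = (\<Sum>i<n. g q v (F i q) *\<^sub>R F i q)"
  by (rule G.orthonormal_expansion[OF orth frame_span])

lemma horizontal_expansion:
  assumes "v \<in> horizontal A B g f p"
  shows "v = (\<Sum>i<r. g p v (F i p) *\<^sub>R F i p)"
proof -
  have "v = (\<Sum>i<n. g p v (F i p) *\<^sub>R F i p)" by (rule frame_expansion[OF U(2)])
  also have "\<dots> = (\<Sum>i<r. g p v (F i p) *\<^sub>R F i p)"
    by (rule sum.mono_neutral_right) (use assms ver[OF U(2)] dims in \<open>auto simp: horizontal_def\<close>)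
  finally show ?thesis .
qed

lemma vertical_expansion:
  assumes q: "q \<in> U" and v: "v \<in> vertical A B f q"
  shows "v = (\<Sum>i\<in>{r..<n}. g q v (F i q) *\<^sub>R F i q)"
proof -
  have 0: "g q v (F i q) = 0" if "i < r" for i
    using hor[OF q that] v G.sym[of q v] by (auto simp: horizontal_def)
  have "v = (\<Sum>i<n. g q v (F i q) *\<^sub>R F i q)" by (rule frame_expansion[OF q])
  also have "\<dots> = (\<Sum>i\<in>{r..<n}. g q v (F i q) *\<^sub>R F i q)"
    by (rule sum.mono_neutral_right) (use 0 in auto)
  finally show ?thesis .
qed

text \<open>Expand \<open>Y\<close> in the frame with smooth coefficients. The terms in which a
  coefficient is differentiated are the same in both parts of \<open>S\<close>, namely its
  derivative times \<open>df (F b)\<close>, and cancel. In \<open>X\<close> both connections are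
  linear at the point \<open>p\<close>.\<close>

lemma second_fundamental_form_tensor:
  assumes U': "open U'" "p \<in> U'" and Y: "smooth_vf A U' Y"
  shows "S X Y p = (\<Sum>a<n. \<Sum>b<n. (g p (X p) (F a p) * g p (Y p) (F b p)) *\<^sub>R S (F a) (F b) p)"
proof -
  let ?W = "U \<inter> U'"
  have W: "open ?W" "p \<in> ?W" using U U' by auto
  have FW: "smooth_vf A ?W (F i)" if "i < n" for i
    by (rule I.smooth_section_subset[OF F[OF that]]) auto
  have YW: "smooth_vf A ?W Y" by (rule I.smooth_section_subset[OF Y]) auto
  define y where "y b q = g q (Y q) (F b q)" for b q
  have y: "csmooth A ?W (y b)" if "b < n" for b
    unfolding y_def[abs_def] by (rule csmooth_inner_fields[OF A g W(1) YW FW[OF that]])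
  have Yexp: "Y q = (\<Sum>b<n. y b q *\<^sub>R F b q)" if "q \<in> ?W" for q
    unfolding y_def by (rule frame_expansion) (use that in auto)
  define T where "T v Z = D p v (\<lambda>q. df q (Z q)) - df p (DM p v Z)" for v Z
  have ST: "S X Z p = T (X p) Z" for X Z by (simp add: T_def second_fundamental_form_def)
  have TY: "T v Y = (\<Sum>b<n. y b p *\<^sub>R T v (F b))" for v
  proof -
    have "D p v (\<lambda>q. df q (Y q)) = D p v (\<lambda>q. \<Sum>b<n. y b q *\<^sub>R df q (F b q))"
      by (rule D_cong[OF W(1) smooth_section_differential[OF W(1) YW] _ W(2)])
        (subst Yexp, assumption, simp add: df_linear)
    also have "\<dots> = (\<Sum>b<n. deriv_at A (y b) p v *\<^sub>R df p (F b p) + y b p *\<^sub>R D p v (\<lambda>q. df q (F b q)))"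
      by (rule D_sum[OF W]) (auto intro: y smooth_section_differential[OF W(1) FW])
    finally have 1: "D p v (\<lambda>q. df q (Y q)) = \<dots>" .
    have "DM p v Y = DM p v (\<lambda>q. \<Sum>b<n. y b q *\<^sub>R F b q)"
      by (rule M.D_cong[OF W(1) YW Yexp W(2)])
    also have "\<dots> = (\<Sum>b<n. deriv_at A (y b) p v *\<^sub>R F b p + y b p *\<^sub>R DM p v (F b))"
      by (rule M.D_sum[OF W]) (auto intro: y FW)
    finally have 2: "DM p v Y = \<dots>" .
    show ?thesis
      unfolding T_def 1 2
      by (simp add: df_linear sum.distrib scaleR_diff_right sum_subtractf)
  qed
  have Tlin: "linear (\<lambda>v. T v (F b))" if b: "b < n" for b
    unfolding T_def
    by (intro linear_compose_sub D_linear[OF W(1) smooth_section_differential[OF W(1) FW[OF b]] W(2)]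
        linear_compose[OF M.D_linear[OF W(1) FW[OF b] W(2)] linear_differential, unfolded o_def])
  have TF: "T v (F b) = (\<Sum>a<n. g p v (F a p) *\<^sub>R T (F a p) (F b))" if b: "b < n" for v b
  proof -
    have "T v (F b) = T (\<Sum>a<n. g p v (F a p) *\<^sub>R F a p) (F b)"
      by (rule arg_cong[where f = "\<lambda>v. T v (F b)", OF frame_expansion[OF U(2)]])
    then show ?thesis by (simp add: linear_sum[OF Tlin[OF b]] linear_cmul[OF Tlin[OF b]])
  qed
  have "S X Y p = (\<Sum>b<n. y b p *\<^sub>R (\<Sum>a<n. g p (X p) (F a p) *\<^sub>R T (F a p) (F b)))"
    unfolding ST TY by (intro sum.cong refl arg_cong[where f = "scaleR _"] TF) simp
  also have "\<dots> = (\<Sum>a<n. \<Sum>b<n. (g p (X p) (F a p) * g p (Y p) (F b p)) *\<^sub>R T (F a p) (F b))"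
    by (simp add: scaleR_sum_right y_def mult.commute) (rule sum.swap)
  finally show ?thesis by (simp add: ST)
qed

text \<open>By tensoriality a trace of \<open>S\<close> depends only on the sums over
  \<open>i\<close> of products of coefficients of \<open>E i p\<close>. The hypothesis
  \<open>parseval\<close> holds when the \<open>E i p\<close> form an orthonormal basis of the span
  of the \<open>F a p\<close> with \<open>a \<in> J\<close>; the cases of interest are the whole
  tangent space and the vertical space.\<close>

lemma trace_on_frame:
  assumes U': "open U'" "p \<in> U'" and E: "\<And>i. i < l \<Longrightarrow> smooth_vf A U' (E i)" and J: "J \<subseteq> {..<n}"
    and parseval: "\<And>a b. a < n \<Longrightarrow> b < n \<Longrightarrow>
      (\<Sum>i<l. g p (E i p) (F a p) * g p (E i p) (F b p)) = (if a = b \<and> a \<in> J then 1 else 0)"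
  shows "(\<Sum>i<l. S (E i) (E i) p) = (\<Sum>a\<in>J. S (F a) (F a) p)"
proof -
  have "(\<Sum>i<l. S (E i) (E i) p) =
      (\<Sum>i<l. \<Sum>a<n. \<Sum>b<n. (g p (E i p) (F a p) * g p (E i p) (F b p)) *\<^sub>R S (F a) (F b) p)"
    by (intro sum.cong refl second_fundamental_form_tensor[OF U' E]) simp
  also have "\<dots> = (\<Sum>a<n. \<Sum>i<l. \<Sum>b<n. (g p (E i p) (F a p) * g p (E i p) (F b p)) *\<^sub>R S (F a) (F b) p)"
    by (rule sum.swap)
  also have "\<dots> = (\<Sum>a<n. \<Sum>b<n. (\<Sum>i<l. g p (E i p) (F a p) * g p (E i p) (F b p)) *\<^sub>R S (F a) (F b) p)"
    unfolding scaleR_sum_left by (intro sum.cong refl sum.swap)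
  also have "\<dots> = (\<Sum>a<n. \<Sum>b<n. if b = a then (if a \<in> J then S (F a) (F a) p else 0) else 0)"
    by (intro sum.cong refl) (auto simp: parseval)
  also have "\<dots> = (\<Sum>a<n. if a \<in> J then S (F a) (F a) p else 0)"
    by (intro sum.cong refl) simp
  also have "\<dots> = (\<Sum>a\<in>J. S (F a) (F a) p)"
    using J by (simp add: sum.If_cases Int_absorb1)
  finally show ?thesis .
qed

text \<open>The tension field is defined by an arbitrarily chosen orthonormal frame. Frames exist,
  so the chosen one has the required properties, and it can be replaced by the adapted
  frame.\<close>

lemma tension_field_frame: "tension_field A B g DM D f p = (\<Sum>a<n. S (F a) (F a) p)"
proof -
  have sp: "span ((\<lambda>i. F i q) ` {..<n}) = UNIV" if "q \<in> U" for q
    using G.orthonormal_span_UNIV[OF orth[OF that]] n_eq by simp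
  have "\<exists>E. local_orthonormal_frame A g (\<lambda>q. UNIV) p n E"
    unfolding local_orthonormal_frame_def
    by (intro exI[of _ F] exI[of _ U]) (use U F sp frame_inner in auto)
  then have "local_orthonormal_frame A g (\<lambda>q. UNIV) p n (SOME E. local_orthonormal_frame A g (\<lambda>q. UNIV) p n E)"
    by (rule someI_ex)
  moreover define E where "E = (SOME E. local_orthonormal_frame A g (\<lambda>q. UNIV) p n E)"
  ultimately have E: "local_orthonormal_frame A g (\<lambda>q. UNIV) p n E" by simp
  have tau: "tension_field A B g DM D f p = (\<Sum>i<n. S (E i) (E i) p)"
    unfolding tension_field_def Let_def n_eq[symmetric] E_def ..
  from E obtain U' where U': "open U'" "p \<in> U'" and vE: "\<And>i. i < n \<Longrightarrow> smooth_vf A U' (E i)"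
    and spE: "span ((\<lambda>i. E i p) ` {..<n}) = UNIV" and oE: "G.orthonormal p n (\<lambda>i. E i p)"
    unfolding local_orthonormal_frame_def G.orthonormal_def by blast
  have "(\<Sum>i<n. g p (E i p) (F a p) * g p (E i p) (F b p)) = (if a = b \<and> a \<in> {..<n} then 1 else 0)"
    if "a < n" "b < n" for a b
    using G.orthonormal_parseval[OF oE, of "F a p" "F b p"] spE frame_inner[OF U(2) that] that
    by (simp add: G.sym[of p "E _ p"])
  then show ?thesis
    unfolding tau by (intro trace_on_frame[OF U' vE]) auto
qed

lemma horizontal_projection:
  "horizontal_proj A B g f p u \<in> horizontal A B g f p"
  "u - horizontal_proj A B g f p u \<in> vertical A B f p"
proof -
  define w where "w = (\<Sum>i<r. g p u (F i p) *\<^sub>R F i p)"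
  have wh: "w \<in> horizontal A B g f p"
    unfolding w_def
    by (intro subspace_sum subspace_scale subspace_horizontal hor[OF U(2)]) auto
  have "u = (\<Sum>i<n. g p u (F i p) *\<^sub>R F i p)" by (rule frame_expansion[OF U(2)])
  also have "\<dots> = w + (\<Sum>i\<in>{r..<n}. g p u (F i p) *\<^sub>R F i p)"
    unfolding w_def using dims sum.atLeastLessThan_concat[of 0 r n "\<lambda>i. g p u (F i p) *\<^sub>R F i p"]
    by (simp add: lessThan_atLeast0)
  finally have uw: "u = w + (\<Sum>i\<in>{r..<n}. g p u (F i p) *\<^sub>R F i p)" .
  have "u - w = (\<Sum>i\<in>{r..<n}. g p u (F i p) *\<^sub>R F i p)" by (rule diff_eq_eq[THEN iffD2]) (rule uw[unfolded add.commute[of w]])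
  also have "\<dots> \<in> vertical A B f p"
    by (intro subspace_sum subspace_scale subspace_vertical ver[OF U(2)]) auto
  finally have wv: "u - w \<in> vertical A B f p" .
  have uniq: "w' = w" if "w' \<in> horizontal A B g f p \<and> u - w' \<in> vertical A B f p" for w'
  proof -
    have "w' - w \<in> horizontal A B g f p" using that wh subspace_diff[OF subspace_horizontal] by blast
    moreover have "(u - w) - (u - w') \<in> vertical A B f p"
      using that wv subspace_diff[OF subspace_vertical] by blast
    ultimately show ?thesis using vertical_horizontal_zero[of "w' - w" p] by simp
  qed
  have "horizontal_proj A B g f p u = w"
    unfolding horizontal_proj_def by (rule the_equality, rule conjI[OF wh wv], rule uniq)
  then show "horizontal_proj A B g f p u \<in> horizontal A B g f p"
    "u - horizontal_proj A B g f p u \<in> vertical A B f p" using wh wv by auto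
qed

lemma inner_horizontal_proj:
  assumes "w \<in> horizontal A B g f p"
  shows "g p (horizontal_proj A B g f p u) w = g p u w"
proof -
  have "g p w (u - horizontal_proj A B g f p u) = 0"
    using assms horizontal_projection(2)[of u] by (auto simp: horizontal_def)
  then show ?thesis by (simp add: G.diff G.sym[of p w])
qed

lemma horizontal_eq_zero_iff:
  assumes "w \<in> horizontal A B g f p"
  shows "w = 0 \<longleftrightarrow> (\<forall>l<r. g p w (F l p) = 0)"
  using horizontal_expansion[OF assms] by (auto intro: sum.neutral)

lemma gradient_inner: "g p (gradient A g dil p) w = deriv_at A dil p w"
proof -
  have lin: "linear (deriv_at A dil p)" by (rule linear_deriv_at[OF dil_diff])
  define v where "v = (\<Sum>i<n. deriv_at A dil p (F i p) *\<^sub>R F i p)"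
  have v: "g p v w = deriv_at A dil p w" for w
  proof -
    have "deriv_at A dil p w = deriv_at A dil p (\<Sum>i<n. g p w (F i p) *\<^sub>R F i p)"
      by (rule arg_cong[OF frame_expansion[OF U(2)]])
    then show ?thesis
      by (simp add: v_def linear_sum[OF lin] linear_cmul[OF lin] G.sums G.sym[of p w] mult.commute)
  qed
  have "gradient A g dil p = v"
    unfolding gradient_def
  proof (rule the_equality)
    fix v' assume v': "\<forall>w. g p v' w = deriv_at A dil p w"
    then have "g p (v' - v) (v' - v) = 0" by (simp add: G.diff(1) v)
    then show "v' = v" using G.eq_zero[of p "v' - v"] by simp
  qed (simp add: v)
  then show ?thesis using v by simp
qed

lemma homothetic_at_iff:
  "horizontal_proj A B g f p (gradient A g dil p) = 0 \<longleftrightarrow> (\<forall>l<r. deriv_at A dil p (F l p) = 0)"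
  unfolding horizontal_eq_zero_iff[OF horizontal_projection(1)]
  using inner_horizontal_proj[OF hor[OF U(2)]] by (simp add: gradient_inner)

lemma conformal_any:
  assumes "w \<in> horizontal A B g f p"
  shows "gN (f p) (df p u) (df p w) = (dil p)\<^sup>2 * g p u w"
proof -
  have "df p u = df p (horizontal_proj A B g f p u)"
    using horizontal_projection(2)[of u] by (simp add: vertical_def df_linear)
  then show ?thesis
    using conformal[OF horizontal_projection(1) assms, of u] inner_horizontal_proj[OF assms, of u] by simp
qed

text \<open>On the frame, the horizontally conformal condition reads \<open>gN (df (F j)) (df (F
  l)) = dil\<^sup>2 \<delta>\<^sub>j\<^sub>l\<close>. Differentiate it along \<open>X\<close>. The
  parts \<open>df (DM X (F j))\<close> that distinguish \<open>D X (df (F j))\<close> from \<open>S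
  X (F j)\<close> cancel, since \<open>DM\<close> is metric and the inner products of the frame are
  constant.\<close>

lemma polarised_conformality:
  assumes j: "j < r" and l: "l < r" and X: "smooth_vf A U X"
  shows "gN (f p) (S X (F j) p) (df p (F l p)) + gN (f p) (df p (F j p)) (S X (F l) p) =
    (if j = l then 2 * dil p * deriv_at A dil p (X p) else 0)"
proof -
  note jn = r_le_n[OF j] and ln = r_le_n[OF l]
  let ?v = "X p" and ?W = "\<lambda>i q. df q (F i q)"
  have conf: "gN (f q) (?W j q) (?W l q) = (dil q * dil q) * (if j = l then 1 else 0)" if "q \<in> U" for q
    using conformal[OF hor[OF that j] hor[OF that l]] frame_inner[OF that jn ln]
    by (simp add: power2_eq_square)
  have "deriv_at A (\<lambda>q. gN (f q) (?W j q) (?W l q)) p ?v = deriv_at A (\<lambda>q. (dil q * dil q) * (if j = l then 1 else 0)) p ?v"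
    by (rule diff_at_cong(2)[OF A U conf[symmetric]])
      (auto intro!: deriv_at_mult(1) dil_diff A deriv_at_const)
  also have "\<dots> = (if j = l then 2 * dil p * deriv_at A dil p ?v else 0)"
    by (simp add: deriv_at_mult[OF _ _ A] dil_diff deriv_at_const)
  finally have 1: "gN (f p) (D p ?v (?W j)) (?W l p) + gN (f p) (?W j p) (D p ?v (?W l)) =
      (if j = l then 2 * dil p * deriv_at A dil p ?v else 0)"
    using D_metric[OF U smooth_section_differential[OF U(1) F[OF jn]] smooth_section_differential[OF U(1) F[OF ln]], of ?v]
    by simp
  have "deriv_at A (\<lambda>q. g q (F j q) (F l q)) p ?v = deriv_at A (\<lambda>q. if j = l then 1 else 0 :: real) p ?v"
    by (rule diff_at_cong(2)[OF A U _ deriv_at_const(1)]) (simp add: frame_inner jn ln)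
  then have 2: "g p (DM p ?v (F j)) (F l p) + g p (DM p ?v (F l)) (F j p) = 0"
    using levi_civita_metric[OF DM U(1) F[OF jn] F[OF ln] U(2), of ?v]
    by (simp add: deriv_at_const G.sym[of p "F j p"])
  have 3: "gN (f p) (df p (DM p ?v (F j))) (df p (F l p)) + gN (f p) (df p (F j p)) (df p (DM p ?v (F l))) = 0"
    using 2 conformal_any[OF hor[OF U(2) l], of "DM p ?v (F j)"] conformal_any[OF hor[OF U(2) j], of "DM p ?v (F l)"]
    by (simp add: GN.sym[of "f p" "df p (F j p)"] distrib_left[symmetric])
  show ?thesis
    using 1 3 by (simp add: second_fundamental_form_def GN.diff)
qed

text \<open>Put \<open>T(X, j, l) = gN (S X (F j)) (df (F l))\<close>. Polarised conformality
  gives \<open>T(F j, j, l) = 2 dil (F j)(dil) \<delta>\<^sub>j\<^sub>l - T(F j, l, j)\<close>, and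
  by symmetry of \<open>S\<close> the last term is \<open>T(F l, j, j) = dil (F l)(dil)\<close>. Sum
  over \<open>j\<close>.\<close>

lemma horizontal_trace:
  assumes l: "l < r"
  shows "gN (f p) (\<Sum>j<r. S (F j) (F j) p) (df p (F l p)) = - (real r - 2) * dil p * deriv_at A dil p (F l p)"
proof -
  have "gN (f p) (S (F j) (F j) p) (df p (F l p)) =
      (if j = l then 2 * dil p * deriv_at A dil p (F l p) else 0) - dil p * deriv_at A dil p (F l p)"
    if j: "j < r" for j
  proof -
    have "S (F j) (F l) p = S (F l) (F j) p"
      by (rule second_fundamental_form_sym[OF U F F]) (use r_le_n j l in auto)
    moreover have "2 * gN (f p) (S (F l) (F j) p) (df p (F j p)) = 2 * dil p * deriv_at A dil p (F l p)"
      using polarised_conformality[OF j j F[OF r_le_n[OF l]]] by (simp add: GN.sym[of "f p" "df p (F j p)"])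
    ultimately show ?thesis
      using polarised_conformality[OF j l F[OF r_le_n[OF j]]]
      by (auto simp: GN.sym[of "f p" "df p (F j p)"])
  qed
  then have "gN (f p) (\<Sum>j<r. S (F j) (F j) p) (df p (F l p)) =
      (\<Sum>j<r. (if j = l then 2 * dil p * deriv_at A dil p (F l p) else 0) - dil p * deriv_at A dil p (F l p))"
    unfolding GN.sums(1) by (intro sum.cong refl) simp
  also have "\<dots> = - (real r - 2) * dil p * deriv_at A dil p (F l p)"
    using l by (simp add: sum_subtractf algebra_simps)
  finally show ?thesis .
qed

text \<open>The mean curvature is defined by an arbitrarily chosen vertical frame
  \<open>V\<close>. The vertical part of the trace of \<open>S\<close> can be computed in
  \<open>V\<close> as well, where it is \<open>- df\<close> of the sum of the \<open>DM (V i) (V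
  i)\<close>. The horizontal part of this sum is \<open>k\<close> times the mean curvature, and
  \<open>df\<close> kills the vertical part.\<close>

lemma fibre_mean_curvature_frame:
  "fibre_mean_curvature A B g DM f p \<in> horizontal A B g f p"
  "l < r \<Longrightarrow> gN (f p) (\<Sum>a\<in>{r..<n}. S (F a) (F a) p) (df p (F l p)) =
    - (dil p)\<^sup>2 * (real k * g p (fibre_mean_curvature A B g DM f p) (F l p))"
proof -
  have spF: "span ((\<lambda>i. F (r + i) q) ` {..<k}) = vertical A B f q" if q: "q \<in> U" for q
  proof (rule antisym)
    show "span ((\<lambda>i. F (r + i) q) ` {..<k}) \<subseteq> vertical A B f q"
      by (rule span_minimal[OF _ subspace_vertical]) (use ver[OF q] dims in auto)
    show "vertical A B f q \<subseteq> span ((\<lambda>i. F (r + i) q) ` {..<k})"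
    proof
      fix v assume "v \<in> vertical A B f q"
      then have "v = (\<Sum>i\<in>{r..<n}. g q v (F i q) *\<^sub>R F i q)" by (rule vertical_expansion[OF q])
      also have "\<dots> \<in> span ((\<lambda>i. F (r + i) q) ` {..<k})"
      proof (intro span_sum span_scale span_base)
        fix i assume "i \<in> {r..<n}"
        then show "F i q \<in> (\<lambda>i. F (r + i) q) ` {..<k}" using dims by (intro image_eqI[of _ _ "i - r"]) auto
      qed
      finally show "v \<in> span ((\<lambda>i. F (r + i) q) ` {..<k})" .
    qed
  qed
  have "\<exists>V. local_orthonormal_frame A g (vertical A B f) p k V"
    unfolding local_orthonormal_frame_def
    by (intro exI[of _ "\<lambda>i. F (r + i)"] exI[of _ U]) (use U F spF frame_inner dims in auto)
  then have "local_orthonormal_frame A g (vertical A B f) p k (SOME V. local_orthonormal_frame A g (vertical A B f) p k V)"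
    by (rule someI_ex)
  moreover define V where "V = (SOME V. local_orthonormal_frame A g (vertical A B f) p k V)"
  ultimately have V: "local_orthonormal_frame A g (vertical A B f) p k V" by simp
  have mu: "fibre_mean_curvature A B g DM f p =
      (1 / real k) *\<^sub>R (\<Sum>i<k. horizontal_proj A B g f p (DM p (V i p) (V i)))"
    unfolding fibre_mean_curvature_def Let_def k_eq[symmetric] V_def ..
  from V obtain U' where U': "open U'" "p \<in> U'" and V': "\<forall>i<k. smooth_vf A U' (V i)"
    "\<forall>q\<in>U'. span ((\<lambda>i. V i q) ` {..<k}) = vertical A B f q \<and>
      (\<forall>i<k. \<forall>j<k. g q (V i q) (V j q) = (if i = j then 1 else 0))"
    unfolding local_orthonormal_frame_def by blast
  have vV: "\<And>i. i < k \<Longrightarrow> smooth_vf A U' (V i)" using V'(1) by blast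
  have spV: "\<And>q. q \<in> U' \<Longrightarrow> span ((\<lambda>i. V i q) ` {..<k}) = vertical A B f q" using V'(2) by blast
  have oV: "G.orthonormal p k (\<lambda>i. V i p)" unfolding G.orthonormal_def using V'(2) U'(2) by blast
  have verV: "V i q \<in> vertical A B f q" if "q \<in> U'" "i < k" for i q
    using spV[OF that(1)] span_base[of "V i q" "(\<lambda>i. V i q) ` {..<k}"] that by auto
  have "(\<Sum>i<k. g p (V i p) (F a p) * g p (V i p) (F b p)) = (if a = b \<and> a \<in> {r..<n} then 1 else 0)"
    if ab: "a < n" "b < n" for a b
  proof (cases "a < r")
    case True
    have "g p (V i p) (F a p) = 0" if "i < k" for i
      using hor[OF U(2) True] verV[OF U'(2) that] by (auto simp: horizontal_def G.sym[of p "V i p"])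
    then show ?thesis using True by simp
  next
    case False
    then have "F a p \<in> span ((\<lambda>i. V i p) ` {..<k})" using spV[OF U'(2)] ver[OF U(2)] ab by simp
    from G.orthonormal_parseval[OF oV this, of "F b p"] show ?thesis
      using frame_inner[OF U(2) ab] ab False by (simp add: G.sym[of p "V _ p"])
  qed
  then have "(\<Sum>a\<in>{r..<n}. S (F a) (F a) p) = (\<Sum>i<k. S (V i) (V i) p)"
    by (intro trace_on_frame[OF U' vV, symmetric]) auto
  also have "\<dots> = (\<Sum>i<k. - df p (DM p (V i p) (V i)))"
    by (intro sum.cong refl second_fundamental_form_vertical[OF U' vV verV]) auto
  finally have tr: "(\<Sum>a\<in>{r..<n}. S (F a) (F a) p) = - df p (\<Sum>i<k. DM p (V i p) (V i))"
    by (simp add: df_linear sum_negf)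
  show "fibre_mean_curvature A B g DM f p \<in> horizontal A B g f p"
    unfolding mu by (intro subspace_scale subspace_sum subspace_horizontal horizontal_projection(1))
  assume l: "l < r"
  have "real k * g p (fibre_mean_curvature A B g DM f p) (F l p) = (\<Sum>i<k. g p (DM p (V i p) (V i)) (F l p))"
    unfolding mu by (cases "k = 0") (simp_all add: G.sums inner_horizontal_proj[OF hor[OF U(2) l]])
  also have "\<dots> = g p (\<Sum>i<k. DM p (V i p) (V i)) (F l p)" by (simp add: G.sums)
  finally show "gN (f p) (\<Sum>a\<in>{r..<n}. S (F a) (F a) p) (df p (F l p)) =
    - (dil p)\<^sup>2 * (real k * g p (fibre_mean_curvature A B g DM f p) (F l p))"
    unfolding tr using conformal_any[OF hor[OF U(2) l]] GN.diff(1)[of "f p" 0] by simp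
qed

text \<open>The fundamental equation, tested on the horizontal members of the frame.\<close>

lemma tension_field_formula:
  assumes l: "l < r"
  shows "gN (f p) (tension_field A B g DM D f p) (df p (F l p)) =
    - (real r - 2) * dil p * deriv_at A dil p (F l p)
    - (dil p)\<^sup>2 * (real k * g p (fibre_mean_curvature A B g DM f p) (F l p))"
proof -
  have "(\<Sum>a<n. S (F a) (F a) p) = (\<Sum>a<r. S (F a) (F a) p) + (\<Sum>a\<in>{r..<n}. S (F a) (F a) p)"
    using sum.atLeastLessThan_concat[of 0 r n "\<lambda>a. S (F a) (F a) p"] dims by (simp add: lessThan_atLeast0)
  then show ?thesis
    unfolding tension_field_frame
    using horizontal_trace[OF l] fibre_mean_curvature_frame(2)[OF l] by (simp add: GN.sums(5))
qed

text \<open>The vectors \<open>df (F l)\<close> span the tangent space of the target, because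
  \<open>df\<close> is onto and kills the vertical part.\<close>

lemma tension_field_eq_zero_iff:
  "tension_field A B g DM D f p = 0 \<longleftrightarrow> (\<forall>l<r. gN (f p) (tension_field A B g DM D f p) (df p (F l p)) = 0)"
proof
  let ?\<tau> = "tension_field A B g DM D f p"
  assume 0: "\<forall>l<r. gN (f p) ?\<tau> (df p (F l p)) = 0"
  obtain u where u: "?\<tau> = df p u" using surj_differential[of p] by (metis surjD)
  let ?h = "horizontal_proj A B g f p u"
  have "?\<tau> = df p ?h"
    using horizontal_projection(2)[of u] by (simp add: u vertical_def df_linear)
  also have "\<dots> = df p (\<Sum>i<r. g p ?h (F i p) *\<^sub>R F i p)"
    by (rule arg_cong[OF horizontal_expansion[OF horizontal_projection(1)]])
  also have "\<dots> = (\<Sum>i<r. g p ?h (F i p) *\<^sub>R df p (F i p))"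
    by (simp add: df_linear)
  finally have \<tau>: "?\<tau> = (\<Sum>i<r. g p ?h (F i p) *\<^sub>R df p (F i p))" .
  have "gN (f p) ?\<tau> ?\<tau> = (\<Sum>i<r. g p ?h (F i p) * gN (f p) ?\<tau> (df p (F i p)))"
    by (subst (2) \<tau>) (simp add: GN.sums)
  then show "?\<tau> = 0" using 0 by (intro GN.eq_zero[of "f p"]) simp
qed simp

text \<open>For \<open>k = 0\<close> both sides hold, since then the mean curvature is an empty
  sum.\<close>

lemma fibre_mean_curvature_eq_zero_iff:
  "fibre_mean_curvature A B g DM f p = 0 \<longleftrightarrow> (\<forall>l<r. real k * g p (fibre_mean_curvature A B g DM f p) (F l p) = 0)"
proof (cases "k = 0")
  case True
  then show ?thesis by (simp add: fibre_mean_curvature_def k_eq[symmetric])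
next
  case False
  then show ?thesis using horizontal_eq_zero_iff[OF fibre_mean_curvature_frame(1)] by simp
qed

lemma pointwise_equivalence:
  assumes "r \<noteq> 2"
  shows "tension_field A B g DM D f p = 0 \<Longrightarrow> fibre_mean_curvature A B g DM f p = 0 \<Longrightarrow>
      horizontal_proj A B g f p (gradient A g dil p) = 0"
    and "tension_field A B g DM D f p = 0 \<Longrightarrow> horizontal_proj A B g f p (gradient A g dil p) = 0 \<Longrightarrow>
      fibre_mean_curvature A B g DM f p = 0"
    and "fibre_mean_curvature A B g DM f p = 0 \<Longrightarrow> horizontal_proj A B g f p (gradient A g dil p) = 0 \<Longrightarrow>
      tension_field A B g DM D f p = 0"
proof -
  have r: "real r - 2 \<noteq> 0" using assms by simp
  note pos = dil_pos[of p]
  show "horizontal_proj A B g f p (gradient A g dil p) = 0"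
    if "tension_field A B g DM D f p = 0" "fibre_mean_curvature A B g DM f p = 0"
    unfolding homothetic_at_iff using tension_field_formula pos r that by simp
  show "fibre_mean_curvature A B g DM f p = 0"
    if "tension_field A B g DM D f p = 0" "horizontal_proj A B g f p (gradient A g dil p) = 0"
  proof -
    have "\<forall>l<r. deriv_at A dil p (F l p) = 0" using that(2) unfolding homothetic_at_iff .
    then show ?thesis
      using tension_field_formula pos that(1) by (subst fibre_mean_curvature_eq_zero_iff) simp
  qed
  show "tension_field A B g DM D f p = 0"
    if "fibre_mean_curvature A B g DM f p = 0" "horizontal_proj A B g f p (gradient A g dil p) = 0"
  proof -
    have "\<forall>l<r. deriv_at A dil p (F l p) = 0" using that(2) unfolding homothetic_at_iff .
    then show ?thesis
      using tension_field_formula that(1) by (subst tension_field_eq_zero_iff) simp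
  qed
qed

end

lemma (in conformal_setting) adapted_frame_at:
  "\<exists>U F. adapted_frame A B f D gN DN g DM dil q U F (DIM('e)) (DIM('k)) (dim (vertical A B f q))"
proof (rule adapted_frame_exists[of q])
  fix U F
  assume *: "open U" "q \<in> U" "\<And>i. i < DIM('e) \<Longrightarrow> smooth_vf A U (F i)"
    "\<And>q. q \<in> U \<Longrightarrow> G.orthonormal q (DIM('e)) (\<lambda>i. F i q)"
    "\<And>q i. q \<in> U \<Longrightarrow> i < DIM('k) \<Longrightarrow> F i q \<in> horizontal A B g f q"
    "\<And>q i. q \<in> U \<Longrightarrow> DIM('k) \<le> i \<Longrightarrow> i < DIM('e) \<Longrightarrow> F i q \<in> vertical A B f q"
    "DIM('e) = DIM('k) + dim (vertical A B f q)"
  have "adapted_frame A B f D gN DN g DM dil q U F (DIM('e)) (DIM('k)) (dim (vertical A B f q))"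
    by unfold_locales (use * in auto)
  then show ?thesis by blast
qed

theorem theorem3p11:
  fixes A :: "('a::{t2_space,second_countable_topology}, 'e::euclidean_space) chart set"
    and B :: "('b::{t2_space,second_countable_topology}, 'k::euclidean_space) chart set"
    and \<phi> :: "'a \<Rightarrow> 'e \<Rightarrow> 'e" and \<xi> :: "'a \<Rightarrow> 'e" and \<eta> :: "'a \<Rightarrow> 'e \<Rightarrow> real"
    and gM :: "'a \<Rightarrow> 'e \<Rightarrow> 'e \<Rightarrow> real" and gN :: "'b \<Rightarrow> 'k \<Rightarrow> 'k \<Rightarrow> real"
    and DM :: "'a \<Rightarrow> 'e \<Rightarrow> ('a \<Rightarrow> 'e) \<Rightarrow> 'e" and DN :: "'b \<Rightarrow> 'k \<Rightarrow> ('b \<Rightarrow> 'k) \<Rightarrow> 'k"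
    and DP :: "'a \<Rightarrow> 'e \<Rightarrow> ('a \<Rightarrow> 'k) \<Rightarrow> 'k"
    and dil :: "'a \<Rightarrow> real" and \<pi> :: "'a \<Rightarrow> 'b" and m n :: nat
  assumes M: "smooth_atlas A" "DIM('e) = 2 * (m + n) + 1"
    and N: "smooth_atlas B" "DIM('k) = m + 2 * n + 1"
    and sasakian: "sasakian A \<phi> \<xi> \<eta> gM DM"
    and riemannian: "riemannian_metric B gN"
    and nabla_N: "levi_civita B gN DN"
    and nabla_pi: "pullback_connection A B \<pi> DN DP"
    and submersion: "conformal_anti_invariant_xi_perp_submersion A B \<phi> \<xi> \<eta> gM gN dil \<pi>"
    and nondegenerate: "\<not> (m = 1 \<and> n = 0)"
  shows "(harmonic A B gM DM DP \<pi> \<and> minimal_fibres A B gM DM \<pi>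
            \<longrightarrow> horizontally_homothetic A B gM dil \<pi>) \<and>
         (harmonic A B gM DM DP \<pi> \<and> horizontally_homothetic A B gM dil \<pi>
            \<longrightarrow> minimal_fibres A B gM DM \<pi>) \<and>
         (minimal_fibres A B gM DM \<pi> \<and> horizontally_homothetic A B gM dil \<pi>
            \<longrightarrow> harmonic A B gM DM DP \<pi>)"
proof -
  have hcs: "horizontally_conformal_submersion A B gM gN dil \<pi>"
    using submersion by (simp add: conformal_anti_invariant_xi_perp_submersion_def)
  have sub: "smooth_map A B \<pi>" "\<And>q. surj (differential A B \<pi> q)"
    using hcs by (auto simp: horizontally_conformal_submersion_def submersion_def)
  have gM: "riemannian_metric A gM" and DM: "levi_civita A gM DM"
    using sasakian by (auto simp: sasakian_def almost_contact_metric_def)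
  have dil: "csmooth A UNIV dil" "\<And>q. dil q > 0"
    using hcs by (auto simp: horizontally_conformal_submersion_def smooth_fun_iff)
  have conf: "\<And>u v q. u \<in> horizontal A B gM \<pi> q \<Longrightarrow> v \<in> horizontal A B gM \<pi> q \<Longrightarrow>
      (dil q)\<^sup>2 * gM q u v = gN (\<pi> q) (differential A B \<pi> q u) (differential A B \<pi> q v)"
    using hcs by (auto simp: horizontally_conformal_submersion_def)
  have conn: "connection_along A B \<pi> DP" using nabla_pi by (simp add: pullback_connection_def)
  interpret conformal_setting A B \<pi> DP gN DN gM DM dil
    by unfold_locales (fact M N sub conn riemannian nabla_N nabla_pi gM DM dil conf)+
  have "DIM('k) \<noteq> 2" using N(2) nondegenerate by presburger
  then have "(tension_field A B gM DM DP \<pi> p = 0 \<and> fibre_mean_curvature A B gM DM \<pi> p = 0 \<longrightarrow>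
      horizontal_proj A B gM \<pi> p (gradient A gM dil p) = 0) \<and>
    (tension_field A B gM DM DP \<pi> p = 0 \<and> horizontal_proj A B gM \<pi> p (gradient A gM dil p) = 0 \<longrightarrow>
      fibre_mean_curvature A B gM DM \<pi> p = 0) \<and>
    (fibre_mean_curvature A B gM DM \<pi> p = 0 \<and> horizontal_proj A B gM \<pi> p (gradient A gM dil p) = 0 \<longrightarrow>
      tension_field A B gM DM DP \<pi> p = 0)" for p
    using adapted_frame_at[of p] adapted_frame.pointwise_equivalence by metis
  then show ?thesis
    unfolding harmonic_def minimal_fibres_def horizontally_homothetic_def by blast
qed

end
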